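(* On the torus $\mathbb{T}^2=\mathbb{R}^2/2\pi\mathbb{Z}^2$ consider the autonomous mechanical Lagrangian $$L(x,\dot x)=\frac{\alpha(x_1)}{2}\|\dot x\|^2-V(x_1),\qquad V(x_1)=-\frac{2+\cos2x_1}{2+\sin x_1},\qquad \alpha(x_1)=2+\sin x_1,$$ where $\|\cdot\|$ is the Euclidean norm. Let $I=\left[\frac{1}{3\sqrt2\,\pi},\frac{1}{\sqrt2\,\pi}\right]$. Then there are minimal ergodic measures $\mu_1$ and $\mu_2$, supported on periodic orbits projecting to the loops $x_1=\pi/2$ and $x_1=3\pi/2$, with rotation vectors $\left(0,\frac{1}{3\sqrt2\,\pi}\right)$ and $\left(0,\frac{1}{\sqrt2\,\pi}\right)$ respectively, and for every $\rho\in I$ the minimal measure with rotation vector $(0,\rho)$ is a convex combination of $\mu_1$ and $\mu_2$. Consequently there is no recurrent E-L minimizer with rotation vector $(0,\rho)$ for any $\rho$ in the interior of $I$.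
   Context: An E-L minimizer is a curve $\gamma:\mathbb{R}\to\mathbb{R}^2$ (the universal cover) such that every restriction $\gamma|_{[a,b]}$ minimizes $\int_a^bL(\gamma,\dot\gamma)\,dt$ ($L$ lifted to $T\mathbb{R}^2$) among absolutely continuous curves $[a,b]\to\mathbb{R}^2$ with the same endpoints. It is recurrent if the trajectory of the Euler-Lagrange (E-L) flow on $T\mathbb{T}^2$ obtained by projecting $(\gamma,\dot\gamma)$ is recurrent. Its rotation vector, normalized so that $H_1(\mathbb{T}^2;\mathbb{Z})=\mathbb{Z}^2$, is $\lim_{b-a\to\infty}\frac{1}{2\pi}\frac{\gamma(b)-\gamma(a)}{b-a}$, when the limit exists. For an E-L invariant Borel probability measure $\mu$ on $T\mathbb{T}^2$ with compact support, the rotation vector is $\rho(\mu)=\frac{1}{2\pi}\int\dot x\,d\mu(x,\dot x)\in\mathbb{R}^2$ and the average action is $A(\mu)=\int L\,d\mu$. The measure $\mu$ is minimal if $A(\mu)=\inf A(\nu)$ over all such invariant probability measures $\nu$ with $\rho(\nu)=\rho(\mu)$. *)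

theory Defs
  imports "HOL-Analysis.Analysis" "HOL-Probability.Probability"
begin

(* The norm of the product type real * real is the Euclidean norm. *)
type_synonym plane = "real \<times> real"

subsection \<open>The torus and its tangent bundle\<close>

definition lattice_rel :: "plane \<Rightarrow> plane \<Rightarrow> bool" where
  "lattice_rel x y \<longleftrightarrow> (\<exists>m n :: int. y = x + (2 * pi * of_int m, 2 * pi * of_int n))"

lemma equivp_lattice_rel: "equivp lattice_rel"
proof (rule equivpI)
  show "reflp lattice_rel"
  proof (rule reflpI)
    fix x :: plane
    have "x = x + (2 * pi * of_int 0, 2 * pi * of_int 0)" by (simp add: prod_eq_iff)
    then show "lattice_rel x x" unfolding lattice_rel_def by blast
  qed
  show "symp lattice_rel"
  proof (rule sympI)
    fix x y :: plane
    assume "lattice_rel x y"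
    then obtain m n :: int where "y = x + (2 * pi * of_int m, 2 * pi * of_int n)"
      unfolding lattice_rel_def by blast
    then have "x = y + (2 * pi * of_int (- m), 2 * pi * of_int (- n))"
      by (simp add: prod_eq_iff)
    then show "lattice_rel y x" unfolding lattice_rel_def by blast
  qed
  show "transp lattice_rel"
  proof (rule transpI)
    fix x y z :: plane
    assume "lattice_rel x y" "lattice_rel y z"
    then obtain m n k l :: int where
      "y = x + (2 * pi * of_int m, 2 * pi * of_int n)"
      "z = y + (2 * pi * of_int k, 2 * pi * of_int l)"
      unfolding lattice_rel_def by blast
    then have "z = x + (2 * pi * of_int (m + k), 2 * pi * of_int (n + l))"
      by (simp add: prod_eq_iff algebra_simps)
    then show "lattice_rel x z" unfolding lattice_rel_def by blast
  qed
qed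

quotient_type torus = plane / lattice_rel
  morphisms rep_torus torus_proj
  by (rule equivp_lattice_rel)

instantiation torus :: topological_space
begin

(* The quotient topology. *)
definition open_torus :: "torus set \<Rightarrow> bool" where
  "open_torus U \<longleftrightarrow> open (torus_proj -` U)"

instance
  by standard (auto simp: open_torus_def vimage_Union)

end

type_synonym tangent = "torus \<times> plane"

subsection \<open>The Lagrangian\<close>

definition mass :: "real \<Rightarrow> real" where
  "mass s = 2 + sin s"

definition potential :: "real \<Rightarrow> real" where
  "potential s = - (2 + cos (2 * s)) / (2 + sin s)"

definition Lag :: "plane \<Rightarrow> plane \<Rightarrow> real" where
  "Lag x v = mass (fst x) / 2 * (norm v)\<^sup>2 - potential (fst x)"

lemma Lag_pos: "Lag x v > 0"
proof -
  have a: "2 + sin s > 0" for s :: real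
    using sin_ge_minus_one[of s] by linarith
  have c: "2 + cos (2 * s) > 0" for s :: real
    using cos_ge_minus_one[of "2 * s"] by linarith
  have "(2 + cos (2 * fst x)) / (2 + sin (fst x)) > 0"
    using a c by simp
  moreover have "(2 + sin (fst x)) / 2 * (norm v)\<^sup>2 \<ge> 0"
    using a[of "fst x"] by simp
  moreover have "potential (fst x) = - ((2 + cos (2 * fst x)) / (2 + sin (fst x)))"
    unfolding potential_def by (rule minus_divide_left[symmetric])
  ultimately show ?thesis
    unfolding Lag_def mass_def by linarith
qed

lemma Lag_periodic:
  assumes "lattice_rel x y"
  shows "Lag x = Lag y"
proof -
  obtain m n :: int where y: "y = x + (2 * pi * of_int m, 2 * pi * of_int n)"
    using assms unfolding lattice_rel_def by blast
  have "sin (fst y) = sin (fst x)" "cos (fst y) = cos (fst x)"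
    unfolding y by (simp_all add: sin_add cos_add)
  then show ?thesis
    by (simp add: fun_eq_iff Lag_def mass_def potential_def cos_double_sin)
qed

lift_definition LagT :: "torus \<Rightarrow> plane \<Rightarrow> real" is Lag
  by (rule Lag_periodic)

subsection \<open>The Euler-Lagrange flow\<close>

definition velocity :: "(real \<Rightarrow> plane) \<Rightarrow> real \<Rightarrow> plane" where
  "velocity \<gamma> t = vector_derivative \<gamma> (at t)"

(* d/dt (dL/dv) = dL/dx along the curve, tested against every direction w. *)
definition EL_curve :: "(real \<Rightarrow> plane) \<Rightarrow> bool" where
  "EL_curve \<gamma> \<longleftrightarrow>
     (\<forall>t. \<gamma> differentiable at t) \<and>
     (\<forall>t w. ((\<lambda>s. frechet_derivative (\<lambda>v. Lag (\<gamma> s) v) (at (velocity \<gamma> s)) w)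
        has_real_derivative frechet_derivative (\<lambda>x. Lag x (velocity \<gamma> t)) (at (\<gamma> t)) w) (at t))"

definition tangent_lift :: "(real \<Rightarrow> plane) \<Rightarrow> real \<Rightarrow> tangent" where
  "tangent_lift \<gamma> t = (torus_proj (\<gamma> t), velocity \<gamma> t)"

(* Well defined: the Euler-Lagrange equation has unique global solutions (the energy is
   conserved), and two lifts of the same initial condition differ by a lattice translation. *)
definition EL_flow :: "real \<Rightarrow> tangent \<Rightarrow> tangent" where
  "EL_flow t w =
     (THE w'. \<exists>\<gamma>. EL_curve \<gamma> \<and> tangent_lift \<gamma> 0 = w \<and> tangent_lift \<gamma> t = w')"

definition EL_orbit :: "tangent \<Rightarrow> tangent set" where
  "EL_orbit w = range (\<lambda>t. EL_flow t w)"

definition periodic_orbit :: "tangent set \<Rightarrow> bool" where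
  "periodic_orbit Q \<longleftrightarrow> (\<exists>w T. T > 0 \<and> EL_flow T w = w \<and> Q = EL_orbit w)"

definition vertical_loop :: "real \<Rightarrow> torus set" where
  "vertical_loop c = {torus_proj (c, y) | y. True}"

definition recurrent_point :: "tangent \<Rightarrow> bool" where
  "recurrent_point w \<longleftrightarrow>
     (\<exists>s :: nat \<Rightarrow> real. filterlim s at_top sequentially \<and> (\<lambda>n. EL_flow (s n) w) \<longlonglongrightarrow> w)"

subsection \<open>Euler-Lagrange minimizers\<close>

definition abs_continuous_curve :: "real \<Rightarrow> real \<Rightarrow> (real \<Rightarrow> plane) \<Rightarrow> bool" where
  "abs_continuous_curve a b \<gamma> \<longleftrightarrow>
     (\<forall>\<epsilon>>0. \<exists>\<delta>>0. \<forall>(n :: nat) (s :: nat \<Rightarrow> real) (t :: nat \<Rightarrow> real).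
        (\<forall>i<n. a \<le> s i \<and> s i \<le> t i \<and> t i \<le> b) \<and>
        (\<forall>i<n. \<forall>j<n. i \<noteq> j \<longrightarrow> {s i<..<t i} \<inter> {s j<..<t j} = {}) \<and>
        (\<Sum>i<n. t i - s i) < \<delta> \<longrightarrow>
        (\<Sum>i<n. norm (\<gamma> (t i) - \<gamma> (s i))) < \<epsilon>)"

(* Lag is positive by Lag_pos, so ennreal truncates nothing; absolutely continuous curves
   whose action diverges get the value infinity. *)
definition curve_action :: "real \<Rightarrow> real \<Rightarrow> (real \<Rightarrow> plane) \<Rightarrow> ennreal" where
  "curve_action a b \<gamma> =
     (\<integral>\<^sup>+ t \<in> {a..b}. ennreal (Lag (\<gamma> t) (vector_derivative \<gamma> (at t within {a..b}))) \<partial>lebesgue)"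

definition EL_minimizer :: "(real \<Rightarrow> plane) \<Rightarrow> bool" where
  "EL_minimizer \<gamma> \<longleftrightarrow>
     (\<forall>a b. a < b \<longrightarrow> abs_continuous_curve a b \<gamma> \<and>
        (\<forall>\<eta>. abs_continuous_curve a b \<eta> \<and> \<eta> a = \<gamma> a \<and> \<eta> b = \<gamma> b \<longrightarrow>
           curve_action a b \<gamma> \<le> curve_action a b \<eta>))"

(* (\<gamma>, \<gamma>') projects to a trajectory of the flow, and that trajectory is recurrent. For an
   Euler-Lagrange minimizer the first conjunct holds automatically, by Tonelli regularity. *)
definition recurrent_curve :: "(real \<Rightarrow> plane) \<Rightarrow> bool" where
  "recurrent_curve \<gamma> \<longleftrightarrow> EL_curve \<gamma> \<and> recurrent_point (tangent_lift \<gamma> 0)"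

definition has_rotation_vector :: "(real \<Rightarrow> plane) \<Rightarrow> plane \<Rightarrow> bool" where
  "has_rotation_vector \<gamma> r \<longleftrightarrow>
     ((\<lambda>(a, b). (1 / (2 * pi)) *\<^sub>R ((\<gamma> b - \<gamma> a) /\<^sub>R (b - a))) \<longlongrightarrow> r)
        (filtercomap (\<lambda>(a, b). b - a) at_top)"

subsection \<open>Invariant and minimal measures\<close>

definition msupport :: "'a :: topological_space measure \<Rightarrow> 'a set" where
  "msupport \<mu> = {w. \<forall>U. open U \<and> w \<in> U \<longrightarrow> emeasure \<mu> U > 0}"

definition invariant_prob :: "tangent measure \<Rightarrow> bool" where
  "invariant_prob \<mu> \<longleftrightarrow>
     prob_space \<mu> \<and> sets \<mu> = sets borel \<and> compact (msupport \<mu>) \<and>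
     (\<forall>t. \<forall>A \<in> sets borel. emeasure \<mu> (EL_flow t -` A) = emeasure \<mu> A)"

definition rotation :: "tangent measure \<Rightarrow> plane" where
  "rotation \<mu> = (1 / (2 * pi)) *\<^sub>R (\<integral>w. snd w \<partial>\<mu>)"

definition average_action :: "tangent measure \<Rightarrow> real" where
  "average_action \<mu> = (\<integral>w. LagT (fst w) (snd w) \<partial>\<mu>)"

definition minimal_measure :: "tangent measure \<Rightarrow> bool" where
  "minimal_measure \<mu> \<longleftrightarrow> invariant_prob \<mu> \<and>
     average_action \<mu> = (INF \<nu> \<in> {\<nu>. invariant_prob \<nu> \<and> rotation \<nu> = rotation \<mu>}. average_action \<nu>)"

definition ergodic_measure :: "tangent measure \<Rightarrow> bool" where
  "ergodic_measure \<mu> \<longleftrightarrow> invariant_prob \<mu> \<and>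
     (\<forall>A \<in> sets borel. (\<forall>t. EL_flow t -` A = A) \<longrightarrow> measure \<mu> A = 0 \<or> measure \<mu> A = 1)"

definition convex_combination :: "'a measure \<Rightarrow> 'a measure \<Rightarrow> 'a measure \<Rightarrow> bool" where
  "convex_combination \<mu> \<mu>1 \<mu>2 \<longleftrightarrow> sets \<mu> = sets \<mu>1 \<and> sets \<mu> = sets \<mu>2 \<and>
     (\<exists>c \<in> {0..1}. \<forall>A \<in> sets \<mu>. measure \<mu> A = (1 - c) * measure \<mu>1 A + c * measure \<mu>2 A)"

end

theory Submission
  imports Defs
begin

text \<open>
The theorem rests on a calibration. Write \<open>\<alpha>\<close> for \<open>mass x1\<close>. Completing squares gives
\<open>L - sqrt 2 * v2 = \<alpha>/2 * v1\<^sup>2 + \<alpha>/2 * (v2 - sqrt 2 / \<alpha>)\<^sup>2 + 2 * (cos x1)\<^sup>2 / \<alpha>\<close> (\<open>Lag_calibrated\<close>), which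
is nonnegative and vanishes exactly on two periodic orbits, the vertical loops \<open>x1 = pi/2\<close> and
\<open>x1 = 3 * pi/2\<close> run through with momentum \<open>\<alpha> * v2 = sqrt 2\<close>. As \<open>sqrt 2 dx2\<close> is closed, it integrates to
a linear function of the rotation vector.

Measures. The average action of an invariant measure with rotation vector \<open>(0, \<rho>)\<close> is at least
\<open>sqrt 2 * 2 * pi * \<rho>\<close>, with equality iff the measure is carried by the two loops
(\<open>average_action_ge\<close>). On a periodic orbit the only invariant probability measure is the uniform one, so a
measure carried by the loops is a mixture of the two uniform measures
(\<open>emeasure_invariant_on_loops\<close>), and the mixture is determined by its rotation vector. For \<open>\<rho>\<close> in the
interval between the rotation numbers of the loops the required mixture exists, so it is the unique
minimal measure (\<open>minimal_measure_iff\<close>).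

Curves. Let a recurrent minimizer have rotation vector \<open>(0, \<rho>)\<close> with \<open>\<rho>\<close> in the interior of the
interval. A competitor that follows one loop and then the other realizes the same mean displacement
with an arbitrarily small mean excess \<open>L - sqrt 2 * v2\<close>; by minimality the excess of the curve has infimum 0
(\<open>minimizer_excess_inf\<close>). Now the system is integrable: the momentum and the energy are conserved,
and the excess controls their distance from the values \<open>sqrt 2\<close> and 0, which they therefore take
(\<open>zero_energy_of_excess_inf\<close>). On this level \<open>\<alpha> * v1 = \<plusminus> 2 * cos x1\<close>, so the orbits are the two loops
and heteroclinic orbits between them. The latter are not recurrent, since \<open>sin x1\<close> is strictly monotone along
them (\<open>recurrent_calibrated_curve_vertical\<close>), and the former have the endpoints of the interval as rotation
numbers.

Foundations. The flow is defined by a definite description over global solutions, and invariance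
of a measure refers to preimages of Borel sets under it, so existence, uniqueness and continuity of
the flow on the whole tangent bundle are needed. They follow from the theory of globally
Lipschitz equations after a change of the first coordinate that makes the mass constant.
\<close>

section \<open>Differential equations with globally Lipschitz right-hand side\<close>

text \<open>
Subtracting the integral over \<open>{t..0}\<close>, which vanishes for positive \<open>t\<close>, turns the unoriented
integral into an oriented one.
\<close>
lemma continuous_has_primitive:
  fixes g :: "real \<Rightarrow> 'a::banach"
  assumes "continuous_on UNIV g"
  obtains G where "G 0 = 0" "\<And>t. (G has_vector_derivative g t) (at t)"
proof -
  define G where "G = (\<lambda>t. integral {0..t} g - integral {t..0} g)"
  have "(G has_vector_derivative g t) (at t)" for t
  proof -
    define N where "N = \<bar>t\<bar> + 1"
    have int: "g integrable_on {a..b}" for a b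
      using assms by (intro integrable_continuous_real) (auto intro: continuous_on_subset)
    have eq: "G s = integral {-N..s} g - integral {-N..0} g" if "s \<in> {-N..N}" for s
    proof (cases "s \<ge> 0")
      case True
      then have "integral {-N..0} g + integral {0..s} g = integral {-N..s} g"
        using that by (intro Henstock_Kurzweil_Integration.integral_combine int) (auto simp: N_def)
      moreover have "integral {s..0} g = 0" using True by (cases "s = 0") auto
      ultimately show ?thesis by (simp add: G_def algebra_simps)
    next
      case False
      then have "integral {-N..s} g + integral {s..0} g = integral {-N..0} g"
        using that by (intro Henstock_Kurzweil_Integration.integral_combine int) (auto simp: N_def)
      moreover have "integral {0..s} g = 0" using False by auto
      ultimately show ?thesis by (simp add: G_def algebra_simps)
    qed
    have t: "t \<in> {-N<..<N}" by (auto simp: N_def)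
    have "((\<lambda>s. integral {-N..s} g - integral {-N..0} g) has_vector_derivative g t - 0)
        (at t within {-N..N})"
      using t assms
      by (intro has_vector_derivative_diff integral_has_vector_derivative
          has_vector_derivative_const) (auto intro: continuous_on_subset)
    then have "((\<lambda>s. integral {-N..s} g - integral {-N..0} g) has_vector_derivative g t) (at t)"
      using t by (simp add: at_within_Icc_at)
    then show "(G has_vector_derivative g t) (at t)"
      by (rule has_vector_derivative_transform_within_open[where S="{-N<..<N}"]) (use t eq in auto)
  qed
  moreover have "G 0 = 0" by (simp add: G_def)
  ultimately show thesis using that by blast
qed

text \<open>
The even bound \<open>b \<bar>t\<bar>\<close> serves both time directions at once; negative times reduce to positive ones
by reversing time.
\<close>
lemma norm_primitive_le:
  fixes G :: "real \<Rightarrow> 'a::real_normed_vector"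
  assumes G: "\<And>t. (G has_vector_derivative g t) (at t)"
    and B: "\<And>t. (B has_real_derivative b t) (at t)"
    and le: "\<And>t. norm (g t) \<le> b \<bar>t\<bar>"
  shows "norm (G t - G 0) \<le> B \<bar>t\<bar> - B 0"
proof -
  have cB: "continuous_on X B" for X
    using B by (meson DERIV_isCont continuous_at_imp_continuous_on)
  have *: "norm (H t - H 0) \<le> B t - B 0"
    if "t > 0" "\<And>t. (H has_vector_derivative h t) (at t)" "\<And>t. norm (h t) \<le> b \<bar>t\<bar>"
    for H :: "real \<Rightarrow> 'a" and h t
  proof (rule differentiable_bound_general[OF that(1) _ cB])
    show "continuous_on {0..t} H"
      using that(2) by (meson has_vector_derivative_continuous continuous_at_imp_continuous_on)
    show "(H has_vector_derivative h x) (at x)" for x by (rule that(2))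
    show "(B has_vector_derivative b x) (at x)" for x
      using B[of x] by (simp add: has_real_derivative_iff_has_vector_derivative)
    show "norm (h x) \<le> b x" if "0 < x" for x using \<open>\<And>t. norm (h t) \<le> b \<bar>t\<bar>\<close>[of x] that by simp
  qed
  consider "t > 0" | "t = 0" | "t < 0" by linarith
  then show ?thesis
  proof cases
    case 1 then show ?thesis using *[OF 1 G le] by simp
  next
    case 2 then show ?thesis by simp
  next
    case 3
    have "((\<lambda>s. G (- s)) has_vector_derivative - g (- s)) (at s)" for s
      using vector_diff_chain_at[OF has_vector_derivative_minus[OF has_vector_derivative_id] G[of "- s"]]
      by (simp add: o_def)
    from *[of "- t", OF _ this] 3 le show ?thesis
      by (metis abs_minus_cancel abs_of_neg add.inverse_inverse minus_zero neg_0_less_iff_less norm_minus_cancel)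
  qed
qed

text \<open>
The integral operator is a contraction on all of the real line after rescaling by an exponential
weight (Bielecki's norm): writing a solution as \<open>z0 + exp (K * \<bar>t\<bar>) *\<^sub>R u t\<close> with \<open>u\<close> bounded and
continuous, integration gains a factor \<open>1 / K\<close>, which beats the Lipschitz constant. One
application of Banach's theorem thus gives a global solution, with no gluing of local ones.
\<close>
lemma lipschitz_ode_exists:
  fixes f :: "'a::banach \<Rightarrow> 'a"
  assumes lip: "\<And>x y. norm (f x - f y) \<le> L * norm (x - y)"
  obtains z where "z 0 = z0" "\<And>t. (z has_vector_derivative f (z t)) (at t)"
proof -
  \<comment> \<open>Half the exponential rate bounds the Lipschitz constant, which gives the contraction constant 1/2.\<close>
  define K where "K = 2 * \<bar>L\<bar> + 1"
  have K: "K \<ge> 1" "\<bar>L\<bar> / K \<le> 1/2" by (auto simp: K_def field_simps)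
  have lip': "norm (f x - f y) \<le> \<bar>L\<bar> * norm (x - y)" for x y
    using lip[of x y] by (smt (verit) mult_right_mono norm_ge_zero)
  have "(\<bar>L\<bar>)-lipschitz_on UNIV f"
    by (rule lipschitz_onI) (use lip' in \<open>auto simp: dist_norm\<close>)
  then have contf: "continuous_on UNIV f" by (rule lipschitz_on_continuous_on)
  define Z where "Z = (\<lambda>(u::real \<Rightarrow>\<^sub>C 'a) t. z0 + exp (K * \<bar>t\<bar>) *\<^sub>R apply_bcontfun u t)"
  have contZ: "continuous_on UNIV (Z u)" for u
    unfolding Z_def by (intro continuous_intros) auto
  have "\<exists>G. \<forall>u. G u 0 = 0 \<and> (\<forall>t. (G u has_vector_derivative f (Z u t)) (at t))"
  proof (rule choice_iff[THEN iffD1], rule allI)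
    fix u
    have "continuous_on UNIV (\<lambda>t. f (Z u t))"
      using continuous_on_compose2[OF contf contZ[of u]] by simp
    from continuous_has_primitive[OF this] show
      "\<exists>G. G 0 = 0 \<and> (\<forall>t. (G has_vector_derivative f (Z u t)) (at t))" by metis
  qed
  then obtain G where G0: "\<And>u. G u 0 = 0"
    and G: "\<And>u t. (G u has_vector_derivative f (Z u t)) (at t)" by metis
  have contG: "continuous_on UNIV (G u)" for u
    using G by (meson has_vector_derivative_continuous continuous_at_imp_continuous_on)
  have E: "((\<lambda>t. C * exp (K * t) / K) has_real_derivative C * exp (K * t)) (at t)" for C t
    using K by (auto intro!: derivative_eq_intros)
  have exp1: "exp (K * \<bar>t\<bar>) \<ge> 1" for t using K by simp
  have bound: "norm (exp (- (K * \<bar>t\<bar>)) *\<^sub>R G u t) \<le> norm (f z0) + \<bar>L\<bar> * norm u" for u t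
  proof -
    have "norm (f (Z u t)) \<le> (norm (f z0) + \<bar>L\<bar> * norm u) * exp (K * \<bar>t\<bar>)" for t
    proof -
      have "norm (f (Z u t)) \<le> norm (f z0) + norm (f (Z u t) - f z0)"
        using norm_triangle_sub[of "f (Z u t)" "f z0"] by simp
      also have "\<dots> \<le> norm (f z0) + \<bar>L\<bar> * (exp (K * \<bar>t\<bar>) * norm (apply_bcontfun u t))"
        using lip'[of "Z u t" z0] by (simp add: Z_def)
      also have "\<dots> \<le> norm (f z0) * exp (K * \<bar>t\<bar>) + \<bar>L\<bar> * (exp (K * \<bar>t\<bar>) * norm u)"
        using exp1[of t] norm_bounded[of u t]
        by (intro add_mono mult_left_mono) (auto simp: mult_le_cancel_left1)
      finally show ?thesis by (simp add: algebra_simps)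
    qed
    from norm_primitive_le[OF G E this, where t=t] G0
    have "norm (G u t) \<le> (norm (f z0) + \<bar>L\<bar> * norm u) * exp (K * \<bar>t\<bar>) / K
        - (norm (f z0) + \<bar>L\<bar> * norm u) / K" by simp
    also have "\<dots> \<le> (norm (f z0) + \<bar>L\<bar> * norm u) * exp (K * \<bar>t\<bar>)"
    proof -
      have "c * E / K - c / K \<le> c * E" if "c \<ge> 0" "E \<ge> 0" for c E
      proof -
        have "c * E / K \<le> c * E / 1" using K that by (intro divide_left_mono) auto
        moreover have "c / K \<ge> 0" using K that by auto
        ultimately show ?thesis by simp
      qed
      then show ?thesis by simp
    qed
    finally have "exp (- (K * \<bar>t\<bar>)) * norm (G u t)
       \<le> exp (- (K * \<bar>t\<bar>)) * ((norm (f z0) + \<bar>L\<bar> * norm u) * exp (K * \<bar>t\<bar>))"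
      by (intro mult_left_mono) auto
    then show ?thesis by (simp add: exp_minus field_simps)
  qed
  define T where "T = (\<lambda>u. Bcontfun (\<lambda>t. exp (- (K * \<bar>t\<bar>)) *\<^sub>R G u t))"
  have T: "apply_bcontfun (T u) t = exp (- (K * \<bar>t\<bar>)) *\<^sub>R G u t" for u t
  proof -
    have "(\<lambda>t. exp (- (K * \<bar>t\<bar>)) *\<^sub>R G u t) \<in> bcontfun"
      by (rule bcontfun_normI[OF _ bound]) (intro continuous_intros contG)
    then show ?thesis by (simp add: T_def Bcontfun_inverse)
  qed
  have contr: "dist (T u) (T w) \<le> 1/2 * dist u w" for u w
  proof (rule dist_bound)
    fix t
    have D: "((\<lambda>t. G u t - G w t) has_vector_derivative f (Z u t) - f (Z w t)) (at t)" for t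
      by (intro has_vector_derivative_diff G)
    have "norm (f (Z u t) - f (Z w t)) \<le> (\<bar>L\<bar> * dist u w) * exp (K * \<bar>t\<bar>)" for t
    proof -
      have "norm (f (Z u t) - f (Z w t)) \<le> \<bar>L\<bar> * norm (Z u t - Z w t)" by (rule lip')
      also have "\<dots> \<le> \<bar>L\<bar> * (exp (K * \<bar>t\<bar>) * dist u w)"
      proof (rule mult_left_mono)
        have "Z u t - Z w t = exp (K * \<bar>t\<bar>) *\<^sub>R (apply_bcontfun u t - apply_bcontfun w t)"
          by (simp add: Z_def scaleR_diff_right)
        then show "norm (Z u t - Z w t) \<le> exp (K * \<bar>t\<bar>) * dist u w"
          using dist_bounded[of u t w] by (simp add: dist_norm)
      qed simp
      finally show ?thesis by (simp add: mult_ac)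
    qed
    from norm_primitive_le[OF D E this, where t=t] G0
    have "norm (G u t - G w t) \<le> \<bar>L\<bar> * dist u w * exp (K * \<bar>t\<bar>) / K - \<bar>L\<bar> * dist u w / K" by simp
    also have "\<dots> \<le> (\<bar>L\<bar> / K) * dist u w * exp (K * \<bar>t\<bar>)" using K by simp
    also have "\<dots> \<le> (1/2) * dist u w * exp (K * \<bar>t\<bar>)" using K by (intro mult_right_mono) auto
    finally have "exp (- (K * \<bar>t\<bar>)) * norm (G u t - G w t)
       \<le> exp (- (K * \<bar>t\<bar>)) * ((1/2) * dist u w * exp (K * \<bar>t\<bar>))"
      by (intro mult_left_mono) auto
    also have "\<dots> = 1/2 * dist u w" by (simp add: exp_minus field_simps)
    finally show "dist (apply_bcontfun (T u) t) (apply_bcontfun (T w) t) \<le> 1/2 * dist u w"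
      by (simp add: T dist_norm flip: scaleR_diff_right)
  qed
  have "\<exists>!u. T u = u"
    by (rule banach_fix_type[where c="1/2"]) (use contr in auto)
  then obtain u where u: "T u = u" by auto
  have Zu: "Z u t = z0 + G u t" for t
    using T[of u t] unfolding u by (simp add: Z_def flip: exp_add)
  show ?thesis
  proof
    show "Z u 0 = z0" using Zu[of 0] G0 by simp
    show "(Z u has_vector_derivative f (Z u t)) (at t)" for t
      using has_vector_derivative_add[OF has_vector_derivative_const[of z0] G[of u t]]
      by (simp add: Zu[abs_def])
  qed
qed

text \<open>
Both estimates say that \<open>D t * exp (- C * t)\<close> decreases and \<open>D t * exp (C * t)\<close> increases. The
lower one shows that a nonnegative \<open>D\<close> with \<open>D 0 > 0\<close> never vanishes.
\<close>
lemma gronwall_scalar: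
  fixes D :: "real \<Rightarrow> real"
  assumes D: "\<And>t. (D has_real_derivative D' t) (at t)"
    and le: "\<And>t. \<bar>D' t\<bar> \<le> C * D t"
  shows "D t \<le> D 0 * exp (C * \<bar>t\<bar>)" and "D 0 * exp (- (C * \<bar>t\<bar>)) \<le> D t"
proof -
  have A: "((\<lambda>t. D t * exp (- (C * t))) has_real_derivative (D' t - C * D t) * exp (- (C * t))) (at t)" for t
    by (auto intro!: derivative_eq_intros D simp: algebra_simps)
  have B: "((\<lambda>t. D t * exp (C * t)) has_real_derivative (D' t + C * D t) * exp (C * t)) (at t)" for t
    by (auto intro!: derivative_eq_intros D simp: algebra_simps)
  have down: "D b * exp (- (C * b)) \<le> D a * exp (- (C * a))" if "a \<le> b" for a b
  proof (rule DERIV_nonpos_imp_nonincreasing[OF that])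
    fix x show "\<exists>y. ((\<lambda>t. D t * exp (- (C * t))) has_real_derivative y) (at x) \<and> y \<le> 0"
      using A[of x] le[of x] by (auto intro!: mult_nonpos_nonneg simp: abs_le_iff)
  qed
  have up: "D a * exp (C * a) \<le> D b * exp (C * b)" if "a \<le> b" for a b
  proof (rule DERIV_nonneg_imp_nondecreasing[OF that])
    fix x
    have "0 \<le> (D' x + C * D x) * exp (C * x)"
      using le[of x] by (intro mult_nonneg_nonneg) (auto simp: abs_le_iff)
    then show "\<exists>y. ((\<lambda>t. D t * exp (C * t)) has_real_derivative y) (at x) \<and> 0 \<le> y"
      using B[of x] by blast
  qed
  have *: "D t \<le> D 0 * exp (C * \<bar>t\<bar>) \<and> D 0 * exp (- (C * \<bar>t\<bar>)) \<le> D t"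
  proof (cases "t \<ge> 0")
    case True
    with down[of 0 t] up[of 0 t] show ?thesis by (simp add: exp_minus field_simps)
  next
    case False
    with down[of t 0] up[of t 0] show ?thesis by (simp add: exp_minus field_simps)
  qed
  show "D t \<le> D 0 * exp (C * \<bar>t\<bar>)" "D 0 * exp (- (C * \<bar>t\<bar>)) \<le> D t" using * by auto
qed

text \<open>
The constant \<open>e\<close> accounts for comparing solutions of two different equations. Adding \<open>e\<^sup>2\<close> to the
square norm absorbs it, by \<open>2 * a * e \<le> a\<^sup>2 + e\<^sup>2\<close>, into a homogeneous inequality.
\<close>
lemma gronwall_norm:
  fixes z :: "real \<Rightarrow> 'a::real_inner"
  assumes z: "\<And>t. (z has_vector_derivative z' t) (at t)"
    and le: "\<And>t. norm (z' t) \<le> K * norm (z t) + e" and K: "K \<ge> 0"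
  shows "(norm (z t))\<^sup>2 \<le> ((norm (z 0))\<^sup>2 + e\<^sup>2) * exp ((2 * K + 1) * \<bar>t\<bar>)"
proof -
  \<comment> \<open>The square of the norm, unlike the norm, is differentiable at the zeros of \<open>z\<close>.\<close>
  define D where "D = (\<lambda>t. z t \<bullet> z t + e\<^sup>2)"
  have D: "(D has_real_derivative 2 * (z t \<bullet> z' t)) (at t)" for t
  proof -
    have "(z has_derivative (\<lambda>h. h *\<^sub>R z' t)) (at t)" using z[of t] by (simp add: has_vector_derivative_def)
    from has_derivative_add[OF has_derivative_inner[OF this this] has_derivative_const[of "e\<^sup>2"]]
    show ?thesis unfolding D_def has_field_derivative_def
      by (rule has_derivative_eq_rhs) (auto simp: fun_eq_iff inner_commute algebra_simps)
  qed
  have b: "\<bar>2 * (z t \<bullet> z' t)\<bar> \<le> (2 * K + 1) * D t" for t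
  proof -
    have "\<bar>z t \<bullet> z' t\<bar> \<le> norm (z t) * norm (z' t)" by (rule Cauchy_Schwarz_ineq2)
    also have "\<dots> \<le> norm (z t) * (K * norm (z t) + e)" using le by (intro mult_left_mono) auto
    finally have "\<bar>2 * (z t \<bullet> z' t)\<bar> \<le> 2 * K * (norm (z t))\<^sup>2 + 2 * norm (z t) * e"
      by (simp add: power2_eq_square algebra_simps)
    also have "\<dots> \<le> 2 * K * (norm (z t))\<^sup>2 + (norm (z t))\<^sup>2 + e\<^sup>2"
      using sum_squares_bound[of "norm (z t)" e] by simp
    also have "\<dots> \<le> (2 * K + 1) * D t" using K
      by (simp add: D_def power2_norm_eq_inner algebra_simps)
    finally show ?thesis .
  qed
  from gronwall_scalar(1)[OF D b, of t] show ?thesis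
    by (simp add: D_def power2_norm_eq_inner) (smt (verit) zero_le_power2)
qed

section \<open>The Euler-Lagrange equation in coordinates\<close>

lemma mass_bounds: "1 \<le> mass x" "mass x \<le> 3"
  using sin_ge_minus_one[of x] sin_le_one[of x] by (auto simp: mass_def simp del: sin_le_one sin_ge_minus_one)

lemma mass_pos [simp]: "0 < mass x" "mass x \<noteq> 0" "0 \<le> mass x" "\<not> mass x < 0"
  using mass_bounds(1)[of x] by auto

lemma DERIV_mass: "(mass has_real_derivative cos x) (at x)"
  unfolding mass_def[abs_def] by (auto intro!: derivative_eq_intros)

definition neg_potential_deriv :: "real \<Rightarrow> real" where
  "neg_potential_deriv x = - 2 * sin (2 * x) / mass x - (2 + cos (2 * x)) * cos x / (mass x)\<^sup>2"

lemma DERIV_potential: "(potential has_real_derivative - neg_potential_deriv x) (at x)"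
  unfolding potential_def[abs_def] neg_potential_deriv_def mass_def[symmetric]
  by (auto intro!: derivative_eq_intros DERIV_mass simp: field_simps power2_eq_square)

lemma power2_norm_plane: "(norm (v::plane))\<^sup>2 = (fst v)\<^sup>2 + (snd v)\<^sup>2"
  by (simp add: norm_prod_def)

lemma frechet_Lag_velocity:
  "frechet_derivative (\<lambda>v. Lag x v) (at v) w = mass (fst x) * (v \<bullet> w)"
proof -
  have "((\<lambda>v. Lag x v) has_derivative (\<lambda>w. mass (fst x) * (v \<bullet> w))) (at v)"
    unfolding Lag_def power2_norm_eq_inner
    by (auto intro!: derivative_eq_intros simp: inner_commute)
  then show ?thesis by (simp add: frechet_derivative_at[symmetric])
qed

lemma frechet_Lag_position:
  "frechet_derivative (\<lambda>x. Lag x v) (at x) w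
     = fst w * (cos (fst x) / 2 * (norm v)\<^sup>2 + neg_potential_deriv (fst x))"
proof -
  have "((\<lambda>s. mass s / 2 * (norm v)\<^sup>2 - potential s) has_real_derivative
      (cos (fst x) / 2 * (norm v)\<^sup>2 + neg_potential_deriv (fst x))) (at (fst x))"
    by (auto intro!: derivative_eq_intros DERIV_mass DERIV_potential)
  then have "((\<lambda>s. mass s / 2 * (norm v)\<^sup>2 - potential s) has_derivative
      (\<lambda>h. (cos (fst x) / 2 * (norm v)\<^sup>2 + neg_potential_deriv (fst x)) * h)) (at (fst x))"
    by (simp add: has_field_derivative_def)
  from has_derivative_compose[OF has_derivative_fst[OF has_derivative_ident] this]
  have "((\<lambda>x. Lag x v) has_derivative
      (\<lambda>w. (cos (fst x) / 2 * (norm v)\<^sup>2 + neg_potential_deriv (fst x)) * fst w)) (at x)"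
    unfolding Lag_def .
  then show ?thesis by (simp add: frechet_derivative_at[symmetric])
qed

text \<open>
The Euler-Lagrange equation is linear in the test direction, so it amounts to its two components. As
the Lagrangian does not depend on the second coordinate, the second component is the conservation
of the momentum \<open>mass * v2\<close>.
\<close>
lemma EL_curve_iff:
  "EL_curve \<gamma> \<longleftrightarrow>
     (\<forall>t. (\<gamma> has_vector_derivative velocity \<gamma> t) (at t)) \<and>
     (\<forall>t. ((\<lambda>s. mass (fst (\<gamma> s)) * fst (velocity \<gamma> s)) has_real_derivative
        cos (fst (\<gamma> t)) / 2 * (norm (velocity \<gamma> t))\<^sup>2 + neg_potential_deriv (fst (\<gamma> t))) (at t)) \<and>
     (\<forall>t. ((\<lambda>s. mass (fst (\<gamma> s)) * snd (velocity \<gamma> s)) has_real_derivative 0) (at t))"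
  (is "_ \<longleftrightarrow> ?D \<and> ?A \<and> ?B")
proof -
  have "(\<forall>t. \<gamma> differentiable at t) \<longleftrightarrow> ?D"
    unfolding velocity_def using vector_derivative_works by blast
  moreover have "(\<forall>t w. ((\<lambda>s. mass (fst (\<gamma> s)) * (velocity \<gamma> s \<bullet> w)) has_real_derivative
      fst w * (cos (fst (\<gamma> t)) / 2 * (norm (velocity \<gamma> t))\<^sup>2 + neg_potential_deriv (fst (\<gamma> t)))) (at t))
      \<longleftrightarrow> ?A \<and> ?B" (is "?W \<longleftrightarrow> _")
  proof
    assume W: ?W
    have ?A using W[THEN spec, THEN spec[of _ "(1, 0)"]] by (simp add: inner_prod_def)
    moreover have ?B using W[THEN spec, THEN spec[of _ "(0, 1)"]] by (simp add: inner_prod_def)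
    ultimately show "?A \<and> ?B" ..
  next
    assume AB: "?A \<and> ?B"
    show ?W
    proof (intro allI)
      fix t w
      from AB have "((\<lambda>s. fst w * (mass (fst (\<gamma> s)) * fst (velocity \<gamma> s))
          + snd w * (mass (fst (\<gamma> s)) * snd (velocity \<gamma> s))) has_real_derivative
          fst w * (cos (fst (\<gamma> t)) / 2 * (norm (velocity \<gamma> t))\<^sup>2 + neg_potential_deriv (fst (\<gamma> t)))
          + snd w * 0) (at t)"
        by (intro DERIV_add DERIV_cmult) auto
      then show "((\<lambda>s. mass (fst (\<gamma> s)) * (velocity \<gamma> s \<bullet> w)) has_real_derivative
        fst w * (cos (fst (\<gamma> t)) / 2 * (norm (velocity \<gamma> t))\<^sup>2 + neg_potential_deriv (fst (\<gamma> t)))) (at t)"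
        by (simp add: inner_prod_def algebra_simps)
    qed
  qed
  ultimately show ?thesis
    unfolding EL_curve_def frechet_Lag_velocity frechet_Lag_position by blast
qed

lemma has_real_derivative_fst_snd:
  fixes \<gamma> :: "real \<Rightarrow> plane"
  assumes "(\<gamma> has_vector_derivative v) (at t)"
  shows "((\<lambda>t. fst (\<gamma> t)) has_real_derivative fst v) (at t)"
    and "((\<lambda>t. snd (\<gamma> t)) has_real_derivative snd v) (at t)"
proof -
  have "(\<gamma> has_derivative (\<lambda>h. h *\<^sub>R v)) (at t)" using assms by (simp add: has_vector_derivative_def)
  from has_derivative_fst[OF this] has_derivative_snd[OF this]
  show "((\<lambda>t. fst (\<gamma> t)) has_real_derivative fst v) (at t)"
    and "((\<lambda>t. snd (\<gamma> t)) has_real_derivative snd v) (at t)"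
    by (auto simp: has_field_derivative_def mult.commute[of _ "fst v"] mult.commute[of _ "snd v"])
qed

lemma EL_curveD:
  assumes "EL_curve \<gamma>"
  shows "(\<gamma> has_vector_derivative velocity \<gamma> t) (at t)"
    and "((\<lambda>t. fst (\<gamma> t)) has_real_derivative fst (velocity \<gamma> t)) (at t)"
    and "((\<lambda>t. snd (\<gamma> t)) has_real_derivative snd (velocity \<gamma> t)) (at t)"
    and "((\<lambda>s. mass (fst (\<gamma> s)) * fst (velocity \<gamma> s)) has_real_derivative
        cos (fst (\<gamma> t)) / 2 * (norm (velocity \<gamma> t))\<^sup>2 + neg_potential_deriv (fst (\<gamma> t))) (at t)"
    and "mass (fst (\<gamma> t)) * snd (velocity \<gamma> t) = mass (fst (\<gamma> 0)) * snd (velocity \<gamma> 0)"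
proof -
  show *: "(\<gamma> has_vector_derivative velocity \<gamma> t) (at t)"
    using assms unfolding EL_curve_iff by blast
  from has_real_derivative_fst_snd[OF *]
  show "((\<lambda>t. fst (\<gamma> t)) has_real_derivative fst (velocity \<gamma> t)) (at t)"
    "((\<lambda>t. snd (\<gamma> t)) has_real_derivative snd (velocity \<gamma> t)) (at t)" by auto
  show "((\<lambda>s. mass (fst (\<gamma> s)) * fst (velocity \<gamma> s)) has_real_derivative
        cos (fst (\<gamma> t)) / 2 * (norm (velocity \<gamma> t))\<^sup>2 + neg_potential_deriv (fst (\<gamma> t))) (at t)"
    using assms unfolding EL_curve_iff by blast
  have "((\<lambda>s. mass (fst (\<gamma> s)) * snd (velocity \<gamma> s)) has_real_derivative 0) (at t)" for t
    using assms unfolding EL_curve_iff by blast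
  from DERIV_isconst_all[OF allI[OF this]]
  show "mass (fst (\<gamma> t)) * snd (velocity \<gamma> t) = mass (fst (\<gamma> 0)) * snd (velocity \<gamma> 0)" by blast
qed

text \<open>
A candidate velocity \<open>v\<close> is passed separately, so that the derivative need not be computed through
the definite description behind the vector derivative.
\<close>
lemma EL_curveI:
  assumes "\<And>t. (\<gamma> has_vector_derivative v t) (at t)"
    and "\<And>t. ((\<lambda>s. mass (fst (\<gamma> s)) * fst (v s)) has_real_derivative
        cos (fst (\<gamma> t)) / 2 * (norm (v t))\<^sup>2 + neg_potential_deriv (fst (\<gamma> t))) (at t)"
    and "\<And>t. mass (fst (\<gamma> t)) * snd (v t) = p"
  shows "EL_curve \<gamma>" "velocity \<gamma> = v"
proof -
  show v: "velocity \<gamma> = v"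
    unfolding velocity_def using vector_derivative_at[OF assms(1)] by blast
  show "EL_curve \<gamma>"
    unfolding EL_curve_iff v using assms by auto
qed

lemma EL_curve_translate:
  assumes "EL_curve \<gamma>" and c: "\<And>x. sin (x + fst c) = sin x" "\<And>x. cos (x + fst c) = cos x"
  shows "EL_curve (\<lambda>t. \<gamma> t + c)" "velocity (\<lambda>t. \<gamma> t + c) = velocity \<gamma>"
proof -
  have m: "mass (x + fst c) = mass x" for x using c by (simp add: mass_def)
  have s2: "sin (2 * (x + fst c)) = sin (2 * x)" "cos (2 * (x + fst c)) = cos (2 * x)" for x
    unfolding sin_double cos_double c by simp_all
  have U: "neg_potential_deriv (x + fst c) = neg_potential_deriv x" for x
    unfolding neg_potential_deriv_def m s2 c ..
  have *: "((\<lambda>t. \<gamma> t + c) has_vector_derivative velocity \<gamma> t) (at t)" for t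
    using has_vector_derivative_add[OF EL_curveD(1)[OF assms(1)] has_vector_derivative_const] by simp
  show "EL_curve (\<lambda>t. \<gamma> t + c)" "velocity (\<lambda>t. \<gamma> t + c) = velocity \<gamma>"
    using EL_curveD[OF assms(1)] by (auto intro!: EL_curveI[OF *] simp: m U c)
qed

section \<open>Reduction to a globally Lipschitz vector field\<close>

text \<open>
The kinetic term \<open>mass x / 2 * v1\<^sup>2\<close> makes the first component of the equation quadratic in \<open>v1\<close>,
hence not globally Lipschitz. Measuring the first coordinate by the length element
\<open>sqrt (mass x) dx\<close> normalizes the mass to 1: with \<open>u = sqrt (mass x) * v1\<close> and the conserved
momentum \<open>p\<close>, the equation becomes \<open>s' = u\<close>, \<open>u' = F p s\<close>, a Newton equation whose force is bounded
and Lipschitz for each \<open>p\<close>.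
\<close>
definition inv_sqrt_mass :: "real \<Rightarrow> real" where "inv_sqrt_mass x = 1 / sqrt (mass x)"

lemma inv_sqrt_mass_bounds: "0 < inv_sqrt_mass x" "inv_sqrt_mass x \<le> 1"
  using mass_bounds(1)[of x] by (auto simp: inv_sqrt_mass_def)

lemma inv_sqrt_mass_mass: "inv_sqrt_mass x * sqrt (mass x) = 1" "(inv_sqrt_mass x)\<^sup>2 * mass x = 1" "inv_sqrt_mass x * mass x = sqrt (mass x)"
  by (auto simp: inv_sqrt_mass_def power_divide field_simps power2_eq_square)

lemma DERIV_sqrt_mass: "((\<lambda>x. sqrt (mass x)) has_real_derivative cos x / 2 * inv_sqrt_mass x) (at x)"
  by (auto intro!: derivative_eq_intros DERIV_mass simp: inv_sqrt_mass_def field_simps)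

lemma DERIV_inv_sqrt_mass: "(inv_sqrt_mass has_real_derivative - cos x / 2 * (inv_sqrt_mass x)^3) (at x)"
  unfolding inv_sqrt_mass_def[abs_def]
  by (auto intro!: derivative_eq_intros DERIV_mass
      simp: field_simps power3_eq_cube power2_eq_square)

lemma ex_arclen: "\<exists>G::real\<Rightarrow>real. \<forall>t. (G has_real_derivative sqrt (mass t)) (at t)"
proof -
  have "continuous_on UNIV (\<lambda>t. sqrt (mass t))"
    using DERIV_sqrt_mass by (meson DERIV_isCont continuous_at_imp_continuous_on)
  from continuous_has_primitive[OF this] show ?thesis
    by (metis has_real_derivative_iff_has_vector_derivative)
qed

text \<open>
The normalized first coordinate, a primitive of \<open>sqrt \<circ> mass\<close>; its additive constant is immaterial.
\<close>
definition arclen :: "real \<Rightarrow> real" where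
  "arclen = (SOME G. \<forall>t. (G has_real_derivative sqrt (mass t)) (at t))"

lemma DERIV_arclen: "(arclen has_real_derivative sqrt (mass t)) (at t)"
  unfolding arclen_def using someI_ex[OF ex_arclen] by blast

lemma arclen_diff: "a \<le> b \<Longrightarrow> b - a \<le> arclen b - arclen a"
proof (cases "a = b")
  case False
  assume "a \<le> b"
  with False have "a < b" by simp
  from MVT2[OF this, of arclen "\<lambda>t. sqrt (mass t)"] DERIV_arclen
  obtain z where "arclen b - arclen a = (b - a) * sqrt (mass z)" by auto
  then show ?thesis using \<open>a < b\<close> mass_bounds(1)[of z] by simp
qed simp

lemma arclen_expands: "\<bar>a - b\<bar> \<le> \<bar>arclen a - arclen b\<bar>"
  using arclen_diff[of a b] arclen_diff[of b a] by linarith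

lemma isCont_arclen: "isCont arclen x"
  using DERIV_arclen by (rule DERIV_isCont)

lemma bij_arclen: "bij arclen"
proof (rule bijI)
  show "inj arclen"
  proof (rule injI)
    fix x y assume "arclen x = arclen y"
    then show "x = y" using arclen_expands[of x y] by simp
  qed
  show "surj arclen"
  unfolding surj_def
  proof (rule allI)
    fix y
    define R where "R = \<bar>y - arclen 0\<bar>"
    have "arclen (- R) \<le> y" "y \<le> arclen R"
      using arclen_diff[of "-R" 0] arclen_diff[of 0 R] by (auto simp: R_def)
    then have "\<exists>x. - R \<le> x \<and> x \<le> R \<and> arclen x = y"
      by (intro IVT) (auto simp: isCont_arclen R_def)
    then show "\<exists>x. y = arclen x" by blast
  qed
qed

definition arclen_inv :: "real \<Rightarrow> real" where "arclen_inv = inv arclen"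

lemma arclen_inv_arclen [simp]: "arclen_inv (arclen x) = x" "arclen (arclen_inv s) = s"
  using bij_arclen by (auto simp: arclen_inv_def bij_def surj_f_inv_f)

lemma DERIV_arclen_inv: "(arclen_inv has_real_derivative inv_sqrt_mass (arclen_inv s)) (at s)"
proof -
  have "isCont arclen_inv (arclen (arclen_inv s))"
    by (rule isCont_inverse_function[of 1]) (auto simp: isCont_arclen)
  then have "(arclen_inv has_real_derivative inverse (sqrt (mass (arclen_inv s)))) (at s)"
    by (intro DERIV_inverse_function[where f=arclen and a="s - 1" and b="s + 1"] DERIV_arclen) auto
  then show ?thesis by (simp add: inv_sqrt_mass_def divide_inverse)
qed

lemma arclen_inv_lipschitz: "\<bar>arclen_inv s - arclen_inv s'\<bar> \<le> \<bar>s - s'\<bar>"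
  using arclen_expands[of "arclen_inv s" "arclen_inv s'"] by simp

text \<open>
Bounded Lipschitz functions form an algebra, whereas Lipschitz functions alone are not closed under
products.
\<close>
definition bounded_lipschitz :: "(real \<Rightarrow> real) \<Rightarrow> bool" where
  "bounded_lipschitz f \<longleftrightarrow> (\<exists>K. \<forall>x y. \<bar>f x\<bar> \<le> K \<and> \<bar>f x - f y\<bar> \<le> K * \<bar>x - y\<bar>)"

lemma bounded_lipschitz_deriv:
  assumes "\<And>x. (f has_real_derivative f' x) (at x)" "\<And>x. \<bar>f x\<bar> \<le> A" "\<And>x. \<bar>f' x\<bar> \<le> B"
  shows "bounded_lipschitz f"
proof -
  have "\<bar>f x - f y\<bar> \<le> B * \<bar>x - y\<bar>" for x y
    using field_differentiable_bound[of UNIV f f' B x y] assms by auto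
  moreover have "B * \<bar>x - y\<bar> \<le> max A B * \<bar>x - y\<bar>" for x y :: real by (intro mult_right_mono) auto
  ultimately show ?thesis unfolding bounded_lipschitz_def using assms(2)
    by (intro exI[of _ "max A B"]) (meson max.cobounded1 order_trans)
qed

lemma bounded_lipschitz_const: "bounded_lipschitz (\<lambda>x. c)"
  unfolding bounded_lipschitz_def by (intro exI[of _ "\<bar>c\<bar>"]) auto

lemma bounded_lipschitz_cos: "bounded_lipschitz (\<lambda>x. cos (a * x))"
  by (rule bounded_lipschitz_deriv[of _ "\<lambda>x. - a * sin (a * x)" 1 "\<bar>a\<bar>"])
     (auto intro!: derivative_eq_intros simp: abs_mult intro: mult_left_le)

lemma bounded_lipschitz_sin: "bounded_lipschitz (\<lambda>x. sin (a * x))"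
  by (rule bounded_lipschitz_deriv[of _ "\<lambda>x. a * cos (a * x)" 1 "\<bar>a\<bar>"])
     (auto intro!: derivative_eq_intros simp: abs_mult intro: mult_left_le)

lemma bounded_lipschitz_inv_sqrt_mass: "bounded_lipschitz inv_sqrt_mass"
proof (rule bounded_lipschitz_deriv[OF DERIV_inv_sqrt_mass, of 1 1])
  fix x
  show "\<bar>inv_sqrt_mass x\<bar> \<le> 1" using inv_sqrt_mass_bounds[of x] by simp
  have "\<bar>cos x / 2\<bar> \<le> 1" using abs_cos_le_one[of x] by linarith
  then have "\<bar>cos x / 2\<bar> * (inv_sqrt_mass x)^3 \<le> 1 * 1"
    using inv_sqrt_mass_bounds[of x] by (intro mult_mono power_le_one) (auto simp del: abs_divide)
  moreover have "\<bar>- cos x / 2 * (inv_sqrt_mass x)^3\<bar> = \<bar>cos x / 2\<bar> * (inv_sqrt_mass x)^3"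
    using inv_sqrt_mass_bounds(1)[of x] by (simp add: abs_mult)
  ultimately show "\<bar>- cos x / 2 * (inv_sqrt_mass x)^3\<bar> \<le> 1" by linarith
qed

lemma bounded_lipschitz_add:
  assumes "bounded_lipschitz f" "bounded_lipschitz g"
  shows "bounded_lipschitz (\<lambda>x. f x + g x)"
proof -
  obtain A where A: "\<And>x. \<bar>f x\<bar> \<le> A" "\<And>x y. \<bar>f x - f y\<bar> \<le> A * \<bar>x - y\<bar>" using assms(1) by (auto simp: bounded_lipschitz_def)
  obtain B where B: "\<And>x. \<bar>g x\<bar> \<le> B" "\<And>x y. \<bar>g x - g y\<bar> \<le> B * \<bar>x - y\<bar>" using assms(2) by (auto simp: bounded_lipschitz_def)
  show ?thesis unfolding bounded_lipschitz_def
  proof (intro exI[of _ "A + B"] allI conjI)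
    fix x y
    show "\<bar>f x + g x\<bar> \<le> A + B" using A(1)[of x] B(1)[of x] by linarith
    show "\<bar>f x + g x - (f y + g y)\<bar> \<le> (A + B) * \<bar>x - y\<bar>" using A(2)[of x y] B(2)[of x y]
      unfolding distrib_right by linarith
  qed
qed

lemma bounded_lipschitz_mult:
  assumes "bounded_lipschitz f" "bounded_lipschitz g"
  shows "bounded_lipschitz (\<lambda>x. f x * g x)"
proof -
  obtain A where A: "\<And>x. \<bar>f x\<bar> \<le> A" "\<And>x y. \<bar>f x - f y\<bar> \<le> A * \<bar>x - y\<bar>" using assms(1) by (auto simp: bounded_lipschitz_def)
  obtain B where B: "\<And>x. \<bar>g x\<bar> \<le> B" "\<And>x y. \<bar>g x - g y\<bar> \<le> B * \<bar>x - y\<bar>" using assms(2) by (auto simp: bounded_lipschitz_def)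
  have AB: "A \<ge> 0" "B \<ge> 0" using A(1)[of 0] B(1)[of 0] by linarith+
  have 1: "\<bar>f x * g x\<bar> \<le> A * B" for x
    unfolding abs_mult using A(1)[of x] B(1)[of x] AB by (intro mult_mono) auto
  have 2: "\<bar>f x * g x - f y * g y\<bar> \<le> 2 * A * B * \<bar>x - y\<bar>" for x y
  proof -
    have "f x * g x - f y * g y = f x * (g x - g y) + (f x - f y) * g y" by (simp add: algebra_simps)
    then have "\<bar>f x * g x - f y * g y\<bar> \<le> \<bar>f x\<bar> * \<bar>g x - g y\<bar> + \<bar>f x - f y\<bar> * \<bar>g y\<bar>"
      by (metis abs_mult abs_triangle_ineq)
    also have "\<dots> \<le> A * (B * \<bar>x - y\<bar>) + (A * \<bar>x - y\<bar>) * B"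
      using A[of x] A(2)[of x y] B(1)[of y] B(2)[of x y] AB by (intro add_mono mult_mono) auto
    finally show ?thesis by simp
  qed
  have "A * B \<le> 2 * A * B" using AB by simp
  with 1 2 show ?thesis unfolding bounded_lipschitz_def
    by (intro exI[of _ "2 * A * B"]) (meson order_trans)
qed

lemma bounded_lipschitz_uminus: "bounded_lipschitz f \<Longrightarrow> bounded_lipschitz (\<lambda>x. - f x)"
  using bounded_lipschitz_mult[OF bounded_lipschitz_const[of "- 1"], of f] by simp

lemma bounded_lipschitz_power: "bounded_lipschitz f \<Longrightarrow> bounded_lipschitz (\<lambda>x. f x ^ n)"
  by (induction n) (auto intro: bounded_lipschitz_mult bounded_lipschitz_const)

text \<open>
The force is \<open>p\<^sup>2 * centrifugal + potential_force\<close>. With \<open>potential + p\<^sup>2 / (2 * mass)\<close> as effective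
potential it is minus the derivative of the latter with respect to \<open>arclen\<close>.
\<close>
definition centrifugal :: "real \<Rightarrow> real" where "centrifugal x = cos x / 2 * inv_sqrt_mass x ^ 5"
definition potential_force :: "real \<Rightarrow> real" where "potential_force x = neg_potential_deriv x * inv_sqrt_mass x"

lemma bounded_lipschitz_centrifugal: "bounded_lipschitz centrifugal"
proof -
  have "bounded_lipschitz (\<lambda>x. (1/2 * cos (1 * x)) * inv_sqrt_mass x ^ 5)"
    by (intro bounded_lipschitz_mult bounded_lipschitz_power bounded_lipschitz_inv_sqrt_mass
        bounded_lipschitz_const bounded_lipschitz_cos)
  then show ?thesis by (simp add: centrifugal_def[abs_def])
qed

lemma bounded_lipschitz_potential_force: "bounded_lipschitz potential_force"
proof -
  have "bounded_lipschitz (\<lambda>x. (((-2) * sin (2 * x)) * inv_sqrt_mass x ^ 2 + - ((2 + cos (2 * x)) * cos (1 * x) * inv_sqrt_mass x ^ 4)) * inv_sqrt_mass x)"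
    by (intro bounded_lipschitz_mult bounded_lipschitz_power bounded_lipschitz_inv_sqrt_mass bounded_lipschitz_add
        bounded_lipschitz_const bounded_lipschitz_cos bounded_lipschitz_sin bounded_lipschitz_uminus)
  also have "(\<lambda>x. (((-2) * sin (2 * x)) * inv_sqrt_mass x ^ 2 + - ((2 + cos (2 * x)) * cos (1 * x) * inv_sqrt_mass x ^ 4)) * inv_sqrt_mass x) = potential_force"
  proof
    fix x
    have "inv_sqrt_mass x ^ 2 = 1 / mass x" "inv_sqrt_mass x ^ 4 = 1 / (mass x)\<^sup>2"
      using power_mult[of "inv_sqrt_mass x" 2 2] by (simp_all add: inv_sqrt_mass_def power_divide)
    then show "(((-2) * sin (2 * x)) * inv_sqrt_mass x ^ 2 + - ((2 + cos (2 * x)) * cos (1 * x) * inv_sqrt_mass x ^ 4)) * inv_sqrt_mass x = potential_force x"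
      by (simp add: potential_force_def neg_potential_deriv_def)
  qed
  finally show ?thesis .
qed

type_synonym state = "real \<times> real \<times> real"

text \<open>
The coordinates of a state are \<open>arclen\<close>, the normalized first velocity \<open>u\<close> and the second position.
The momentum \<open>p\<close> is a parameter and not a coordinate: a field containing it as a coordinate would
be quadratic.
\<close>
definition EL_field :: "real \<Rightarrow> state \<Rightarrow> state" where
  "EL_field p = (\<lambda>(s, u, y). (u, p\<^sup>2 * centrifugal (arclen_inv s) + potential_force (arclen_inv s), p * (inv_sqrt_mass (arclen_inv s))\<^sup>2))"

lemma norm_triple_le: "norm (a, b, c) \<le> \<bar>a\<bar> + \<bar>b\<bar> + \<bar>c\<bar>" for a b c :: real
  using norm_Pair_le[of a "(b, c)"] norm_Pair_le[of b c] by simp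

text \<open>
Besides the Lipschitz bound in the state, the estimate records how the field depends on the
momentum, which nearby initial conditions do not share.
\<close>
lemma EL_field_lipschitz:
  obtains C where "C \<ge> 0" "\<And>p q z z'. norm (EL_field p z - EL_field q z')
     \<le> (1 + C * (1 + \<bar>p\<bar> + p\<^sup>2)) * norm (z - z') + C * (\<bar>p - q\<bar> + \<bar>p\<^sup>2 - q\<^sup>2\<bar>)"
proof -
  have "bounded_lipschitz (\<lambda>x. (inv_sqrt_mass x)\<^sup>2)" by (intro bounded_lipschitz_power bounded_lipschitz_inv_sqrt_mass)
  then obtain A where A: "\<And>x. \<bar>(inv_sqrt_mass x)\<^sup>2\<bar> \<le> A" "\<And>x y. \<bar>(inv_sqrt_mass x)\<^sup>2 - (inv_sqrt_mass y)\<^sup>2\<bar> \<le> A * \<bar>x - y\<bar>"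
    by (auto simp: bounded_lipschitz_def)
  obtain B where B: "\<And>x. \<bar>centrifugal x\<bar> \<le> B" "\<And>x y. \<bar>centrifugal x - centrifugal y\<bar> \<le> B * \<bar>x - y\<bar>"
    using bounded_lipschitz_centrifugal by (auto simp: bounded_lipschitz_def)
  obtain D where D: "\<And>x. \<bar>potential_force x\<bar> \<le> D" "\<And>x y. \<bar>potential_force x - potential_force y\<bar> \<le> D * \<bar>x - y\<bar>"
    using bounded_lipschitz_potential_force by (auto simp: bounded_lipschitz_def)
  have nn: "A \<ge> 0" "B \<ge> 0" "D \<ge> 0" using A(1)[of 0] B(1)[of 0] D(1)[of 0] by linarith+
  define C where "C = A + B + D"
  have C: "A \<le> C" "B \<le> C" "D \<le> C" "C \<ge> 0" using nn by (auto simp: C_def)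
  have main: "norm (EL_field p (s, u, y) - EL_field q (s', u', y'))
     \<le> (1 + C * (1 + \<bar>p\<bar> + p\<^sup>2)) * norm ((s, u, y) - (s', u', y')) + C * (\<bar>p - q\<bar> + \<bar>p\<^sup>2 - q\<^sup>2\<bar>)"
    for p q s u y s' u' y'
  proof -
    define d where "d = norm ((s, u, y) - (s', u', y'))"
    have ds: "\<bar>s - s'\<bar> \<le> d" unfolding d_def using norm_fst_le[of "s - s'" "(u - u', y - y')"] by simp
    have du: "\<bar>u - u'\<bar> \<le> d" unfolding d_def
      using norm_fst_le[of "u - u'" "y - y'"] norm_snd_le[of "(u - u', y - y')" "s - s'"] by simp
    have dp: "K * \<bar>arclen_inv s - arclen_inv s'\<bar> \<le> C * d" if "K \<le> C" "K \<ge> 0" for K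
      using that arclen_inv_lipschitz[of s s'] ds C by (intro mult_mono) auto
    have 2: "\<bar>p\<^sup>2 * centrifugal (arclen_inv s) - q\<^sup>2 * centrifugal (arclen_inv s')\<bar> \<le> p\<^sup>2 * (C * d) + \<bar>p\<^sup>2 - q\<^sup>2\<bar> * C"
    proof -
      have "p\<^sup>2 * centrifugal (arclen_inv s) - q\<^sup>2 * centrifugal (arclen_inv s')
         = p\<^sup>2 * (centrifugal (arclen_inv s) - centrifugal (arclen_inv s')) + (p\<^sup>2 - q\<^sup>2) * centrifugal (arclen_inv s')"
        by (simp add: algebra_simps)
      also have "\<bar>\<dots>\<bar> \<le> \<bar>p\<^sup>2\<bar> * \<bar>centrifugal (arclen_inv s) - centrifugal (arclen_inv s')\<bar> + \<bar>p\<^sup>2 - q\<^sup>2\<bar> * \<bar>centrifugal (arclen_inv s')\<bar>"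
        by (metis abs_mult abs_triangle_ineq)
      also have "\<dots> \<le> p\<^sup>2 * (C * d) + \<bar>p\<^sup>2 - q\<^sup>2\<bar> * C"
        using order_trans[OF B(2) dp[OF C(2) nn(2)]] order_trans[OF B(1) C(2)] by (intro add_mono mult_mono) auto
      finally show ?thesis .
    qed
    have 3: "\<bar>p * (inv_sqrt_mass (arclen_inv s))\<^sup>2 - q * (inv_sqrt_mass (arclen_inv s'))\<^sup>2\<bar> \<le> \<bar>p\<bar> * (C * d) + \<bar>p - q\<bar> * C"
    proof -
      have "p * (inv_sqrt_mass (arclen_inv s))\<^sup>2 - q * (inv_sqrt_mass (arclen_inv s'))\<^sup>2
         = p * ((inv_sqrt_mass (arclen_inv s))\<^sup>2 - (inv_sqrt_mass (arclen_inv s'))\<^sup>2) + (p - q) * (inv_sqrt_mass (arclen_inv s'))\<^sup>2"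
        by (simp add: algebra_simps)
      also have "\<bar>\<dots>\<bar> \<le> \<bar>p\<bar> * \<bar>(inv_sqrt_mass (arclen_inv s))\<^sup>2 - (inv_sqrt_mass (arclen_inv s'))\<^sup>2\<bar> + \<bar>p - q\<bar> * \<bar>(inv_sqrt_mass (arclen_inv s'))\<^sup>2\<bar>"
        by (metis abs_mult abs_triangle_ineq)
      also have "\<dots> \<le> \<bar>p\<bar> * (C * d) + \<bar>p - q\<bar> * C"
        using order_trans[OF A(2) dp[OF C(1) nn(1)]] order_trans[OF A(1) C(1)] by (intro add_mono mult_mono) auto
      finally show ?thesis .
    qed
    have 4: "\<bar>potential_force (arclen_inv s) - potential_force (arclen_inv s')\<bar> \<le> C * d"
      using order_trans[OF D(2) dp[OF C(3) nn(3)]] .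
    have "norm (EL_field p (s, u, y) - EL_field q (s', u', y'))
      \<le> \<bar>u - u'\<bar> + \<bar>p\<^sup>2 * centrifugal (arclen_inv s) + potential_force (arclen_inv s) - (q\<^sup>2 * centrifugal (arclen_inv s') + potential_force (arclen_inv s'))\<bar>
        + \<bar>p * (inv_sqrt_mass (arclen_inv s))\<^sup>2 - q * (inv_sqrt_mass (arclen_inv s'))\<^sup>2\<bar>"
      unfolding EL_field_def by (simp add: norm_triple_le)
    also have "\<dots> \<le> d + (p\<^sup>2 * (C * d) + \<bar>p\<^sup>2 - q\<^sup>2\<bar> * C + C * d) + (\<bar>p\<bar> * (C * d) + \<bar>p - q\<bar> * C)"
      using du 2 3 4 by linarith
    also have "\<dots> = (1 + C * (1 + \<bar>p\<bar> + p\<^sup>2)) * d + C * (\<bar>p - q\<bar> + \<bar>p\<^sup>2 - q\<^sup>2\<bar>)"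
      by (simp add: algebra_simps)
    finally show ?thesis by (simp only: d_def)
  qed
  show thesis
  proof (rule that[OF C(4)])
    fix p q :: real and z z' :: state
    show "norm (EL_field p z - EL_field q z')
     \<le> (1 + C * (1 + \<bar>p\<bar> + p\<^sup>2)) * norm (z - z') + C * (\<bar>p - q\<bar> + \<bar>p\<^sup>2 - q\<^sup>2\<bar>)"
      using main[of p "fst z" "fst (snd z)" "snd (snd z)" q "fst z'" "fst (snd z')" "snd (snd z')"]
      by simp
  qed
qed


section \<open>Existence, uniqueness and continuous dependence of Euler-Lagrange curves\<close>

definition reduced_state :: "plane \<Rightarrow> plane \<Rightarrow> state" where
  "reduced_state x v = (arclen (fst x), sqrt (mass (fst x)) * fst v, snd x)"

definition momentum :: "plane \<Rightarrow> plane \<Rightarrow> real" where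
  "momentum x v = mass (fst x) * snd v"

text \<open>
The inverse of \<open>reduced_state\<close> on the set of phase points with momentum \<open>p\<close>.
\<close>
definition phase_point :: "real \<Rightarrow> state \<Rightarrow> plane \<times> plane" where
  "phase_point p = (\<lambda>(s, u, y). ((arclen_inv s, y), (u * inv_sqrt_mass (arclen_inv s), p * (inv_sqrt_mass (arclen_inv s))\<^sup>2)))"

lemma phase_point_state: "phase_point (momentum x v) (reduced_state x v) = (x, v)"
  using inv_sqrt_mass_mass(1,2)[of "fst x"]
  by (simp add: phase_point_def momentum_def reduced_state_def prod_eq_iff algebra_simps)

lemma momentum_EL: "EL_curve \<gamma> \<Longrightarrow> momentum (\<gamma> t) (velocity \<gamma> t) = momentum (\<gamma> 0) (velocity \<gamma> 0)"
  unfolding momentum_def by (rule EL_curveD(5))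

lemma reduced_state_deriv:
  assumes EL: "EL_curve \<gamma>" and p: "p = momentum (\<gamma> 0) (velocity \<gamma> 0)"
  shows "((\<lambda>t. reduced_state (\<gamma> t) (velocity \<gamma> t)) has_vector_derivative
           EL_field p (reduced_state (\<gamma> t) (velocity \<gamma> t))) (at t)"
proof -
  define x where "x = (\<lambda>t. fst (\<gamma> t))"
  define v1 where "v1 = (\<lambda>t. fst (velocity \<gamma> t))"
  define v2 where "v2 = (\<lambda>t. snd (velocity \<gamma> t))"
  have x: "(x has_real_derivative v1 t) (at t)"
    and y: "((\<lambda>t. snd (\<gamma> t)) has_real_derivative v2 t) (at t)"
    and m: "((\<lambda>s. mass (x s) * v1 s) has_real_derivative
        cos (x t) / 2 * ((v1 t)\<^sup>2 + (v2 t)\<^sup>2) + neg_potential_deriv (x t)) (at t)"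
    using EL_curveD(2,3,4)[OF EL, of t] by (auto simp: x_def v1_def v2_def power2_norm_plane)
  have p': "p = mass (x t) * v2 t"
    using momentum_EL[OF EL, of t] p by (simp add: momentum_def x_def v2_def)
  define r where "r = inv_sqrt_mass (x t)"
  have r: "r > 0" "mass (x t) = 1 / r\<^sup>2" "sqrt (mass (x t)) = 1 / r"
    using inv_sqrt_mass_bounds(1)[of "x t"] inv_sqrt_mass_mass[of "x t"] by (auto simp: r_def field_simps)
  have "((\<lambda>t. arclen (x t)) has_real_derivative sqrt (mass (x t)) * v1 t) (at t)"
    by (rule DERIV_chain2[OF DERIV_arclen x])
  moreover have "((\<lambda>t. sqrt (mass (x t)) * v1 t) has_real_derivative p\<^sup>2 * centrifugal (x t) + potential_force (x t)) (at t)"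
  proof -
    have "((\<lambda>t. inv_sqrt_mass (x t)) has_real_derivative - cos (x t) / 2 * r^3 * v1 t) (at t)"
      unfolding r_def by (rule DERIV_chain2[OF DERIV_inv_sqrt_mass x])
    from DERIV_mult[OF this m]
    have "((\<lambda>t. inv_sqrt_mass (x t) * (mass (x t) * v1 t)) has_real_derivative
        - cos (x t) / 2 * r^3 * v1 t * (mass (x t) * v1 t)
        + (cos (x t) / 2 * ((v1 t)\<^sup>2 + (v2 t)\<^sup>2) + neg_potential_deriv (x t)) * r) (at t)"
      by (simp add: r_def)
    moreover have "- cos (x t) / 2 * r^3 * v1 t * (mass (x t) * v1 t)
        + (cos (x t) / 2 * ((v1 t)\<^sup>2 + (v2 t)\<^sup>2) + neg_potential_deriv (x t)) * r
        = p\<^sup>2 * centrifugal (x t) + potential_force (x t)"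
      using r(1) unfolding p' centrifugal_def potential_force_def r_def[symmetric] r(2)
      by (simp add: field_simps power2_eq_square power3_eq_cube eval_nat_numeral)
    moreover have "(\<lambda>t. inv_sqrt_mass (x t) * (mass (x t) * v1 t)) = (\<lambda>t. sqrt (mass (x t)) * v1 t)"
      using inv_sqrt_mass_mass(3) by (simp add: mult.assoc[symmetric])
    ultimately show ?thesis by simp
  qed
  moreover have "v2 t = p * (inv_sqrt_mass (x t))\<^sup>2"
    using r by (simp add: p' r_def[symmetric])
  ultimately have "((\<lambda>t. (arclen (x t), sqrt (mass (x t)) * v1 t, snd (\<gamma> t))) has_vector_derivative
       (sqrt (mass (x t)) * v1 t, p\<^sup>2 * centrifugal (x t) + potential_force (x t), p * (inv_sqrt_mass (x t))\<^sup>2)) (at t)"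
    using y by (intro has_vector_derivative_Pair)
      (auto simp: has_real_derivative_iff_has_vector_derivative)
  then show ?thesis by (simp add: reduced_state_def EL_field_def x_def v1_def)
qed

lemma EL_curve_dependence:
  obtains C where "C \<ge> 0" "\<And>\<gamma> \<eta> p q t. EL_curve \<gamma> \<Longrightarrow> EL_curve \<eta> \<Longrightarrow>
     p = momentum (\<gamma> 0) (velocity \<gamma> 0) \<Longrightarrow> q = momentum (\<eta> 0) (velocity \<eta> 0) \<Longrightarrow>
     (norm (reduced_state (\<gamma> t) (velocity \<gamma> t) - reduced_state (\<eta> t) (velocity \<eta> t)))\<^sup>2
     \<le> ((norm (reduced_state (\<gamma> 0) (velocity \<gamma> 0) - reduced_state (\<eta> 0) (velocity \<eta> 0)))\<^sup>2
          + (C * (\<bar>p - q\<bar> + \<bar>p\<^sup>2 - q\<^sup>2\<bar>))\<^sup>2)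
       * exp ((2 * (1 + C * (1 + \<bar>p\<bar> + p\<^sup>2)) + 1) * \<bar>t\<bar>)"
proof -
  obtain C where C: "C \<ge> 0" "\<And>p q z z'. norm (EL_field p z - EL_field q z')
     \<le> (1 + C * (1 + \<bar>p\<bar> + p\<^sup>2)) * norm (z - z') + C * (\<bar>p - q\<bar> + \<bar>p\<^sup>2 - q\<^sup>2\<bar>)"
    using EL_field_lipschitz by metis
  show thesis
  proof (rule that[OF C(1)])
    fix \<gamma> \<eta> p q t
    assume a: "EL_curve \<gamma>" "EL_curve \<eta>"
     "p = momentum (\<gamma> 0) (velocity \<gamma> 0)" "q = momentum (\<eta> 0) (velocity \<eta> 0)"
    show "(norm (reduced_state (\<gamma> t) (velocity \<gamma> t) - reduced_state (\<eta> t) (velocity \<eta> t)))\<^sup>2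
     \<le> ((norm (reduced_state (\<gamma> 0) (velocity \<gamma> 0) - reduced_state (\<eta> 0) (velocity \<eta> 0)))\<^sup>2
          + (C * (\<bar>p - q\<bar> + \<bar>p\<^sup>2 - q\<^sup>2\<bar>))\<^sup>2)
       * exp ((2 * (1 + C * (1 + \<bar>p\<bar> + p\<^sup>2)) + 1) * \<bar>t\<bar>)"
      by (rule gronwall_norm[OF has_vector_derivative_diff
            [OF reduced_state_deriv[OF a(1,3)] reduced_state_deriv[OF a(2,4)]]])
         (use C in \<open>auto intro!: add_nonneg_nonneg mult_nonneg_nonneg\<close>)
  qed
qed

lemma EL_curve_unique:
  assumes "EL_curve \<gamma>" "EL_curve \<eta>" "\<gamma> 0 = \<eta> 0" "velocity \<gamma> 0 = velocity \<eta> 0"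
  shows "\<gamma> = \<eta>"
proof
  fix t
  obtain C where C: "\<And>\<gamma> \<eta> p q t. EL_curve \<gamma> \<Longrightarrow> EL_curve \<eta> \<Longrightarrow>
     p = momentum (\<gamma> 0) (velocity \<gamma> 0) \<Longrightarrow> q = momentum (\<eta> 0) (velocity \<eta> 0) \<Longrightarrow>
     (norm (reduced_state (\<gamma> t) (velocity \<gamma> t) - reduced_state (\<eta> t) (velocity \<eta> t)))\<^sup>2
     \<le> ((norm (reduced_state (\<gamma> 0) (velocity \<gamma> 0) - reduced_state (\<eta> 0) (velocity \<eta> 0)))\<^sup>2
          + (C * (\<bar>p - q\<bar> + \<bar>p\<^sup>2 - q\<^sup>2\<bar>))\<^sup>2)
       * exp ((2 * (1 + C * (1 + \<bar>p\<bar> + p\<^sup>2)) + 1) * \<bar>t\<bar>)"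
    using EL_curve_dependence by metis
  have "(norm (reduced_state (\<gamma> t) (velocity \<gamma> t) - reduced_state (\<eta> t) (velocity \<eta> t)))\<^sup>2 \<le> 0"
    using C[OF assms(1,2) refl refl, of t] assms(3,4) by simp
  then have "reduced_state (\<gamma> t) (velocity \<gamma> t) = reduced_state (\<eta> t) (velocity \<eta> t)" by simp
  then show "\<gamma> t = \<eta> t"
    using arclen_inv_arclen(1) by (metis reduced_state_def prod.inject prod_eqI)
qed

text \<open>
Solve the reduced system with the prescribed momentum and transform back.
\<close>
lemma EL_curve_exists:
  obtains \<gamma> where "EL_curve \<gamma>" "\<gamma> 0 = x" "velocity \<gamma> 0 = v"
proof -
  define p where "p = momentum x v"
  obtain C where C: "\<And>p q z z'. norm (EL_field p z - EL_field q z')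
     \<le> (1 + C * (1 + \<bar>p\<bar> + p\<^sup>2)) * norm (z - z') + C * (\<bar>p - q\<bar> + \<bar>p\<^sup>2 - q\<^sup>2\<bar>)"
    using EL_field_lipschitz by metis
  have lip: "norm (EL_field p z - EL_field p z') \<le> (1 + C * (1 + \<bar>p\<bar> + p\<^sup>2)) * norm (z - z')" for z z'
    using C[of p z p z'] by simp
  obtain z where z0: "z 0 = reduced_state x v" and z: "\<And>t. (z has_vector_derivative EL_field p (z t)) (at t)"
    using lipschitz_ode_exists[where f="EL_field p", OF lip] by metis
  define s where "s = (\<lambda>t. fst (z t))"
  define u where "u = (\<lambda>t. fst (snd (z t)))"
  define y where "y = (\<lambda>t. snd (snd (z t)))"
  have zd: "(z has_derivative (\<lambda>h. h *\<^sub>R EL_field p (z t))) (at t)" for t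
    using z[of t] by (simp add: has_vector_derivative_def)
  have ds: "(s has_real_derivative u t) (at t)"
    and du: "(u has_real_derivative p\<^sup>2 * centrifugal (arclen_inv (s t)) + potential_force (arclen_inv (s t))) (at t)"
    and dy: "(y has_real_derivative p * (inv_sqrt_mass (arclen_inv (s t)))\<^sup>2) (at t)" for t
    using has_derivative_fst[OF zd[of t]] has_derivative_fst[OF has_derivative_snd[OF zd[of t]]]
      has_derivative_snd[OF has_derivative_snd[OF zd[of t]]]
    unfolding has_real_derivative_iff_has_vector_derivative has_vector_derivative_def s_def u_def y_def
    by (simp_all add: EL_field_def case_prod_beta)
  define \<gamma> where "\<gamma> = (\<lambda>t. fst (phase_point p (z t)))"
  define v' where "v' = (\<lambda>t. snd (phase_point p (z t)))"
  have g: "\<gamma> = (\<lambda>t. (arclen_inv (s t), y t))"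
    and v': "v' = (\<lambda>t. (u t * inv_sqrt_mass (arclen_inv (s t)), p * (inv_sqrt_mass (arclen_inv (s t)))\<^sup>2))"
    by (auto simp: \<gamma>_def v'_def phase_point_def case_prod_beta s_def u_def y_def)
  have dx: "((\<lambda>t. arclen_inv (s t)) has_real_derivative u t * inv_sqrt_mass (arclen_inv (s t))) (at t)" for t
    using DERIV_chain2[OF DERIV_arclen_inv ds] by (simp add: mult.commute)
  have 1: "(\<gamma> has_vector_derivative v' t) (at t)" for t
    unfolding g v' using dx dy
    by (intro has_vector_derivative_Pair) (auto simp: has_real_derivative_iff_has_vector_derivative)
  have 2: "((\<lambda>s. mass (fst (\<gamma> s)) * fst (v' s)) has_real_derivative
        cos (fst (\<gamma> t)) / 2 * (norm (v' t))\<^sup>2 + neg_potential_deriv (fst (\<gamma> t))) (at t)" for t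
  proof -
    define r where "r = inv_sqrt_mass (arclen_inv (s t))"
    have r: "r > 0" "sqrt (mass (arclen_inv (s t))) = 1 / r"
      using inv_sqrt_mass_bounds(1)[of "arclen_inv (s t)"] inv_sqrt_mass_mass[of "arclen_inv (s t)"] by (auto simp: r_def field_simps)
    have "((\<lambda>t. sqrt (mass (arclen_inv (s t)))) has_real_derivative
        cos (arclen_inv (s t)) / 2 * r * (u t * r)) (at t)"
      unfolding r_def by (rule DERIV_chain2[OF DERIV_sqrt_mass dx])
    from DERIV_mult[OF du this]
    have "((\<lambda>t. u t * sqrt (mass (arclen_inv (s t)))) has_real_derivative
        (p\<^sup>2 * centrifugal (arclen_inv (s t)) + potential_force (arclen_inv (s t))) * (1 / r)
         + cos (arclen_inv (s t)) / 2 * r * (u t * r) * u t) (at t)" by (simp add: r)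
    moreover have "(p\<^sup>2 * centrifugal (arclen_inv (s t)) + potential_force (arclen_inv (s t))) * (1 / r)
         + cos (arclen_inv (s t)) / 2 * r * (u t * r) * u t
       = cos (fst (\<gamma> t)) / 2 * (norm (v' t))\<^sup>2 + neg_potential_deriv (fst (\<gamma> t))"
      using r(1) unfolding g v' power2_norm_plane centrifugal_def potential_force_def fst_conv snd_conv r_def[symmetric]
      by (simp add: field_simps power2_eq_square eval_nat_numeral)
    moreover have "(\<lambda>s. mass (fst (\<gamma> s)) * fst (v' s)) = (\<lambda>t. u t * sqrt (mass (arclen_inv (s t))))"
    proof
      fix t show "mass (fst (\<gamma> t)) * fst (v' t) = u t * sqrt (mass (arclen_inv (s t)))"
        using inv_sqrt_mass_mass(3)[of "arclen_inv (s t)"] by (simp add: g v' mult_ac)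
    qed
    ultimately show ?thesis by simp
  qed
  have 3: "mass (fst (\<gamma> t)) * snd (v' t) = p" for t
    using inv_sqrt_mass_mass(2)[of "arclen_inv (s t)"] by (simp add: g v' mult_ac)
  have "(\<gamma> 0, v' 0) = (x, v)"
    using phase_point_state[of x v] by (simp add: \<gamma>_def v'_def z0 p_def)
  then show thesis
    using EL_curveI[OF 1 2 3] that[of \<gamma>] by simp
qed

definition EL_solution :: "plane \<Rightarrow> plane \<Rightarrow> real \<Rightarrow> plane" where
  "EL_solution x v = (SOME \<gamma>. EL_curve \<gamma> \<and> \<gamma> 0 = x \<and> velocity \<gamma> 0 = v)"

lemma EL_solution: "EL_curve (EL_solution x v)" "EL_solution x v 0 = x" "velocity (EL_solution x v) 0 = v"
proof -
  have "\<exists>\<gamma>. EL_curve \<gamma> \<and> \<gamma> 0 = x \<and> velocity \<gamma> 0 = v" using EL_curve_exists by metis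
  from someI_ex[OF this] show "EL_curve (EL_solution x v)" "EL_solution x v 0 = x" "velocity (EL_solution x v) 0 = v"
    unfolding EL_solution_def by auto
qed

definition phase_flow :: "real \<Rightarrow> plane \<times> plane \<Rightarrow> plane \<times> plane" where
  "phase_flow t = (\<lambda>(x, v). (EL_solution x v t, velocity (EL_solution x v) t))"

lemma isCont_inv_sqrt_mass: "isCont inv_sqrt_mass x" and isCont_arclen_inv: "isCont arclen_inv x" and isCont_mass: "isCont mass x"
  using DERIV_inv_sqrt_mass DERIV_arclen_inv DERIV_mass by (blast intro: DERIV_isCont)+

text \<open>
The reduced states at time \<open>t\<close> depend continuously on the initial point by Gronwall's estimate, and
\<open>phase_point\<close> recovers the position and the velocity from the state and the momentum continuously.
Continuity of the flow is what makes the preimages in the definition of an invariant measure Borel.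
\<close>
lemma continuous_phase_flow: "continuous_on UNIV (phase_flow t)"
proof (rule continuous_on_sequentiallyI)
  fix z :: "nat \<Rightarrow> plane \<times> plane" and a
  assume za: "z \<longlonglongrightarrow> a"
  define P where "P = (\<lambda>z. momentum (fst z) (snd z))"
  define S where "S = (\<lambda>t z. reduced_state (fst (phase_flow t z)) (snd (phase_flow t z)))"
  have S0: "S 0 z = reduced_state (fst z) (snd z)" for z
    by (simp add: S_def phase_flow_def case_prod_beta EL_solution)
  have rec: "phase_flow t z = phase_point (P z) (S t z)" for t z
  proof -
    have "P z = momentum (fst (phase_flow t z)) (snd (phase_flow t z))"
      using momentum_EL[OF EL_solution(1)[of "fst z" "snd z"], of t]
      by (simp add: P_def phase_flow_def case_prod_beta EL_solution)
    then show ?thesis by (simp add: S_def phase_point_state)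
  qed
  obtain C where C: "\<And>\<gamma> \<eta> p q t. EL_curve \<gamma> \<Longrightarrow> EL_curve \<eta> \<Longrightarrow>
     p = momentum (\<gamma> 0) (velocity \<gamma> 0) \<Longrightarrow> q = momentum (\<eta> 0) (velocity \<eta> 0) \<Longrightarrow>
     (norm (reduced_state (\<gamma> t) (velocity \<gamma> t) - reduced_state (\<eta> t) (velocity \<eta> t)))\<^sup>2
     \<le> ((norm (reduced_state (\<gamma> 0) (velocity \<gamma> 0) - reduced_state (\<eta> 0) (velocity \<eta> 0)))\<^sup>2
          + (C * (\<bar>p - q\<bar> + \<bar>p\<^sup>2 - q\<^sup>2\<bar>))\<^sup>2)
       * exp ((2 * (1 + C * (1 + \<bar>p\<bar> + p\<^sup>2)) + 1) * \<bar>t\<bar>)"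
    using EL_curve_dependence by metis
  have dep: "(norm (S t a - S t (z n)))\<^sup>2 \<le> ((norm (S 0 a - S 0 (z n)))\<^sup>2
      + (C * (\<bar>P a - P (z n)\<bar> + \<bar>(P a)\<^sup>2 - (P (z n))\<^sup>2\<bar>))\<^sup>2)
      * exp ((2 * (1 + C * (1 + \<bar>P a\<bar> + (P a)\<^sup>2)) + 1) * \<bar>t\<bar>)" for n
    using C[OF EL_solution(1)[of "fst a" "snd a"] EL_solution(1)[of "fst (z n)" "snd (z n)"] refl refl, of t]
    by (simp add: S_def P_def phase_flow_def case_prod_beta EL_solution)
  have Pc: "(\<lambda>n. P (z n)) \<longlonglongrightarrow> P a"
    unfolding P_def momentum_def
    by (intro tendsto_intros isCont_tendsto_compose[OF isCont_mass] za)
  have S0c: "(\<lambda>n. S 0 (z n)) \<longlonglongrightarrow> S 0 a"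
    unfolding S0 reduced_state_def
    by (intro tendsto_intros isCont_tendsto_compose[OF isCont_mass] isCont_tendsto_compose[OF isCont_arclen] za)
  have "(\<lambda>n. ((norm (S 0 a - S 0 (z n)))\<^sup>2
      + (C * (\<bar>P a - P (z n)\<bar> + \<bar>(P a)\<^sup>2 - (P (z n))\<^sup>2\<bar>))\<^sup>2)
      * exp ((2 * (1 + C * (1 + \<bar>P a\<bar> + (P a)\<^sup>2)) + 1) * \<bar>t\<bar>))
     \<longlonglongrightarrow> ((norm (S 0 a - S 0 a))\<^sup>2
      + (C * (\<bar>P a - P a\<bar> + \<bar>(P a)\<^sup>2 - (P a)\<^sup>2\<bar>))\<^sup>2)
      * exp ((2 * (1 + C * (1 + \<bar>P a\<bar> + (P a)\<^sup>2)) + 1) * \<bar>t\<bar>)"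
    by (intro tendsto_intros Pc S0c)
  then have "(\<lambda>n. (norm (S t a - S t (z n)))\<^sup>2) \<longlonglongrightarrow> 0"
    by (intro tendsto_sandwich[OF _ always_eventually[OF allI[OF dep]] tendsto_const]) auto
  from tendsto_real_sqrt[OF this] have "(\<lambda>n. norm (S t (z n) - S t a)) \<longlonglongrightarrow> 0"
    by (simp add: norm_minus_commute)
  then have Sc: "(\<lambda>n. S t (z n)) \<longlonglongrightarrow> S t a"
    by (rule LIM_zero_cancel[OF tendsto_norm_zero_cancel])
  have "(\<lambda>n. phase_point (P (z n)) (S t (z n))) \<longlonglongrightarrow> phase_point (P a) (S t a)"
    unfolding phase_point_def case_prod_beta
    by (intro tendsto_intros Pc Sc isCont_tendsto_compose[OF isCont_arclen_inv] isCont_tendsto_compose[OF isCont_inv_sqrt_mass])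
  then show "(\<lambda>n. phase_flow t (z n)) \<longlonglongrightarrow> phase_flow t a" by (simp only: rec)
qed

section \<open>Topology of the torus and of its tangent bundle\<close>

lemma torus_proj_eq_iff: "torus_proj x = torus_proj y \<longleftrightarrow> lattice_rel x y"
  by (rule torus.abs_eq_iff)

lemma torus_proj_exists: "\<exists>x. \<theta> = torus_proj x"
  by (rule torus.abs_induct) blast

lemma lattice_rel_rep_torus: "lattice_rel x (rep_torus (torus_proj x))"
  using Quotient_abs_rep[OF Quotient_torus, of "torus_proj x"] by (metis torus_proj_eq_iff)

lemma continuous_torus_proj: "continuous_on UNIV torus_proj"
  by (rule continuous_on_open_vimage[OF open_UNIV, THEN iffD2]) (auto simp: open_torus_def)

text \<open>
The saturation of an open set is the union of its lattice translates.
\<close>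
lemma open_torus_proj_image:
  assumes "open U" shows "open (torus_proj ` U)"
proof -
  have "torus_proj -` torus_proj ` U
      = (\<Union>m::int. \<Union>n::int. (\<lambda>x. (2 * pi * of_int m, 2 * pi * of_int n) + x) ` U)"
  proof (intro set_eqI)
    fix x
    have "x \<in> torus_proj -` torus_proj ` U \<longleftrightarrow> (\<exists>u\<in>U. lattice_rel u x)"
      unfolding vimage_eq image_iff by (metis torus_proj_eq_iff)
    then show "x \<in> torus_proj -` torus_proj ` U \<longleftrightarrow>
        x \<in> (\<Union>m::int. \<Union>n::int. (\<lambda>x. (2 * pi * of_int m, 2 * pi * of_int n) + x) ` U)"
      unfolding lattice_rel_def by (simp add: image_iff add.commute) blast
  qed
  moreover have "open \<dots>" using assms by (intro open_UN ballI open_translation)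
  ultimately show ?thesis by (simp add: open_torus_def)
qed

lemma open_image_map_prod:
  assumes f: "\<And>S. open S \<Longrightarrow> open (f ` S)" and g: "\<And>S. open S \<Longrightarrow> open (g ` S)" and W: "open W"
  shows "open (map_prod f g ` W)"
proof (rule open_prod_intro)
  fix y assume "y \<in> map_prod f g ` W"
  then obtain z where z: "z \<in> W" "y = map_prod f g z" by (rule imageE) blast
  obtain A B where AB: "open A" "open B" "z \<in> A \<times> B" "A \<times> B \<subseteq> W"
    using open_prod_elim[OF W z(1)] by blast
  have "f ` A \<times> g ` B = map_prod f g ` (A \<times> B)" by (rule map_prod_surj_on[OF refl refl, symmetric])
  also have "\<dots> \<subseteq> map_prod f g ` W" using AB(4) by (rule image_mono)
  finally have "f ` A \<times> g ` B \<subseteq> map_prod f g ` W" .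
  moreover have "y \<in> f ` A \<times> g ` B" using z(2) AB(3) by (cases z) auto
  ultimately show "\<exists>A B. open A \<and> open B \<and> y \<in> A \<times> B \<and> A \<times> B \<subseteq> map_prod f g ` W"
    using f[OF AB(1)] g[OF AB(2)] by blast
qed

text \<open>
A product of quotient maps need not be a quotient map, but a product of open surjections is an open
surjection. So openness is the property of the projection that passes to the tangent bundle.
\<close>
lemma continuous_on_open_quotient:
  fixes q :: "'a::topological_space \<Rightarrow> 'b::topological_space" and f :: "'b \<Rightarrow> 'c::topological_space"
  assumes q: "\<And>S. open S \<Longrightarrow> open (q ` S)" "surj q" and f: "continuous_on UNIV (\<lambda>x. f (q x))"
  shows "continuous_on UNIV f"
proof (rule continuous_on_open_vimage[OF open_UNIV, THEN iffD2], intro allI impI)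
  fix U :: "'c set" assume "open U"
  then have "open ((\<lambda>x. f (q x)) -` U)" using f by (simp add: continuous_on_open_vimage)
  then have "open (q ` ((\<lambda>x. f (q x)) -` U))" by (rule q)
  also have "q ` ((\<lambda>x. f (q x)) -` U) = f -` U"
    using surj_image_vimage_eq[OF q(2), of "f -` U"] by (simp add: vimage_def)
  finally show "open (f -` U \<inter> UNIV)" by simp
qed

instance torus :: second_countable_topology
proof
  obtain B :: "plane set set" where B: "countable B" "topological_basis B"
    using ex_countable_basis by blast
  have "topological_basis ((`) torus_proj ` B)"
  proof (rule topological_basisI)
    show "open U" if "U \<in> (`) torus_proj ` B" for U
      using that B(2) by (auto intro: open_torus_proj_image topological_basis_open)
  next
    fix U and \<theta> :: torus assume U: "open U" "\<theta> \<in> U"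
    obtain x where x: "\<theta> = torus_proj x" using torus_proj_exists by blast
    have "open (torus_proj -` U)" "x \<in> torus_proj -` U" using U x by (auto simp: open_torus_def)
    then obtain b where "b \<in> B" "x \<in> b" "b \<subseteq> torus_proj -` U"
      by (rule topological_basisE[OF B(2)])
    then show "\<exists>b\<in>(`) torus_proj ` B. \<theta> \<in> b \<and> b \<subseteq> U" using x by auto
  qed
  then show "\<exists>B::torus set set. countable B \<and> open = generate_topology B"
    using B(1) topological_basis_imp_subbasis by blast
qed

definition tangent_proj :: "plane \<times> plane \<Rightarrow> tangent" where
  "tangent_proj = map_prod torus_proj id"

lemma tangent_proj_simp [simp]: "tangent_proj (x, v) = (torus_proj x, v)"
  by (simp add: tangent_proj_def)

lemma tangent_proj_fst_snd: "tangent_proj z = (torus_proj (fst z), snd z)"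
  by (cases z) simp

lemma surj_tangent_proj: "surj tangent_proj"
proof (rule surjI)
  show "tangent_proj (rep_torus (fst w), snd w) = w" for w
    by (simp add: Quotient_abs_rep[OF Quotient_torus])
qed

lemma tangent_proj_exists: obtains x v where "w = (torus_proj x, v)"
proof -
  obtain x where "fst w = torus_proj x" using torus_proj_exists by blast
  then show thesis using that[of x "snd w"] by (cases w) simp
qed

lemma open_tangent_proj_image: "open S \<Longrightarrow> open (tangent_proj ` S)"
  unfolding tangent_proj_def by (rule open_image_map_prod) (simp_all add: open_torus_proj_image)

lemma continuous_tangent_proj: "continuous_on UNIV tangent_proj"
proof -
  have "continuous_on UNIV (\<lambda>z::plane \<times> plane. (torus_proj (fst z), snd z))"
    by (rule continuous_on_Pair[OF continuous_on_compose2[OF continuous_torus_proj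
          continuous_on_fst[OF continuous_on_id] subset_UNIV] continuous_on_snd[OF continuous_on_id]])
  also have "(\<lambda>z::plane \<times> plane. (torus_proj (fst z), snd z)) = tangent_proj"
    by (rule ext) (rule tangent_proj_fst_snd[symmetric])
  finally show ?thesis .
qed

lemma continuous_on_tangentI:
  "continuous_on UNIV (\<lambda>z. f (tangent_proj z)) \<Longrightarrow> continuous_on UNIV f"
  by (rule continuous_on_open_quotient[OF open_tangent_proj_image surj_tangent_proj])

text \<open>
The first coordinate is only defined modulo the lattice; its sine distinguishes the two loops and
strictly increases or decreases along the curves that join them.
\<close>
definition torus_sin :: "tangent \<Rightarrow> real" where
  "torus_sin w = sin (fst (rep_torus (fst w)))"

lemma torus_sin_tangent_proj: "torus_sin (tangent_proj (x, v)) = sin (fst x)"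
proof -
  have "lattice_rel x (rep_torus (torus_proj x))" by (rule lattice_rel_rep_torus)
  then show ?thesis by (auto simp: torus_sin_def lattice_rel_def sin_add)
qed

lemma continuous_torus_sin: "continuous_on UNIV torus_sin"
proof (rule continuous_on_tangentI)
  have "continuous_on UNIV (\<lambda>z::plane \<times> plane. sin (fst (fst z)))" by (intro continuous_intros)
  then show "continuous_on UNIV (\<lambda>z. torus_sin (tangent_proj z))"
    using torus_sin_tangent_proj[of "fst z" "snd z" for z] by simp
qed

section \<open>The flow on the tangent bundle\<close>

lemma tangent_lift_tangent_proj: "tangent_lift \<gamma> t = tangent_proj (\<gamma> t, velocity \<gamma> t)"
  by (simp add: tangent_lift_def)

lemma lattice_shift_periodic:
  assumes "c = (2 * pi * of_int m, 2 * pi * of_int n)"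
  shows "sin (x + fst c) = sin x" "cos (x + fst c) = cos x"
  using assms by (simp_all add: sin_add cos_add)

text \<open>
Two lifts of the same initial condition differ by a lattice vector, and translating by it maps
solutions to solutions. Hence the definite description behind \<open>EL_flow\<close> is well defined.
\<close>
lemma tangent_lift_determined:
  assumes EL: "EL_curve \<gamma>" "EL_curve \<eta>" and eq: "tangent_lift \<gamma> 0 = tangent_lift \<eta> 0"
  shows "tangent_lift \<gamma> t = tangent_lift \<eta> t"
proof -
  from eq have v: "velocity \<gamma> 0 = velocity \<eta> 0" and "lattice_rel (\<gamma> 0) (\<eta> 0)"
    by (auto simp: tangent_lift_def torus_proj_eq_iff)
  then obtain m n :: int where c: "\<eta> 0 = \<gamma> 0 + (2 * pi * of_int m, 2 * pi * of_int n)"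
    by (auto simp: lattice_rel_def)
  define c where "c = (2 * pi * of_int m, 2 * pi * of_int n)"
  have tr: "EL_curve (\<lambda>t. \<gamma> t + c)" "velocity (\<lambda>t. \<gamma> t + c) = velocity \<gamma>"
    using EL_curve_translate[OF EL(1), of c] lattice_shift_periodic[OF c_def] by auto
  have "(\<lambda>t. \<gamma> t + c) = \<eta>"
    by (rule EL_curve_unique[OF tr(1) EL(2)]) (use c v tr(2) in \<open>auto simp: c_def\<close>)
  then have "\<eta> t = \<gamma> t + c" "velocity \<eta> t = velocity \<gamma> t" using tr(2) by auto
  then show ?thesis by (auto simp: tangent_lift_def torus_proj_eq_iff lattice_rel_def c_def)
qed

lemma EL_flow_tangent_lift:
  assumes "EL_curve \<gamma>"
  shows "EL_flow t (tangent_lift \<gamma> 0) = tangent_lift \<gamma> t"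
  unfolding EL_flow_def
proof (rule the_equality)
  show "\<exists>\<gamma>'. EL_curve \<gamma>' \<and> tangent_lift \<gamma>' 0 = tangent_lift \<gamma> 0 \<and> tangent_lift \<gamma>' t = tangent_lift \<gamma> t"
    using assms by blast
next
  fix w' assume "\<exists>\<gamma>'. EL_curve \<gamma>' \<and> tangent_lift \<gamma>' 0 = tangent_lift \<gamma> 0 \<and> tangent_lift \<gamma>' t = w'"
  then show "w' = tangent_lift \<gamma> t" using tangent_lift_determined[OF _ assms] by blast
qed

lemma EL_flow_tangent_proj: "EL_flow t (tangent_proj z) = tangent_proj (phase_flow t z)"
  using EL_flow_tangent_lift[OF EL_solution(1)[of "fst z" "snd z"], of t]
  by (simp add: tangent_lift_tangent_proj EL_solution phase_flow_def case_prod_beta del: tangent_proj_simp)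

lemma continuous_EL_flow: "continuous_on UNIV (EL_flow t)"
  by (rule continuous_on_tangentI, unfold EL_flow_tangent_proj)
     (intro continuous_on_compose2[OF continuous_tangent_proj continuous_phase_flow] subset_UNIV)

lemma measurable_EL_flow: "EL_flow t \<in> borel \<rightarrow>\<^sub>M borel"
  by (intro borel_measurable_continuous_onI continuous_EL_flow)

section \<open>The calibration and the two loops\<close>

lemma potential_eq: "potential x = - (1 / mass x) - 2 * (cos x)\<^sup>2 / mass x"
proof -
  have "2 + cos (2 * x) = 1 + 2 * (cos x)\<^sup>2" by (simp add: cos_double_cos)
  then show ?thesis
    unfolding potential_def mass_def[symmetric]
    by (simp only: minus_add_distrib diff_divide_distrib minus_divide_left)
       (simp add: diff_divide_distrib)
qed

lemma Lag_le: "Lag x v \<le> 3 / 2 * (norm v)\<^sup>2 + 3"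
proof -
  have "mass (fst x) / 2 * (norm v)\<^sup>2 \<le> 3 / 2 * (norm v)\<^sup>2"
    using mass_bounds(2)[of "fst x"] by (intro mult_right_mono) auto
  moreover have "(2 + cos (2 * fst x)) / mass (fst x) \<le> 3 / 1"
    using mass_bounds(1)[of "fst x"] cos_le_one[of "2 * fst x"] by (intro frac_le) auto
  moreover have "potential (fst x) = - ((2 + cos (2 * fst x)) / mass (fst x))"
    unfolding potential_def mass_def by (rule minus_divide_left[symmetric])
  ultimately show ?thesis by (simp add: Lag_def)
qed

text \<open>
Completing the square for the closed form \<open>sqrt 2 dx2\<close>. The numerator of the potential is chosen
such that \<open>mass * (- potential) - 1 = 2 * cos\<^sup>2\<close>, which is nonnegative and vanishes on both loops.
\<close>
lemma Lag_calibrated: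
  "Lag x v - sqrt 2 * snd v = mass (fst x) / 2 * (fst v)\<^sup>2
     + mass (fst x) / 2 * (snd v - sqrt 2 / mass (fst x))\<^sup>2 + 2 * (cos (fst x))\<^sup>2 / mass (fst x)"
proof -
  define m where "m = mass (fst x)"
  have m: "m > 0" by (simp add: m_def)
  have U: "potential (fst x) = - (1 / m) - 2 * (cos (fst x))\<^sup>2 / m"
    unfolding m_def by (rule potential_eq)
  have "m / 2 * (snd v - sqrt 2 / m)\<^sup>2 = m / 2 * (snd v)\<^sup>2 - sqrt 2 * snd v + 1 / m"
    using m by (simp add: power2_diff power_divide field_simps power2_eq_square)
  moreover have "m / 2 * ((fst v)\<^sup>2 + (snd v)\<^sup>2) = m / 2 * (fst v)\<^sup>2 + m / 2 * (snd v)\<^sup>2"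
    by (rule distrib_left)
  ultimately show ?thesis
    unfolding Lag_def m_def[symmetric] U power2_norm_plane by linarith
qed

text \<open>
The vertical velocity that minimizes the calibrated Lagrangian at \<open>x1 = c\<close>, which corresponds to the momentum
\<open>sqrt 2\<close>.
\<close>
definition loop_speed :: "real \<Rightarrow> real" where "loop_speed c = sqrt 2 / mass c"

definition loop_point :: "real \<Rightarrow> real \<Rightarrow> tangent" where
  "loop_point c t = (torus_proj (c, loop_speed c * t), (0, loop_speed c))"

definition loop_orbit :: "real \<Rightarrow> tangent set" where
  "loop_orbit c = range (loop_point c)"

definition loop_period :: "real \<Rightarrow> real" where "loop_period c = 2 * pi / loop_speed c"

lemma loop_speed_pos: "loop_speed c > 0" by (simp add: loop_speed_def)
lemma loop_period_pos: "loop_period c > 0" by (simp add: loop_period_def loop_speed_pos)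

lemma mem_loop_orbit: "(torus_proj (c, y), (0, loop_speed c)) \<in> loop_orbit c"
  unfolding loop_orbit_def loop_point_def using loop_speed_pos[of c]
  by (intro range_eqI[of _ _ "y / loop_speed c"]) auto

lemma Lag_nonneg_calibrated: "0 \<le> Lag x v - sqrt 2 * snd v"
  unfolding Lag_calibrated by (intro add_nonneg_nonneg mult_nonneg_nonneg divide_nonneg_nonneg) auto

lemma Lag_calibrated_eq_0_iff:
  "Lag x v = sqrt 2 * snd v \<longleftrightarrow> cos (fst x) = 0 \<and> v = (0, loop_speed (fst x))"
proof -
  have "Lag x v = sqrt 2 * snd v \<longleftrightarrow> Lag x v - sqrt 2 * snd v = 0" by simp
  also have "\<dots> \<longleftrightarrow> mass (fst x) / 2 * (fst v)\<^sup>2 = 0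
     \<and> mass (fst x) / 2 * (snd v - sqrt 2 / mass (fst x))\<^sup>2 = 0 \<and> 2 * (cos (fst x))\<^sup>2 / mass (fst x) = 0"
    unfolding Lag_calibrated by (simp add: add_nonneg_eq_0_iff del: mult_eq_0_iff divide_eq_0_iff)
  also have "\<dots> \<longleftrightarrow> cos (fst x) = 0 \<and> v = (0, loop_speed (fst x))"
    by (cases v) (auto simp: loop_speed_def)
  finally show ?thesis .
qed

lemma cos_zero_cases:
  assumes "cos x = 0"
  obtains k :: int where "x = pi / 2 + 2 * pi * k" | k :: int where "x = 3 * pi / 2 + 2 * pi * k"
proof -
  obtain i :: int where i: "odd i" "x = of_int i * (pi / 2)" using assms cos_zero_iff_int by blast
  then obtain j where j: "i = 2 * j + 1" by (auto elim: oddE)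
  show thesis
  proof (cases "even j")
    case True
    then obtain k where "j = 2 * k" by blast
    then have "x = pi / 2 + 2 * pi * k" using i j by (simp add: field_simps)
    then show ?thesis by (rule that(1))
  next
    case False
    then obtain k where "j = 2 * k + 1" by (auto elim: oddE)
    then have "x = 3 * pi / 2 + 2 * pi * k" using i j by (simp add: field_simps)
    then show ?thesis by (rule that(2))
  qed
qed

lemma cos_loops: "cos (pi / 2) = 0" "cos (3 * pi / 2) = 0"
  using cos_zero_iff_int[of "3 * pi / 2"] by (auto intro!: exI[of _ 3])

lemma Lag_calibrated_orbit_iff:
  "LagT \<theta> v = sqrt 2 * snd v \<longleftrightarrow> (\<theta>, v) \<in> loop_orbit (pi / 2) \<union> loop_orbit (3 * pi / 2)"
proof
  obtain x where x: "\<theta> = torus_proj x" using torus_proj_exists by blast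
  assume "LagT \<theta> v = sqrt 2 * snd v"
  then have "cos (fst x) = 0" and v: "v = (0, loop_speed (fst x))"
    using Lag_calibrated_eq_0_iff by (auto simp: x LagT.abs_eq)
  have *: "(\<theta>, v) \<in> loop_orbit c" if "fst x = c + 2 * pi * of_int k" for c k
  proof -
    have "torus_proj (c, snd x) = \<theta>"
      unfolding x torus_proj_eq_iff lattice_rel_def using that
      by (intro exI[of _ k] exI[of _ 0]) (simp add: prod_eq_iff)
    moreover have "loop_speed (fst x) = loop_speed c"
      by (simp add: that loop_speed_def mass_def sin_add)
    ultimately show ?thesis using mem_loop_orbit[of c "snd x"] v by simp
  qed
  from \<open>cos (fst x) = 0\<close> show "(\<theta>, v) \<in> loop_orbit (pi / 2) \<union> loop_orbit (3 * pi / 2)"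
    by (rule cos_zero_cases) (auto dest: *)
next
  have *: "LagT \<theta> v = sqrt 2 * snd v" if c: "cos c = 0" and "(\<theta>, v) \<in> loop_orbit c" for c
  proof -
    from that(2) obtain t where "\<theta> = torus_proj (c, loop_speed c * t)" "v = (0, loop_speed c)"
      by (auto simp: loop_orbit_def loop_point_def)
    then show ?thesis using Lag_calibrated_eq_0_iff[of "(c, loop_speed c * t)" v] c by (simp add: LagT.abs_eq)
  qed
  then show "(\<theta>, v) \<in> loop_orbit (pi / 2) \<union> loop_orbit (3 * pi / 2) \<Longrightarrow> LagT \<theta> v = sqrt 2 * snd v"
    using cos_loops by blast
qed

lemma sin_3pi_half: "sin (3 * pi / 2) = -1"
proof -
  have "3 * pi / 2 = pi + pi / 2" by simp
  then show ?thesis by (simp only: sin_add) simp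
qed

lemma loop_speeds: "loop_speed (pi / 2) = sqrt 2 / 3" "loop_speed (3 * pi / 2) = sqrt 2"
  using sin_3pi_half by (simp_all add: loop_speed_def mass_def)

lemma EL_curve_loop:
  assumes "cos c = 0"
  shows "EL_curve (\<lambda>t. (c, y + loop_speed c * t))"
    "velocity (\<lambda>t. (c, y + loop_speed c * t)) = (\<lambda>_. (0, loop_speed c))"
proof -
  have 1: "((\<lambda>t. (c, y + loop_speed c * t)) has_vector_derivative (0, loop_speed c)) (at t)" for t
    by (intro has_vector_derivative_Pair)
       (auto intro!: derivative_eq_intros simp: has_real_derivative_iff_has_vector_derivative[symmetric])
  have "neg_potential_deriv c = 0" using assms by (simp add: neg_potential_deriv_def sin_double)
  with assms show "EL_curve (\<lambda>t. (c, y + loop_speed c * t))"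
    "velocity (\<lambda>t. (c, y + loop_speed c * t)) = (\<lambda>_. (0, loop_speed c))"
    by (auto intro!: EL_curveI[OF 1])
qed

lemma EL_flow_loop_point:
  assumes "cos c = 0"
  shows "EL_flow s (loop_point c t) = loop_point c (t + s)"
proof -
  note L = EL_curve_loop[OF assms, of "loop_speed c * t"]
  have "EL_flow s (torus_proj (c, loop_speed c * t + loop_speed c * 0), (0, loop_speed c))
      = (torus_proj (c, loop_speed c * t + loop_speed c * s), (0, loop_speed c))"
    using EL_flow_tangent_lift[OF L(1), of s] unfolding tangent_lift_def L(2) .
  then show ?thesis by (simp add: loop_point_def distrib_left)
qed

lemma loop_point_period: "loop_point c (t + loop_period c) = loop_point c t"
proof -
  have "lattice_rel (c, loop_speed c * t) (c, loop_speed c * (t + loop_period c))"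
    unfolding lattice_rel_def using loop_speed_pos[of c]
    by (intro exI[of _ 0] exI[of _ 1]) (simp add: loop_period_def field_simps)
  then show ?thesis by (simp add: loop_point_def torus_proj_eq_iff[symmetric])
qed

lemma EL_flow_loop_orbit:
  assumes "cos c = 0" "w \<in> loop_orbit c"
  shows "range (\<lambda>t. EL_flow t w) = loop_orbit c"
proof -
  from assms(2) obtain t0 where w: "w = loop_point c t0" by (auto simp: loop_orbit_def)
  have "range (\<lambda>t. EL_flow t w) = range (\<lambda>t. loop_point c (t0 + t))"
    by (simp add: w EL_flow_loop_point assms(1))
  also have "\<dots> = loop_point c ` range ((+) t0)" by (simp only: image_image)
  also have "\<dots> = loop_orbit c" by (simp only: loop_orbit_def surj_plus)
  finally show ?thesis .
qed

lemma periodic_orbit_loop: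
  assumes "cos c = 0" shows "periodic_orbit (loop_orbit c)"
proof -
  have "EL_flow (loop_period c) (loop_point c 0) = loop_point c 0"
    using EL_flow_loop_point[OF assms] loop_point_period[of c 0] by simp
  moreover have "loop_orbit c = EL_orbit (loop_point c 0)"
    unfolding EL_orbit_def using EL_flow_loop_orbit[OF assms, of "loop_point c 0"] by (simp add: loop_orbit_def)
  ultimately show ?thesis unfolding periodic_orbit_def using loop_period_pos by blast
qed

lemma fst_loop_orbit: "fst ` loop_orbit c = vertical_loop c"
proof -
  have "torus_proj (c, y) \<in> fst ` loop_orbit c" for y using mem_loop_orbit[of c y] by force
  then show ?thesis by (auto simp: vertical_loop_def loop_orbit_def loop_point_def)
qed

lemma continuous_loop_point: "continuous_on UNIV (loop_point c)"
proof -
  have "continuous_on UNIV (\<lambda>t. ((c, loop_speed c * t), (0::real, loop_speed c)))" by (intro continuous_intros)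
  from continuous_on_compose2[OF continuous_tangent_proj this subset_UNIV]
  show ?thesis unfolding loop_point_def[abs_def] by simp
qed

lemma loop_point_mod_period:
  obtains s where "s \<in> {0..<loop_period c}" "loop_point c t = loop_point c s"
proof -
  define P where "P = loop_period c"
  have P: "P > 0" by (simp add: P_def loop_period_pos)
  have nat: "loop_point c (t + real n * P) = loop_point c t" for t n
  proof (induction n)
    case (Suc n)
    have "loop_point c (t + real (Suc n) * P) = loop_point c (t + real n * P + P)" by (simp add: algebra_simps)
    then show ?case using Suc loop_point_period by (simp add: P_def)
  qed simp
  have int: "loop_point c (t + of_int k * P) = loop_point c t" for k
  proof (cases "k \<ge> 0")
    case True then show ?thesis using nat[of t "nat k"] by simp
  next
    case False then show ?thesis using nat[of "t + of_int k * P" "nat (- k)"] by simp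
  qed
  define s where "s = t + of_int (- \<lfloor>t / P\<rfloor>) * P"
  have "s \<in> {0..<P}"
    using floor_divide_lower[OF P, of t] floor_divide_upper[OF P, of t] by (auto simp: s_def algebra_simps)
  moreover have "loop_point c t = loop_point c s" unfolding s_def by (rule int[symmetric])
  ultimately show thesis using that by (simp add: P_def)
qed

lemma compact_loop_orbit: "compact (loop_orbit c)"
proof -
  have "loop_orbit c = loop_point c ` {0..loop_period c}"
  proof -
    have "loop_point c t \<in> loop_point c ` {0..loop_period c}" for t
      by (rule loop_point_mod_period[of c t]) auto
    then show ?thesis by (auto simp: loop_orbit_def)
  qed
  then show ?thesis
    using compact_continuous_image[OF continuous_on_subset[OF continuous_loop_point] compact_Icc] by simp
qed

text \<open>
Since \<open>sin c\<close> is 1 or -1, it determines the angle modulo \<open>2 * pi\<close>.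
\<close>
lemma closed_loop_orbit:
  assumes c: "cos c = 0" shows "closed (loop_orbit c)"
proof -
  have eq: "loop_orbit c = (\<lambda>w. (torus_sin w, snd w)) -` {(sin c, (0, loop_speed c))}"
  proof (intro set_eqI iffI)
    fix w assume "w \<in> loop_orbit c"
    then obtain t where "w = tangent_proj ((c, loop_speed c * t), (0, loop_speed c))"
      by (auto simp: loop_orbit_def loop_point_def)
    then show "w \<in> (\<lambda>w. (torus_sin w, snd w)) -` {(sin c, (0, loop_speed c))}"
      using torus_sin_tangent_proj by (simp add: tangent_proj_fst_snd)
  next
    fix w :: tangent
    assume w: "w \<in> (\<lambda>w. (torus_sin w, snd w)) -` {(sin c, (0, loop_speed c))}"
    obtain x v where xv: "w = (torus_proj x, v)" by (rule tangent_proj_exists)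
    have sw: "torus_sin w = sin c" and vw: "snd w = (0, loop_speed c)" using w by simp_all
    have s: "sin (fst x) = sin c" using sw torus_sin_tangent_proj[of x v] unfolding xv by simp
    have v: "v = (0, loop_speed c)" using vw unfolding xv by simp
    have "sin c * sin c = 1" using sin_cos_squared_add[of c] c by (simp add: power2_eq_square)
    then have "cos (fst x - c) = 1" using s c by (simp add: cos_diff)
    then obtain k :: int where "fst x - c = of_int k * 2 * pi" using cos_one_2pi_int by blast
    then have "torus_proj (c, snd x) = torus_proj x"
      unfolding torus_proj_eq_iff lattice_rel_def
      by (intro exI[of _ k] exI[of _ 0]) (simp add: prod_eq_iff algebra_simps)
    then show "w \<in> loop_orbit c" using mem_loop_orbit[of c "snd x"] by (simp add: xv v)
  qed
  have "continuous_on UNIV (\<lambda>w. (torus_sin w, snd w))"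
    by (intro continuous_on_Pair continuous_torus_sin continuous_on_snd continuous_on_id)
  then show ?thesis unfolding eq by (rule closed_vimage[rotated]) simp
qed

section \<open>Support, action and rotation vector of invariant measures\<close>

lemma closed_msupport: "closed (msupport \<mu>)"
proof -
  have "- msupport \<mu> = \<Union>{U. open U \<and> emeasure \<mu> U = 0}"
    by (auto simp: msupport_def zero_less_iff_neq_zero)
  moreover have "open \<dots>" by (intro open_Union) auto
  ultimately show ?thesis by (simp add: closed_def)
qed

text \<open>
By second countability the complement of the support is a countable union of null sets.
\<close>
lemma AE_msupport:
  fixes \<mu> :: "'a::second_countable_topology measure"
  assumes sets: "sets \<mu> = sets borel"
  shows "AE w in \<mu>. w \<in> msupport \<mu>"
proof -
  obtain B :: "'a set set" where B: "countable B" "topological_basis B"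
    using ex_countable_basis by blast
  define N where "N = {b \<in> B. emeasure \<mu> b = 0}"
  have "countable N" using B(1) by (simp add: N_def)
  then have "AE w in \<mu>. \<forall>b\<in>N. w \<notin> b"
  proof (rule AE_ball_countable[THEN iffD2], intro ballI)
    fix b assume b: "b \<in> N"
    then have "open b" using topological_basis_open[OF B(2)] by (auto simp: N_def)
    then have "b \<in> sets \<mu>" by (simp add: sets)
    with b have "b \<in> null_sets \<mu>" by (auto simp: N_def)
    then show "AE w in \<mu>. w \<notin> b" by (rule AE_not_in)
  qed
  then show ?thesis
  proof (rule AE_mp, intro AE_I2 impI)
    fix w assume w: "\<forall>b\<in>N. w \<notin> b"
    show "w \<in> msupport \<mu>" unfolding msupport_def
    proof (intro CollectI allI impI)
      fix U assume "open U \<and> w \<in> U"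
      then obtain b where b: "b \<in> B" "w \<in> b" "b \<subseteq> U" by (meson topological_basisE[OF B(2)])
      have "emeasure \<mu> b \<noteq> 0" using w b by (auto simp: N_def)
      moreover have "emeasure \<mu> b \<le> emeasure \<mu> U"
        using b(3) \<open>open U \<and> w \<in> U\<close> by (intro emeasure_mono) (auto simp: sets)
      ultimately show "emeasure \<mu> U > 0" by (metis le_zero_eq zero_less_iff_neq_zero)
    qed
  qed
qed

text \<open>
The Lagrangian minus its calibration: nonnegative, and zero exactly on the two loops.
\<close>
definition excess :: "tangent \<Rightarrow> real" where
  "excess w = LagT (fst w) (snd w) - sqrt 2 * snd (snd w)"

lemma continuous_LagT: "continuous_on UNIV (\<lambda>w. LagT (fst w) (snd w))"
proof (rule continuous_on_tangentI)
  have "continuous_on UNIV (\<lambda>z. Lag (fst z) (snd z))"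
    unfolding Lag_def mass_def potential_def using mass_pos(2)[unfolded mass_def]
    by (intro continuous_intros) auto
  then show "continuous_on UNIV (\<lambda>z. LagT (fst (tangent_proj z)) (snd (tangent_proj z)))"
    by (simp add: tangent_proj_fst_snd LagT.abs_eq)
qed

lemma LagT_bound: "\<bar>LagT \<theta> v\<bar> \<le> 3 / 2 * (norm v)\<^sup>2 + 3"
proof -
  obtain x where "\<theta> = torus_proj x" using torus_proj_exists by blast
  then show ?thesis using Lag_pos[of x v] Lag_le[of x v] by (simp add: LagT.abs_eq)
qed

text \<open>
A compact support bounds the velocity almost everywhere.
\<close>
lemma invariant_integrable:
  assumes "invariant_prob \<nu>"
  shows "integrable \<nu> snd" "integrable \<nu> (\<lambda>w. LagT (fst w) (snd w))"
proof -
  interpret prob_space \<nu> using assms by (simp add: invariant_prob_def)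
  have sets: "sets \<nu> = sets borel" and comp: "compact (msupport \<nu>)"
    using assms by (auto simp: invariant_prob_def)
  have meas: "f \<in> borel_measurable \<nu>" if "continuous_on UNIV f" for f :: "tangent \<Rightarrow> 'b::topological_space"
    using borel_measurable_continuous_onI[OF that] measurable_cong_sets[OF sets refl] by blast
  have "compact (snd ` msupport \<nu>)"
    by (intro compact_continuous_image comp continuous_on_snd continuous_on_id)
  then obtain R where R: "\<And>w. w \<in> msupport \<nu> \<Longrightarrow> norm (snd w) \<le> R"
    using compact_imp_bounded[THEN bounded_iff[THEN iffD1]] by (metis image_eqI)
  have AE: "AE w in \<nu>. norm (snd w) \<le> R"
    using AE_msupport[OF sets] by eventually_elim (rule R)
  show "integrable \<nu> snd"
    by (rule integrable_const_bound[OF AE]) (intro meas continuous_on_snd continuous_on_id)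
  have "AE w in \<nu>. norm (LagT (fst w) (snd w)) \<le> 3 / 2 * R\<^sup>2 + 3"
    using AE
  proof eventually_elim
    case (elim w)
    then have "(norm (snd w))\<^sup>2 \<le> R\<^sup>2" by (intro power_mono) auto
    then show ?case using LagT_bound[of "fst w" "snd w"] by simp
  qed
  then show "integrable \<nu> (\<lambda>w. LagT (fst w) (snd w))"
    by (rule integrable_const_bound) (intro meas continuous_LagT)
qed

lemma excess_nonneg: "0 \<le> excess w"
proof -
  obtain x v where "w = (torus_proj x, v)" by (rule tangent_proj_exists)
  then show ?thesis using Lag_nonneg_calibrated[of x v] by (simp add: excess_def LagT.abs_eq)
qed

lemma excess_eq_0_iff: "excess w = 0 \<longleftrightarrow> w \<in> loop_orbit (pi / 2) \<union> loop_orbit (3 * pi / 2)"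
  using Lag_calibrated_orbit_iff[of "fst w" "snd w"] by (simp add: excess_def)

lemma snd_rotation:
  assumes "invariant_prob \<nu>"
  shows "snd (rotation \<nu>) = (\<integral>w. snd (snd w) \<partial>\<nu>) / (2 * pi)"
    and "fst (rotation \<nu>) = (\<integral>w. fst (snd w) \<partial>\<nu>) / (2 * pi)"
    and "integrable \<nu> (\<lambda>w. snd (snd w))" and "integrable \<nu> (\<lambda>w. fst (snd w))"
  using integral_bounded_linear[OF bounded_linear_snd invariant_integrable(1)[OF assms]]
    integral_bounded_linear[OF bounded_linear_fst invariant_integrable(1)[OF assms]]
    integrable_bounded_linear[OF bounded_linear_snd invariant_integrable(1)[OF assms]]
    integrable_bounded_linear[OF bounded_linear_fst invariant_integrable(1)[OF assms]]
  by (auto simp: rotation_def)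

lemma average_action_calibrated:
  assumes "invariant_prob \<nu>"
  shows "average_action \<nu> = sqrt 2 * (2 * pi * snd (rotation \<nu>)) + (\<integral>w. excess w \<partial>\<nu>)"
    and "integrable \<nu> excess"
proof -
  note I = invariant_integrable(2)[OF assms] snd_rotation(3)[OF assms]
  show "integrable \<nu> excess" unfolding excess_def using I by auto
  have "(\<integral>w. excess w \<partial>\<nu>) = average_action \<nu> - sqrt 2 * (\<integral>w. snd (snd w) \<partial>\<nu>)"
    unfolding excess_def average_action_def using I by simp
  then show "average_action \<nu> = sqrt 2 * (2 * pi * snd (rotation \<nu>)) + (\<integral>w. excess w \<partial>\<nu>)"
    by (simp add: snd_rotation(1)[OF assms])
qed

text \<open>
The calibration bounds the average action by a linear function of the rotation vector; equality means
that the excess vanishes almost everywhere.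
\<close>
lemma average_action_ge:
  assumes "invariant_prob \<nu>"
  shows "sqrt 2 * (2 * pi * snd (rotation \<nu>)) \<le> average_action \<nu>"
    and "average_action \<nu> = sqrt 2 * (2 * pi * snd (rotation \<nu>)) \<longleftrightarrow>
      (AE w in \<nu>. w \<in> loop_orbit (pi / 2) \<union> loop_orbit (3 * pi / 2))"
proof -
  have "0 \<le> (\<integral>w. excess w \<partial>\<nu>)" by (simp add: excess_nonneg)
  then show "sqrt 2 * (2 * pi * snd (rotation \<nu>)) \<le> average_action \<nu>"
    using average_action_calibrated(1)[OF assms] by simp
  have "(\<integral>w. excess w \<partial>\<nu>) = 0 \<longleftrightarrow> (AE w in \<nu>. excess w = 0)"
    by (rule integral_nonneg_eq_0_iff_AE[OF average_action_calibrated(2)[OF assms]]) (simp add: excess_nonneg)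
  then show "average_action \<nu> = sqrt 2 * (2 * pi * snd (rotation \<nu>)) \<longleftrightarrow>
      (AE w in \<nu>. w \<in> loop_orbit (pi / 2) \<union> loop_orbit (3 * pi / 2))"
    unfolding average_action_calibrated(1)[OF assms] by (simp add: excess_eq_0_iff)
qed

section \<open>The uniform measures on the loops\<close>

text \<open>
Moving the window by \<open>d \<le> P\<close> trades its left end for an equal piece, a period later, at its right
end. Every shift is a multiple of such a small one.
\<close>
lemma nn_integral_periodic:
  fixes f :: "real \<Rightarrow> ennreal"
  assumes f[measurable]: "f \<in> borel_measurable borel" and per: "\<And>t. f (t + P) = f t" and P: "P > 0"
  shows "(\<integral>\<^sup>+t. f (t + s) * indicator {0..<P} t \<partial>lborel) = (\<integral>\<^sup>+t. f t * indicator {0..<P} t \<partial>lborel)"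
proof -
  define J where "J = (\<lambda>a. \<integral>\<^sup>+t. f t * indicator {a..<a + P} t \<partial>lborel)"
  have shift: "(\<integral>\<^sup>+t. g t \<partial>lborel) = (\<integral>\<^sup>+t. g (t + a) \<partial>lborel)"
    if "g \<in> borel_measurable borel" for g :: "real \<Rightarrow> ennreal" and a
    using nn_integral_real_affine[OF that, of 1 a] by (simp add: add.commute)
  have split: "(\<integral>\<^sup>+t. f t * indicator {a..<c} t \<partial>lborel)
     = (\<integral>\<^sup>+t. f t * indicator {a..<b} t \<partial>lborel) + (\<integral>\<^sup>+t. f t * indicator {b..<c} t \<partial>lborel)"
    if "a \<le> b" "b \<le> c" for a b c
    using that by (subst nn_integral_add[symmetric]) (auto intro!: nn_integral_cong split: split_indicator)
  have step: "J (a + d) = J a" if "0 \<le> d" "d \<le> P" for a d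
  proof -
    have "(\<integral>\<^sup>+t. f t * indicator {a + P..<a + d + P} t \<partial>lborel) = (\<integral>\<^sup>+t. f t * indicator {a..<a + d} t \<partial>lborel)"
      by (subst shift[of _ P]) (auto intro!: nn_integral_cong simp: per split: split_indicator)
    then show ?thesis
      unfolding J_def using that split[of "a + d" "a + P" "a + d + P"] split[of a "a + d" "a + P"]
      by (simp add: add.commute)
  qed
  have steps: "J (a + real n * d) = J a" if "0 \<le> d" "d \<le> P" for a n d
  proof (induction n)
    case (Suc n)
    have "J (a + real (Suc n) * d) = J (a + real n * d + d)" by (simp add: algebra_simps)
    then show ?case using step[OF that] Suc by simp
  qed simp
  have pos: "J (a + s) = J a" if "0 \<le> s" for a s
  proof -
    \<comment> \<open>Divide the shift into steps no longer than one period.\<close>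
    obtain n where n: "s / P < real n" using reals_Archimedean2 by blast
    with that P have n0: "n > 0" by (cases n) (auto simp: field_simps)
    have "s / real n \<le> P" using n n0 P by (simp add: field_simps)
    then show ?thesis using steps[of "s / real n" a n] that n0 by simp
  qed
  have "J s = J 0"
    using pos[of s 0] pos[of "- s" s] by (cases "s \<ge> 0") auto
  moreover have "J s = (\<integral>\<^sup>+t. f (t + s) * indicator {0..<P} t \<partial>lborel)"
    unfolding J_def by (subst shift[of _ s]) (auto intro!: nn_integral_cong split: split_indicator)
  ultimately show ?thesis by (simp add: J_def)
qed

definition loop_measure :: "real \<Rightarrow> tangent measure" where
  "loop_measure c = distr (uniform_measure lborel {0..<loop_period c}) borel (loop_point c)"

lemma measurable_loop_point [measurable]: "loop_point c \<in> borel \<rightarrow>\<^sub>M borel"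
  by (intro borel_measurable_continuous_onI continuous_loop_point)

lemma sets_loop_measure [simp]: "sets (loop_measure c) = sets borel" "space (loop_measure c) = UNIV"
  by (simp_all add: loop_measure_def)

lemma nn_integral_loop:
  assumes A: "A \<in> sets borel"
  shows "(\<integral>\<^sup>+t. indicator A (loop_point c (t + s)) * indicator {0..<loop_period c} t \<partial>lborel)
     = ennreal (loop_period c) * emeasure (loop_measure c) A"
proof -
  define P where "P = loop_period c"
  have P: "P > 0" by (simp add: P_def loop_period_pos)
  have [measurable]: "A \<in> sets borel" by fact
  have "(\<integral>\<^sup>+t. indicator A (loop_point c (t + s)) * indicator {0..<P} t \<partial>lborel)
     = (\<integral>\<^sup>+t. indicator A (loop_point c t) * indicator {0..<P} t \<partial>lborel)"
    by (rule nn_integral_periodic[OF _ _ P]) (auto simp: loop_point_period P_def)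
  also have "\<dots> = (\<integral>\<^sup>+t. indicator ({0..<P} \<inter> loop_point c -` A) t \<partial>lborel)"
    by (intro nn_integral_cong) (auto split: split_indicator)
  also have "\<dots> = emeasure lborel ({0..<P} \<inter> loop_point c -` A)"
    using measurable_sets_borel[OF measurable_loop_point A]
    by (intro nn_integral_indicator) auto
  also have "\<dots> = ennreal P * emeasure (loop_measure c) A"
  proof -
    have B: "loop_point c -` A \<in> sets lborel"
      using measurable_sets_borel[OF measurable_loop_point A] by simp
    have "emeasure (loop_measure c) A = emeasure lborel ({0..<P} \<inter> loop_point c -` A) / ennreal P"
      unfolding loop_measure_def using A B P
      by (subst emeasure_distr) (auto simp: P_def[symmetric])
    then show ?thesis
      using P by (simp add: ennreal_times_divide mult.commute[of "ennreal P"] mult_divide_eq_ennreal)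
  qed
  finally show ?thesis by (simp add: P_def)
qed

lemma emeasure_loop_eqI:
  assumes "A \<in> sets borel" "B \<in> sets borel"
    and "\<And>t. loop_point c t \<in> A \<longleftrightarrow> loop_point c (t + s) \<in> B"
  shows "emeasure (loop_measure c) A = emeasure (loop_measure c) B"
proof -
  have "ennreal (loop_period c) * emeasure (loop_measure c) A
      = ennreal (loop_period c) * emeasure (loop_measure c) B"
    using nn_integral_loop[OF assms(1), of c 0] nn_integral_loop[OF assms(2), of c s] assms(3)
    by (simp add: indicator_def)
  then show ?thesis using loop_period_pos[of c] by (simp add: ennreal_mult_cancel_left)
qed

lemma prob_space_loop_measure: "prob_space (loop_measure c)"
  unfolding loop_measure_def
  by (intro prob_space.prob_space_distr prob_space_uniform_measure)
     (use loop_period_pos[of c] in auto)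

lemma AE_loop_measure:
  assumes "cos c = 0" shows "AE w in loop_measure c. w \<in> loop_orbit c"
proof -
  have b: "- loop_orbit c \<in> sets borel" using closed_loop_orbit[OF assms] by auto
  have "emeasure (loop_measure c) (- loop_orbit c) = emeasure (loop_measure c) {}"
    by (rule emeasure_loop_eqI[OF b, of _ _ 0]) (auto simp: loop_orbit_def)
  then show ?thesis using b by (intro AE_I[of _ _ "- loop_orbit c"]) auto
qed

lemma msupport_loop_measure:
  assumes "cos c = 0" shows "msupport (loop_measure c) = loop_orbit c"
proof (intro set_eqI iffI)
  fix w assume w: "w \<in> msupport (loop_measure c)"
  show "w \<in> loop_orbit c"
  proof (rule ccontr)
    assume "w \<notin> loop_orbit c"
    moreover have "open (- loop_orbit c)" using closed_loop_orbit[OF assms] by auto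
    ultimately have "emeasure (loop_measure c) (- loop_orbit c) > 0"
      using w by (auto simp: msupport_def)
    moreover have "emeasure (loop_measure c) (- loop_orbit c) = 0"
      using AE_loop_measure[OF assms] closed_loop_orbit[OF assms]
      by (subst (asm) AE_iff_measurable[of "- loop_orbit c"]) auto
    ultimately show False by simp
  qed
next
  fix w assume "w \<in> loop_orbit c"
  then obtain t0 where w: "w = loop_point c t0" by (auto simp: loop_orbit_def)
  show "w \<in> msupport (loop_measure c)" unfolding msupport_def
  proof (intro CollectI allI impI)
    fix U assume U: "open U \<and> w \<in> U"
    have "open (loop_point c -` U)"
      using continuous_loop_point U by (simp add: continuous_on_open_vimage)
    with U obtain e where e: "e > 0" "\<And>t. \<bar>t - t0\<bar> < e \<Longrightarrow> loop_point c t \<in> U"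
      unfolding open_dist w by (auto simp: dist_real_def)
    define d where "d = min e (loop_period c)"
    have d: "d > 0" using e loop_period_pos by (simp add: d_def)
    have "0 < ennreal d" using d by simp
    also have "ennreal d = (\<integral>\<^sup>+t. indicator {0..<d} t \<partial>lborel)" using d by simp
    also have "\<dots> \<le> (\<integral>\<^sup>+t. indicator U (loop_point c (t + t0)) * indicator {0..<loop_period c} t \<partial>lborel)"
      by (intro nn_integral_mono) (auto simp: d_def e split: split_indicator)
    also have "\<dots> = ennreal (loop_period c) * emeasure (loop_measure c) U"
      using U by (intro nn_integral_loop) auto
    finally show "emeasure (loop_measure c) U > 0"
      by (metis mult_zero_right zero_less_iff_neq_zero)
  qed
qed

lemma invariant_loop_measure:
  assumes "cos c = 0" shows "invariant_prob (loop_measure c)"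
  unfolding invariant_prob_def
proof (intro conjI allI ballI)
  show "prob_space (loop_measure c)" by (rule prob_space_loop_measure)
  show "compact (msupport (loop_measure c))"
    unfolding msupport_loop_measure[OF assms] by (rule compact_loop_orbit)
  fix t and A :: "tangent set" assume A: "A \<in> sets borel"
  show "emeasure (loop_measure c) (EL_flow t -` A) = emeasure (loop_measure c) A"
    by (rule emeasure_loop_eqI[OF measurable_sets_borel[OF measurable_EL_flow A] A])
       (simp add: EL_flow_loop_point[OF assms])
qed simp

lemma ergodic_loop_measure:
  assumes "cos c = 0" shows "ergodic_measure (loop_measure c)"
  unfolding ergodic_measure_def
proof (intro conjI ballI impI)
  show "invariant_prob (loop_measure c)" by (rule invariant_loop_measure[OF assms])
  interpret prob_space "loop_measure c" by (rule prob_space_loop_measure)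
  fix A :: "tangent set" assume A: "A \<in> sets borel" and inv: "\<forall>t. EL_flow t -` A = A"
  have "loop_point c t \<in> A \<longleftrightarrow> loop_point c 0 \<in> A" for t
    using EL_flow_loop_point[OF assms, of t 0] inv by (metis add_0 vimage_eq)
  then consider "loop_orbit c \<subseteq> A" | "loop_orbit c \<inter> A = {}" by (auto simp: loop_orbit_def)
  then show "measure (loop_measure c) A = 0 \<or> measure (loop_measure c) A = 1"
  proof cases
    case 1
    then have "AE w in loop_measure c. w \<in> A" using AE_loop_measure[OF assms] by auto
    then show ?thesis using prob_eq_1 A by simp
  next
    case 2
    then have "AE w in loop_measure c. w \<notin> A" using AE_loop_measure[OF assms] by auto
    then show ?thesis using prob_eq_0 A by simp
  qed
qed

section \<open>Invariant measures carried by the loops\<close>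

abbreviation loop1 :: "tangent set" where "loop1 \<equiv> loop_orbit (pi / 2)"
abbreviation loop2 :: "tangent set" where "loop2 \<equiv> loop_orbit (3 * pi / 2)"

lemma snd_loop_orbit: "w \<in> loop_orbit c \<Longrightarrow> snd w = (0, loop_speed c)"
  by (auto simp: loop_orbit_def loop_point_def)

lemma loops_disjoint: "loop1 \<inter> loop2 = {}"
proof (rule equals0I)
  fix w assume "w \<in> loop1 \<inter> loop2"
  then have "loop_speed (pi / 2) = loop_speed (3 * pi / 2)"
    using snd_loop_orbit by (metis IntE prod.inject)
  then show False by (simp add: loop_speeds)
qed

lemma loops_borel [measurable]: "loop1 \<in> sets borel" "loop2 \<in> sets borel"
  by (intro borel_closed closed_loop_orbit cos_loops)+

text \<open>
Motion with constant velocity. It agrees with the Euler-Lagrange flow on the two loops, and it is jointly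
continuous in time and phase point by inspection.
\<close>
definition free_motion :: "real \<times> tangent \<Rightarrow> tangent" where
  "free_motion = (\<lambda>(t, w). tangent_proj (rep_torus (fst w) + t *\<^sub>R snd w, snd w))"

lemma free_motion_tangent_proj: "free_motion (t, tangent_proj (x, v)) = tangent_proj (x + t *\<^sub>R v, v)"
proof -
  have "lattice_rel x (rep_torus (torus_proj x))" by (rule lattice_rel_rep_torus)
  then have "lattice_rel (x + t *\<^sub>R v) (rep_torus (torus_proj x) + t *\<^sub>R v)"
    unfolding lattice_rel_def by (elim exE) (auto simp: add.assoc add.commute[of _ "t *\<^sub>R v"] add.left_commute[of _ "t *\<^sub>R v"])
  then show ?thesis by (simp add: free_motion_def torus_proj_eq_iff[symmetric])
qed

lemma free_motion_loop_point: "free_motion (s, loop_point c t) = loop_point c (t + s)"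
  using free_motion_tangent_proj[of s "(c, loop_speed c * t)" "(0, loop_speed c)"]
  by (simp add: loop_point_def algebra_simps)

lemma continuous_free_motion: "continuous_on UNIV free_motion"
proof (rule continuous_on_open_quotient[of "map_prod id tangent_proj"])
  show "open (map_prod id tangent_proj ` S)" if "open S" for S :: "(real \<times> plane \<times> plane) set"
    by (rule open_image_map_prod[OF _ _ that]) (simp_all add: open_tangent_proj_image)
  show "surj (map_prod (id :: real \<Rightarrow> real) tangent_proj)"
    by (rule map_prod_surj[OF surj_id surj_tangent_proj])
  have eq: "free_motion (map_prod id tangent_proj z) = tangent_proj (fst (snd z) + fst z *\<^sub>R snd (snd z), snd (snd z))"
    for z :: "real \<times> plane \<times> plane"
    using free_motion_tangent_proj[of "fst z" "fst (snd z)" "snd (snd z)"] by (simp add: map_prod_def case_prod_beta del: tangent_proj_simp)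
  have "continuous_on UNIV (\<lambda>z::real \<times> plane \<times> plane. (fst (snd z) + fst z *\<^sub>R snd (snd z), snd (snd z)))"
    by (intro continuous_intros)
  from continuous_on_compose2[OF continuous_tangent_proj this subset_UNIV]
  show "continuous_on UNIV (\<lambda>z::real \<times> plane \<times> plane. free_motion (map_prod id tangent_proj z))"
    by (simp only: eq)
qed

text \<open>
Unique ergodicity of the flow on a single periodic orbit: averaging the invariance over a period and
exchanging the integrals replaces the indicator of \<open>A\<close> by its mean over the orbit, which is the same at every
point of the loop.
\<close>
lemma emeasure_invariant_on_loops:
  assumes inv: "invariant_prob \<nu>" and AE: "AE w in \<nu>. w \<in> loop1 \<union> loop2"
    and c: "c \<in> {pi / 2, 3 * pi / 2}" and A: "A \<in> sets borel"
  shows "emeasure \<nu> (A \<inter> loop_orbit c) = emeasure (loop_measure c) A * emeasure \<nu> (loop_orbit c)"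
proof -
  interpret prob_space \<nu> using inv by (simp add: invariant_prob_def)
  have sets: "sets \<nu> = sets borel" using inv by (simp add: invariant_prob_def)
  have cc: "cos c = 0" using c by (elim insertE emptyE) (simp_all only: cos_loops)
  have Qb: "loop_orbit c \<in> sets borel" by (rule borel_closed[OF closed_loop_orbit[OF cc]])
  define P where "P = loop_period c"
  have P: "P > 0" by (simp add: P_def loop_period_pos)
  define A' where "A' = A \<inter> loop_orbit c"
  have A'[measurable]: "A' \<in> sets borel" using A Qb by (simp add: A'_def)
  \<comment> \<open>Fubini needs joint measurability in time and phase point, which is plain for the free motion.\<close>
  have flow: "free_motion (t, w) = EL_flow t w" if wQ: "w \<in> loop1 \<union> loop2" for t w
  proof -
    obtain c' where "w \<in> loop_orbit c'" "cos c' = 0" using wQ cos_loops by blast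
    moreover from this obtain t' where "w = loop_point c' t'" by (auto simp: loop_orbit_def)
    ultimately show ?thesis by (simp add: free_motion_loop_point EL_flow_loop_point)
  qed
  have slice: "(\<integral>\<^sup>+w. indicator A' (free_motion (t, w)) \<partial>\<nu>) = emeasure \<nu> A'" for t
  proof -
    have "(\<integral>\<^sup>+w. indicator A' (free_motion (t, w)) \<partial>\<nu>) = (\<integral>\<^sup>+w. indicator (EL_flow t -` A') w \<partial>\<nu>)"
      by (intro nn_integral_cong_AE AE_mp[OF AE AE_I2] impI) (simp only: flow indicator_def vimage_eq)
    also have "\<dots> = emeasure \<nu> (EL_flow t -` A')"
      using measurable_sets_borel[OF measurable_EL_flow A'] by (intro nn_integral_indicator) (simp add: sets)
    also have "\<dots> = emeasure \<nu> A'" using inv A' by (simp add: invariant_prob_def)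
    finally show ?thesis .
  qed
  have orbit: "(\<integral>\<^sup>+t. indicator A' (free_motion (t, w)) * indicator {0..<P} t \<partial>lborel)
      = ennreal P * (emeasure (loop_measure c) A * indicator (loop_orbit c) w)" if wQ: "w \<in> loop1 \<union> loop2" for w
  proof (cases "w \<in> loop_orbit c")
    case True
    then obtain s where w: "w = loop_point c s" by (auto simp: loop_orbit_def)
    have "(\<integral>\<^sup>+t. indicator A' (free_motion (t, w)) * indicator {0..<P} t \<partial>lborel)
        = (\<integral>\<^sup>+t. indicator A (loop_point c (t + s)) * indicator {0..<P} t \<partial>lborel)"
      by (intro nn_integral_cong)
         (auto simp: w free_motion_loop_point A'_def loop_orbit_def add.commute split: split_indicator)
    also have "\<dots> = ennreal P * emeasure (loop_measure c) A"
      unfolding P_def by (rule nn_integral_loop[OF A])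
    finally show ?thesis using True by simp
  next
    case False
    have "free_motion (t, w) \<notin> A'" for t
    proof -
      obtain c' where c': "w \<in> loop_orbit c'" "c' \<in> {pi / 2, 3 * pi / 2}" using wQ by blast
      then obtain s where s: "w = loop_point c' s" by (auto simp: loop_orbit_def)
      have "c' \<noteq> c" using False c'(1) by blast
      then have "loop_orbit c' \<inter> loop_orbit c = {}" using loops_disjoint c c'(2) by blast
      moreover have "free_motion (t, w) \<in> loop_orbit c'"
        unfolding s free_motion_loop_point loop_orbit_def by (rule rangeI)
      ultimately show ?thesis unfolding A'_def by blast
    qed
    then show ?thesis using False by simp
  qed
  interpret pair_sigma_finite lborel \<nu> by standard
  have meas: "(\<lambda>z. indicator A' (free_motion z) * indicator {0..<P} (fst z) :: ennreal) \<in> borel_measurable (lborel \<Otimes>\<^sub>M \<nu>)"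
  proof -
    have "sets (lborel \<Otimes>\<^sub>M \<nu>) = sets (borel \<Otimes>\<^sub>M (borel :: tangent measure))"
      by (intro sets_pair_measure_cong) (simp_all add: sets)
    also have "\<dots> = sets (borel :: (real \<times> tangent) measure)" by (simp only: borel_prod)
    finally have S: "sets (lborel \<Otimes>\<^sub>M \<nu>) = sets (borel :: (real \<times> tangent) measure)" .
    have 1: "(\<lambda>z. indicator A' (free_motion z) :: ennreal) \<in> borel_measurable borel"
      by (rule measurable_compose[OF _ borel_measurable_indicator[OF A']])
         (intro borel_measurable_continuous_onI continuous_free_motion)
    have "fst \<in> (borel :: (real \<times> tangent) measure) \<rightarrow>\<^sub>M borel"
      by (intro borel_measurable_continuous_onI continuous_on_fst continuous_on_id)
    then have 2: "(\<lambda>z. indicator {0..<P} (fst z) :: ennreal) \<in> borel_measurable (borel :: (real \<times> tangent) measure)"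
      by (rule measurable_compose) (rule borel_measurable_indicator, simp)
    show ?thesis
      unfolding measurable_cong_sets[OF S refl] by (rule borel_measurable_times_ennreal[OF 1 2])
  qed
  have "ennreal P * emeasure \<nu> A' = (\<integral>\<^sup>+t. (\<integral>\<^sup>+w. indicator A' (free_motion (t, w)) * indicator {0..<P} t \<partial>\<nu>) \<partial>lborel)"
  proof -
    have "(\<integral>\<^sup>+w. indicator A' (free_motion (t, w)) * indicator {0..<P} t \<partial>\<nu>) = emeasure \<nu> A' * indicator {0..<P} t" for t
      by (cases "t \<in> {0..<P}") (simp_all add: slice)
    then show ?thesis using P by (simp add: nn_integral_cmult_indicator mult.commute)
  qed
  also have "\<dots> = (\<integral>\<^sup>+w. (\<integral>\<^sup>+t. indicator A' (free_motion (t, w)) * indicator {0..<P} t \<partial>lborel) \<partial>\<nu>)"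
    using Fubini[OF meas] by simp
  also have "\<dots> = (\<integral>\<^sup>+w. ennreal P * (emeasure (loop_measure c) A * indicator (loop_orbit c) w) \<partial>\<nu>)"
    by (intro nn_integral_cong_AE AE_mp[OF AE AE_I2] impI orbit)
  also have "\<dots> = ennreal P * (emeasure (loop_measure c) A * emeasure \<nu> (loop_orbit c))"
    unfolding mult.assoc[symmetric] by (rule nn_integral_cmult_indicator) (simp only: sets Qb)
  finally have "ennreal P * emeasure \<nu> A' = ennreal P * (emeasure (loop_measure c) A * emeasure \<nu> (loop_orbit c))" .
  then have "emeasure \<nu> A' = emeasure (loop_measure c) A * emeasure \<nu> (loop_orbit c)"
    unfolding ennreal_mult_cancel_left using P by auto
  then show ?thesis by (simp only: A'_def)
qed

lemma measure_invariant_on_loops: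
  assumes inv: "invariant_prob \<nu>" and AE: "AE w in \<nu>. w \<in> loop1 \<union> loop2" and A: "A \<in> sets borel"
  shows "measure \<nu> A = measure (loop_measure (pi / 2)) A * measure \<nu> loop1
     + measure (loop_measure (3 * pi / 2)) A * measure \<nu> loop2"
    and "measure \<nu> loop1 + measure \<nu> loop2 = 1"
proof -
  interpret prob_space \<nu> using inv by (simp add: invariant_prob_def)
  have sets: "sets \<nu> = sets borel" using inv by (simp add: invariant_prob_def)
  have split: "measure \<nu> B = measure \<nu> (B \<inter> loop1) + measure \<nu> (B \<inter> loop2)" if B: "B \<in> sets borel" for B
  proof -
    have "measure \<nu> B = measure \<nu> (B \<inter> loop1 \<union> B \<inter> loop2)"
      using B loops_borel by (intro finite_measure_eq_AE AE_mp[OF AE AE_I2]) (auto simp: sets)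
    also have "\<dots> = measure \<nu> (B \<inter> loop1) + measure \<nu> (B \<inter> loop2)"
      using B loops_borel loops_disjoint by (intro finite_measure_Union) (auto simp: sets)
    finally show ?thesis .
  qed
  have m: "measure \<nu> (A \<inter> loop_orbit c) = measure (loop_measure c) A * measure \<nu> (loop_orbit c)"
    if "c \<in> {pi / 2, 3 * pi / 2}" for c
    using emeasure_invariant_on_loops[OF inv AE that A] by (simp add: measure_def enn2real_mult)
  show "measure \<nu> A = measure (loop_measure (pi / 2)) A * measure \<nu> loop1
     + measure (loop_measure (3 * pi / 2)) A * measure \<nu> loop2"
    using split[OF A] m by simp
  have "space \<nu> = UNIV" using sets_eq_imp_space_eq[OF sets] by simp
  then show "measure \<nu> loop1 + measure \<nu> loop2 = 1"
    using split[of UNIV] prob_space by simp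
qed

text \<open>
On the loops the velocity is a function of the loop alone.
\<close>
lemma rotation_on_loops:
  assumes inv: "invariant_prob \<nu>" and AE: "AE w in \<nu>. w \<in> loop1 \<union> loop2"
  shows "rotation \<nu> = (0, (measure \<nu> loop1 * (sqrt 2 / 3) + measure \<nu> loop2 * sqrt 2) / (2 * pi))"
proof (rule prod_eqI)
  interpret prob_space \<nu> using inv by (simp add: invariant_prob_def)
  have sets: "sets \<nu> = sets borel" using inv by (simp add: invariant_prob_def)
  have [measurable]: "loop1 \<in> sets \<nu>" "loop2 \<in> sets \<nu>" by (simp_all only: sets loops_borel)
  have eq: "snd w = (0, indicator loop1 w * (sqrt 2 / 3) + indicator loop2 w * sqrt 2)"
    if "w \<in> loop1 \<union> loop2" for w
  proof (cases "w \<in> loop1")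
    case True
    then have "w \<notin> loop2" using loops_disjoint by blast
    moreover have "snd w = (0, sqrt 2 / 3)"
      using snd_loop_orbit[OF True] by (simp only: loop_speeds)
    ultimately show ?thesis using True by simp
  next
    case False
    then have "w \<in> loop2" using that by blast
    moreover from snd_loop_orbit[OF this] have "snd w = (0, sqrt 2)"
      by (simp only: loop_speeds)
    ultimately show ?thesis using False by simp
  qed
  have [measurable]: "(\<lambda>w. snd (snd w)) \<in> borel_measurable \<nu>" "(\<lambda>w. fst (snd w)) \<in> borel_measurable \<nu>"
    using snd_rotation(3,4)[OF inv] by auto
  have "(\<integral>w. fst (snd w) \<partial>\<nu>) = (\<integral>w. 0 \<partial>\<nu>)"
    by (intro integral_cong_AE AE_mp[OF AE AE_I2] impI) (simp_all add: eq)
  then show "fst (rotation \<nu>) = fst (0::real, (measure \<nu> loop1 * (sqrt 2 / 3) + measure \<nu> loop2 * sqrt 2) / (2 * pi))"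
    by (simp add: snd_rotation(2)[OF inv])
  have [simp]: "integrable \<nu> (indicat_real loop1)" "integrable \<nu> (indicat_real loop2)"
    by (intro integrable_real_indicator; simp add: emeasure_eq_measure)+
  have "(\<integral>w. snd (snd w) \<partial>\<nu>) = (\<integral>w. indicator loop1 w * (sqrt 2 / 3) + indicator loop2 w * sqrt 2 \<partial>\<nu>)"
    by (intro integral_cong_AE AE_mp[OF AE AE_I2] impI) (simp_all add: eq)
  also have "\<dots> = measure \<nu> loop1 * (sqrt 2 / 3) + measure \<nu> loop2 * sqrt 2"
    by (subst Bochner_Integration.integral_add) (intro integrable_mult_left, simp_all)
  finally show "snd (rotation \<nu>) = snd (0::real, (measure \<nu> loop1 * (sqrt 2 / 3) + measure \<nu> loop2 * sqrt 2) / (2 * pi))"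
    by (simp add: snd_rotation(1)[OF inv])
qed

section \<open>Minimal measures\<close>

definition mixture :: "real \<Rightarrow> 'a measure \<Rightarrow> 'a measure \<Rightarrow> 'a measure" where
  "mixture a \<mu> \<nu> = measure_of (space \<mu>) (sets \<mu>)
     (\<lambda>A. ennreal (1 - a) * emeasure \<mu> A + ennreal a * emeasure \<nu> A)"

lemma sets_mixture [simp]: "sets (mixture a \<mu> \<nu>) = sets \<mu>" "space (mixture a \<mu> \<nu>) = space \<mu>"
  by (simp_all add: mixture_def sets.space_closed sets.sigma_sets_eq)

lemma emeasure_mixture:
  assumes sets: "sets \<nu> = sets \<mu>" and A: "A \<in> sets \<mu>"
  shows "emeasure (mixture a \<mu> \<nu>) A = ennreal (1 - a) * emeasure \<mu> A + ennreal a * emeasure \<nu> A"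
  unfolding mixture_def
proof (rule emeasure_measure_of_sigma[OF sets.sigma_algebra_axioms _ _ A])
  let ?f = "\<lambda>A. ennreal (1 - a) * emeasure \<mu> A + ennreal a * emeasure \<nu> A"
  show "positive (sets \<mu>) ?f" by (simp add: positive_def)
  show "countably_additive (sets \<mu>) ?f"
  proof (rule countably_additiveI)
    fix F :: "nat \<Rightarrow> 'a set" assume F: "range F \<subseteq> sets \<mu>" "disjoint_family F"
    have "(\<Sum>i. ?f (F i)) = ennreal (1 - a) * (\<Sum>i. emeasure \<mu> (F i)) + ennreal a * (\<Sum>i. emeasure \<nu> (F i))"
      by (simp add: suminf_add[symmetric])
    also have "\<dots> = ?f (\<Union> (range F))"
      using F by (simp add: suminf_emeasure sets)
    finally show "(\<Sum>i. ?f (F i)) = ?f (\<Union> (range F))" .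
  qed
qed

text \<open>
For an interior weight the mixture is supported on the union of the loops; here it suffices that its support
is a closed subset of this compact set.
\<close>
lemma exists_invariant_mixture:
  assumes a: "0 \<le> a" "a \<le> 1"
  obtains \<nu> where "invariant_prob \<nu>" "AE w in \<nu>. w \<in> loop1 \<union> loop2" "measure \<nu> loop2 = a"
proof -
  define \<mu>1 where "\<mu>1 = loop_measure (pi / 2)"
  define \<mu>2 where "\<mu>2 = loop_measure (3 * pi / 2)"
  define \<nu> where "\<nu> = mixture a \<mu>1 \<mu>2"
  have s: "sets \<mu>2 = sets \<mu>1" "sets \<mu>1 = sets borel" "space \<mu>1 = UNIV"
    by (simp_all add: \<mu>1_def \<mu>2_def)
  have em: "emeasure \<nu> A = ennreal (1 - a) * emeasure \<mu>1 A + ennreal a * emeasure \<mu>2 A"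
    if "A \<in> sets borel" for A
    unfolding \<nu>_def using emeasure_mixture[OF s(1)] that s(2) by simp
  have sets: "sets \<nu> = sets borel" "space \<nu> = UNIV" using s by (simp_all add: \<nu>_def)
  interpret p1: prob_space \<mu>1 unfolding \<mu>1_def by (rule prob_space_loop_measure)
  interpret p2: prob_space \<mu>2 unfolding \<mu>2_def by (rule prob_space_loop_measure)
  have one: "ennreal (1 - a) + ennreal a = 1" using a by (simp flip: ennreal_plus)
  have "emeasure \<mu>1 UNIV = 1" "emeasure \<mu>2 UNIV = 1"
    using p1.emeasure_space_1 p2.emeasure_space_1 sets_eq_imp_space_eq[OF s(1)] s(3) by auto
  then interpret prob_space \<nu>
    by (intro prob_spaceI) (simp add: sets em one)
  have AE1: "AE w in \<mu>1. w \<in> loop1" unfolding \<mu>1_def by (rule AE_loop_measure[OF cos_loops(1)])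
  have AE2: "AE w in \<mu>2. w \<in> loop2" unfolding \<mu>2_def by (rule AE_loop_measure[OF cos_loops(2)])
  have full: "emeasure \<mu>1 loop1 = 1" "emeasure \<mu>2 loop2 = 1"
    using p1.prob_eq_1[of loop1] p2.prob_eq_1[of loop2] AE1 AE2 loops_borel s
    by (simp_all add: p1.emeasure_eq_measure p2.emeasure_eq_measure)
  have zero: "emeasure \<mu>1 B = 0" if "B \<in> sets borel" "B \<inter> loop1 = {}" for B
  proof -
    have "AE w in \<mu>1. w \<notin> B" using AE1 that(2) by auto
    then show ?thesis using p1.prob_eq_0[of B] that s by (simp add: p1.emeasure_eq_measure)
  qed
  have zero2: "emeasure \<mu>2 B = 0" if "B \<in> sets borel" "B \<inter> loop2 = {}" for B
  proof -
    have "AE w in \<mu>2. w \<notin> B" using AE2 that(2) by auto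
    then show ?thesis using p2.prob_eq_0[of B] that s by (simp add: p2.emeasure_eq_measure)
  qed
  define N where "N = - (loop1 \<union> loop2)"
  have cl: "closed (loop1 \<union> loop2)" by (intro closed_Un closed_loop_orbit cos_loops)
  have "open N" unfolding N_def by (rule open_Compl[OF cl])
  then have N: "open N" "N \<in> sets borel" by (simp_all only: borel_open)
  have N0: "emeasure \<nu> N = 0"
    using em[OF N(2)] zero[OF N(2)] zero2[OF N(2)] by (auto simp: N_def)
  have AE: "AE w in \<nu>. w \<in> loop1 \<union> loop2"
    by (rule AE_I[of _ _ N]) (use N N0 sets in \<open>auto simp: N_def\<close>)
  have "msupport \<nu> \<subseteq> loop1 \<union> loop2"
  proof (rule subsetI, rule ccontr)
    fix w assume "w \<in> msupport \<nu>" "w \<notin> loop1 \<union> loop2"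
    then have "emeasure \<nu> N > 0" using N by (auto simp: msupport_def N_def)
    then show False using N0 by simp
  qed
  then have "msupport \<nu> = (loop1 \<union> loop2) \<inter> msupport \<nu>" by blast
  moreover have "compact \<dots>"
    by (intro compact_Int_closed compact_Un compact_loop_orbit closed_msupport)
  ultimately have comp: "compact (msupport \<nu>)" by simp
  have "emeasure \<nu> (EL_flow t -` A) = emeasure \<nu> A" if A: "A \<in> sets borel" for t A
    using invariant_loop_measure[OF cos_loops(1)] invariant_loop_measure[OF cos_loops(2)] A
      em[OF A] em[OF measurable_sets_borel[OF measurable_EL_flow A]]
    by (simp add: invariant_prob_def \<mu>1_def \<mu>2_def)
  then have "invariant_prob \<nu>"
    using comp sets prob_space_axioms by (simp add: invariant_prob_def)
  moreover have "emeasure \<nu> loop2 = ennreal a"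
    using em[OF loops_borel(2)] zero[OF loops_borel(2)] full loops_disjoint by (simp add: Int_commute)
  then have "measure \<nu> loop2 = a" using a by (simp add: measure_def)
  ultimately show thesis using AE that by blast
qed

text \<open>
The mass that the second loop must carry for the vertical rotation number \<open>\<rho>\<close>; it increases from
0 to 1 on the interval between the rotation numbers of the loops.
\<close>
definition loop2_weight :: "real \<Rightarrow> real" where
  "loop2_weight \<rho> = (sqrt 2 * pi * \<rho> - 1 / 3) * (3 / 2)"

abbreviation (input) \<rho>1 :: real where "\<rho>1 \<equiv> 1 / (3 * sqrt 2 * pi)"
abbreviation (input) \<rho>2 :: real where "\<rho>2 \<equiv> 1 / (sqrt 2 * pi)"

lemma loop2_weight_iff:
  assumes "m1 + m2 = 1"
  shows "(m1 * (sqrt 2 / 3) + m2 * sqrt 2) / (2 * pi) = \<rho> \<longleftrightarrow> m2 = loop2_weight \<rho>"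
proof -
  have m1: "m1 = 1 - m2" using assms by simp
  have "(m1 * (sqrt 2 / 3) + m2 * sqrt 2) / (2 * pi) = \<rho> \<longleftrightarrow> (1 / 3 + m2 * (2 / 3)) * sqrt 2 = 2 * pi * \<rho>"
    unfolding m1 by (simp add: field_simps)
  also have "\<dots> \<longleftrightarrow> sqrt 2 * ((1 / 3 + m2 * (2 / 3)) * sqrt 2) = sqrt 2 * (2 * pi * \<rho>)" by simp
  also have "sqrt 2 * ((1 / 3 + m2 * (2 / 3)) * sqrt 2) = (sqrt 2 * sqrt 2) * (1 / 3 + m2 * (2 / 3))"
    by (simp only: mult_ac)
  also have "\<dots> = 2 / 3 + m2 * (4 / 3)" by (simp add: algebra_simps)
  also have "2 / 3 + m2 * (4 / 3) = sqrt 2 * (2 * pi * \<rho>) \<longleftrightarrow> m2 = loop2_weight \<rho>"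
    unfolding loop2_weight_def by (simp add: field_simps) linarith
  finally show ?thesis .
qed

lemma loop2_weight_endpoints: "loop2_weight \<rho>1 = 0" "loop2_weight \<rho>2 = 1"
  by (simp_all add: loop2_weight_def field_simps)

lemma loop2_weight_bounds:
  assumes "\<rho> \<in> {\<rho>1 .. \<rho>2}" shows "0 \<le> loop2_weight \<rho>" "loop2_weight \<rho> \<le> 1"
proof -
  have "loop2_weight x \<le> loop2_weight y" if "x \<le> y" for x y
    using that unfolding loop2_weight_def by simp
  then have "loop2_weight \<rho>1 \<le> loop2_weight \<rho>" "loop2_weight \<rho> \<le> loop2_weight \<rho>2" using assms by auto
  then show "0 \<le> loop2_weight \<rho>" "loop2_weight \<rho> \<le> 1" by (simp_all only: loop2_weight_endpoints)
qed

lemma rotation_on_loops_iff: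
  assumes inv: "invariant_prob \<nu>" and AE: "AE w in \<nu>. w \<in> loop1 \<union> loop2"
  shows "rotation \<nu> = (0, \<rho>) \<longleftrightarrow> measure \<nu> loop2 = loop2_weight \<rho>"
  unfolding rotation_on_loops[OF assms]
  using loop2_weight_iff[OF measure_invariant_on_loops(2)[OF inv AE loops_borel(1)]] by simp

text \<open>
The calibration gives the lower bound \<open>sqrt 2 * (2 * pi * \<rho>)\<close> for the action, and a mixture of the
two uniform measures attains it. Thus the minimal measures are those carried by the loops.
\<close>
lemma minimal_measure_iff:
  assumes \<rho>: "\<rho> \<in> {\<rho>1 .. \<rho>2}"
  shows "minimal_measure \<nu> \<and> rotation \<nu> = (0, \<rho>) \<longleftrightarrow>
    invariant_prob \<nu> \<and> (AE w in \<nu>. w \<in> loop1 \<union> loop2) \<and> measure \<nu> loop2 = loop2_weight \<rho>"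
proof -
  define K where "K = {\<nu>. invariant_prob \<nu> \<and> rotation \<nu> = (0, \<rho>)}"
  define m where "m = sqrt 2 * (2 * pi * \<rho>)"
  obtain \<mu> where \<mu>: "invariant_prob \<mu>" "AE w in \<mu>. w \<in> loop1 \<union> loop2" "measure \<mu> loop2 = loop2_weight \<rho>"
    using exists_invariant_mixture[OF loop2_weight_bounds[OF \<rho>]] by blast
  then have r\<mu>: "rotation \<mu> = (0, \<rho>)" using rotation_on_loops_iff by blast
  have ge: "m \<le> average_action \<nu>" if "\<nu> \<in> K" for \<nu>
    using that average_action_ge(1)[of \<nu>] by (simp add: K_def m_def)
  have eq: "average_action \<nu> = m \<longleftrightarrow> (AE w in \<nu>. w \<in> loop1 \<union> loop2)" if "\<nu> \<in> K" for \<nu>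
    using that average_action_ge(2)[of \<nu>] by (simp add: K_def m_def)
  have "\<mu> \<in> K" using \<mu> r\<mu> by (simp add: K_def)
  then have "m \<in> average_action ` K" using eq \<mu>(2) by (metis image_eqI)
  then have INF: "(INF \<nu> \<in> K. average_action \<nu>) = m"
    by (rule cInf_eq_minimum) (use ge in auto)
  have "minimal_measure \<nu> \<and> rotation \<nu> = (0, \<rho>) \<longleftrightarrow> \<nu> \<in> K \<and> average_action \<nu> = m"
  proof -
    have "minimal_measure \<nu> \<and> rotation \<nu> = (0, \<rho>) \<longleftrightarrow>
        invariant_prob \<nu> \<and> rotation \<nu> = (0, \<rho>) \<and> average_action \<nu> = (INF \<nu> \<in> K. average_action \<nu>)"
      unfolding minimal_measure_def K_def by auto
    then show ?thesis unfolding INF by (auto simp: K_def)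
  qed
  also have "\<dots> \<longleftrightarrow> \<nu> \<in> K \<and> (AE w in \<nu>. w \<in> loop1 \<union> loop2)" using eq by blast
  also have "\<dots> \<longleftrightarrow> invariant_prob \<nu> \<and> (AE w in \<nu>. w \<in> loop1 \<union> loop2) \<and> measure \<nu> loop2 = loop2_weight \<rho>"
    unfolding K_def using rotation_on_loops_iff by auto
  finally show ?thesis .
qed

lemma minimal_measure_convex_combination:
  assumes \<rho>: "\<rho> \<in> {\<rho>1 .. \<rho>2}"
  shows "\<exists>!\<mu>. minimal_measure \<mu> \<and> rotation \<mu> = (0, \<rho>)"
    and "minimal_measure \<mu> \<Longrightarrow> rotation \<mu> = (0, \<rho>) \<Longrightarrow>
      convex_combination \<mu> (loop_measure (pi / 2)) (loop_measure (3 * pi / 2))"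
proof -
  have formula: "measure \<nu> A = (1 - loop2_weight \<rho>) * measure (loop_measure (pi / 2)) A
      + loop2_weight \<rho> * measure (loop_measure (3 * pi / 2)) A"
    if "minimal_measure \<nu> \<and> rotation \<nu> = (0, \<rho>)" and A: "A \<in> sets borel" for \<nu> A
  proof -
    from that(1) have \<nu>: "invariant_prob \<nu>" "AE w in \<nu>. w \<in> loop1 \<union> loop2" "measure \<nu> loop2 = loop2_weight \<rho>"
      unfolding minimal_measure_iff[OF \<rho>] by auto
    have "measure \<nu> loop1 = 1 - loop2_weight \<rho>" using measure_invariant_on_loops(2)[OF \<nu>(1,2) A] \<nu>(3) by simp
    then show ?thesis using measure_invariant_on_loops(1)[OF \<nu>(1,2) A] \<nu>(3) by (simp add: mult.commute)
  qed
  have inv: "invariant_prob \<nu>" if "minimal_measure \<nu> \<and> rotation \<nu> = (0, \<rho>)" for \<nu>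
    using that unfolding minimal_measure_iff[OF \<rho>] by auto
  show "\<exists>!\<mu>. minimal_measure \<mu> \<and> rotation \<mu> = (0, \<rho>)"
  proof (rule ex_ex1I)
    show "\<exists>\<mu>. minimal_measure \<mu> \<and> rotation \<mu> = (0, \<rho>)"
      unfolding minimal_measure_iff[OF \<rho>]
      using exists_invariant_mixture[OF loop2_weight_bounds[OF \<rho>]] by blast
    fix \<mu> \<nu>
    assume m: "minimal_measure \<mu> \<and> rotation \<mu> = (0, \<rho>)" "minimal_measure \<nu> \<and> rotation \<nu> = (0, \<rho>)"
    have s: "sets \<mu> = sets borel" "sets \<nu> = sets borel" "prob_space \<mu>" "prob_space \<nu>"
      using inv[OF m(1)] inv[OF m(2)] by (auto simp: invariant_prob_def)
    interpret a: prob_space \<mu> by (rule s(3))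
    interpret b: prob_space \<nu> by (rule s(4))
    show "\<mu> = \<nu>"
    proof (rule measure_eqI)
      show "sets \<mu> = sets \<nu>" by (simp only: s)
      fix A assume "A \<in> sets \<mu>"
      then have "A \<in> sets borel" by (simp only: s)
      then show "emeasure \<mu> A = emeasure \<nu> A"
        by (simp only: a.emeasure_eq_measure b.emeasure_eq_measure formula[OF m(1)] formula[OF m(2)])
    qed
  qed
  assume "minimal_measure \<mu>" "rotation \<mu> = (0, \<rho>)"
  then have m: "minimal_measure \<mu> \<and> rotation \<mu> = (0, \<rho>)" by simp
  have "sets \<mu> = sets borel" using inv[OF m] by (simp add: invariant_prob_def)
  then show "convex_combination \<mu> (loop_measure (pi / 2)) (loop_measure (3 * pi / 2))"
    unfolding convex_combination_def using formula[OF m] loop2_weight_bounds[OF \<rho>]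
    by (auto intro!: bexI[of _ "loop2_weight \<rho>"])
qed

lemma loop_measure_minimal:
  "minimal_measure (loop_measure (pi / 2))" "rotation (loop_measure (pi / 2)) = (0, \<rho>1)"
  "minimal_measure (loop_measure (3 * pi / 2))" "rotation (loop_measure (3 * pi / 2)) = (0, \<rho>2)"
proof -
  have le: "\<rho>1 \<le> \<rho>2" by (simp add: field_simps)
  have AE: "AE w in loop_measure c. w \<in> loop1 \<union> loop2" if "c \<in> {pi / 2, 3 * pi / 2}" for c
  proof -
    have "cos c = 0" using that by (elim insertE emptyE) (simp_all only: cos_loops)
    from AE_loop_measure[OF this] show ?thesis by (rule AE_mp) (rule AE_I2, use that in blast)
  qed
  interpret p1: prob_space "loop_measure (pi / 2)" by (rule prob_space_loop_measure)
  interpret p2: prob_space "loop_measure (3 * pi / 2)" by (rule prob_space_loop_measure)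
  have m1: "measure (loop_measure (pi / 2)) loop2 = loop2_weight \<rho>1"
  proof -
    have "AE w in loop_measure (pi / 2). w \<notin> loop2"
      by (rule AE_mp[OF AE_loop_measure[OF cos_loops(1)]], rule AE_I2) (use loops_disjoint in blast)
    then show ?thesis using p1.prob_eq_0 loops_borel(2) by (simp add: loop2_weight_endpoints)
  qed
  have m2: "measure (loop_measure (3 * pi / 2)) loop2 = loop2_weight \<rho>2"
    using p2.prob_eq_1 loops_borel(2) AE_loop_measure[OF cos_loops(2)] by (simp add: loop2_weight_endpoints)
  have "minimal_measure (loop_measure (pi / 2)) \<and> rotation (loop_measure (pi / 2)) = (0, \<rho>1)"
    using le AE m1 invariant_loop_measure[OF cos_loops(1)] by (subst minimal_measure_iff) auto
  moreover have "minimal_measure (loop_measure (3 * pi / 2)) \<and> rotation (loop_measure (3 * pi / 2)) = (0, \<rho>2)"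
    using le AE m2 invariant_loop_measure[OF cos_loops(2)] by (subst minimal_measure_iff) auto
  ultimately show
    "minimal_measure (loop_measure (pi / 2))" "rotation (loop_measure (pi / 2)) = (0, \<rho>1)"
    "minimal_measure (loop_measure (3 * pi / 2))" "rotation (loop_measure (3 * pi / 2)) = (0, \<rho>2)" by auto
qed

section \<open>Competitors that follow the loops\<close>

lemma lipschitz_imp_abs_continuous_curve:
  assumes "L-lipschitz_on {a..b} \<gamma>"
  shows "abs_continuous_curve a b \<gamma>"
  unfolding abs_continuous_curve_def
proof (intro allI impI)
  fix \<epsilon> :: real assume e: "\<epsilon> > 0"
  have L: "L \<ge> 0" using assms by (rule lipschitz_on_nonneg)
  show "\<exists>\<delta>>0. \<forall>(n :: nat) (s :: nat \<Rightarrow> real) (t :: nat \<Rightarrow> real). (\<forall>i<n. a \<le> s i \<and> s i \<le> t i \<and> t i \<le> b) \<and>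
        (\<forall>i<n. \<forall>j<n. i \<noteq> j \<longrightarrow> {s i<..<t i} \<inter> {s j<..<t j} = {}) \<and>
        (\<Sum>i<n. t i - s i) < \<delta> \<longrightarrow> (\<Sum>i<n. norm (\<gamma> (t i) - \<gamma> (s i))) < \<epsilon>"
  proof (intro exI[of _ "\<epsilon> / (L + 1)"] conjI allI impI)
    show "\<epsilon> / (L + 1) > 0" using e L by simp
    fix n :: nat and s t :: "nat \<Rightarrow> real"
    assume *: "(\<forall>i<n. a \<le> s i \<and> s i \<le> t i \<and> t i \<le> b) \<and>
        (\<forall>i<n. \<forall>j<n. i \<noteq> j \<longrightarrow> {s i<..<t i} \<inter> {s j<..<t j} = {}) \<and>
        (\<Sum>i<n. t i - s i) < \<epsilon> / (L + 1)"
    have "(\<Sum>i<n. norm (\<gamma> (t i) - \<gamma> (s i))) \<le> (\<Sum>i<n. (L + 1) * (t i - s i))"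
    proof (rule sum_mono)
      fix i assume "i \<in> {..<n}"
      then have i: "a \<le> s i" "s i \<le> t i" "t i \<le> b" using * by auto
      have "norm (\<gamma> (t i) - \<gamma> (s i)) \<le> L * norm (t i - s i)"
        by (rule lipschitz_on_normD[OF assms]) (use i in auto)
      also have "\<dots> \<le> (L + 1) * (t i - s i)" using i by (simp add: mult_right_mono)
      finally show "norm (\<gamma> (t i) - \<gamma> (s i)) \<le> (L + 1) * (t i - s i)" .
    qed
    also have "\<dots> = (L + 1) * (\<Sum>i<n. t i - s i)" by (simp add: sum_distrib_left)
    also have "\<dots> < \<epsilon>" using * L by (simp add: field_simps)
    finally show "(\<Sum>i<n. norm (\<gamma> (t i) - \<gamma> (s i))) < \<epsilon>" .
  qed
qed

text \<open>
The action of an arbitrary curve is the integral of a possibly nonmeasurable function, and such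
integrals do not add up when curves are concatenated. The measurable majorant \<open>g\<close> repairs this.
\<close>
definition connects :: "real \<Rightarrow> real \<Rightarrow> plane \<Rightarrow> plane \<Rightarrow> real \<Rightarrow> bool" where
  "connects a b A B K \<longleftrightarrow> a < b \<and> (\<exists>\<eta> L g. L-lipschitz_on {a..b} \<eta> \<and> \<eta> a = A \<and> \<eta> b = B \<and>
     g \<in> borel_measurable lebesgue \<and>
     (AE t in lebesgue. t \<in> {a..b} \<longrightarrow>
        ennreal (Lag (\<eta> t) (vector_derivative \<eta> (at t within {a..b}))) \<le> g t) \<and>
     (\<integral>\<^sup>+t \<in> {a..b}. g t \<partial>lebesgue) \<le> ennreal K)"

lemma connectsE:
  assumes "connects a b A B K"
  obtains \<eta> where "abs_continuous_curve a b \<eta>" "\<eta> a = A" "\<eta> b = B" "curve_action a b \<eta> \<le> ennreal K"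
proof -
  obtain \<eta> L g where h: "L-lipschitz_on {a..b} \<eta>" "\<eta> a = A" "\<eta> b = B"
     "AE t in lebesgue. t \<in> {a..b} \<longrightarrow>
        ennreal (Lag (\<eta> t) (vector_derivative \<eta> (at t within {a..b}))) \<le> g t"
     "(\<integral>\<^sup>+t \<in> {a..b}. g t \<partial>lebesgue) \<le> ennreal K"
    using assms unfolding connects_def by blast
  have "curve_action a b \<eta> \<le> (\<integral>\<^sup>+t \<in> {a..b}. g t \<partial>lebesgue)"
    unfolding curve_action_def
    by (rule nn_integral_mono_AE, rule AE_mp[OF h(4)], rule AE_I2) (auto split: split_indicator)
  then show thesis
    using that[OF lipschitz_imp_abs_continuous_curve[OF h(1)] h(2,3)] h(5) by (meson order_trans)
qed

lemma connects_mono: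
  assumes "connects a b A B K" "K \<le> K'"
  shows "connects a b A B K'"
proof -
  have "ennreal K \<le> ennreal K'" using assms(2) by (rule ennreal_leI)
  then have "x \<le> ennreal K \<longrightarrow> x \<le> ennreal K'" for x using order_trans by blast
  with assms(1) show ?thesis unfolding connects_def by blast
qed

lemma connects_line:
  assumes ab: "a < b" and B: "B = A + (b - a) *\<^sub>R v"
    and M: "\<And>s. Lag (A + s *\<^sub>R v) v \<le> M"
  shows "connects a b A B (M * (b - a))"
  unfolding connects_def
proof (intro conjI exI)
  define \<eta> where "\<eta> = (\<lambda>t. A + (t - a) *\<^sub>R v)"
  have M0: "M \<ge> 0" using order_trans[OF less_imp_le[OF Lag_pos] M] .
  show "a < b" by (rule ab)
  show "(norm v)-lipschitz_on {a..b} \<eta>"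
  proof (rule lipschitz_onI)
    fix x y
    have "\<eta> x - \<eta> y = (x - y) *\<^sub>R v" by (simp add: \<eta>_def algebra_simps)
    then show "dist (\<eta> x) (\<eta> y) \<le> norm v * dist x y" by (simp add: dist_norm mult.commute)
  qed simp
  show "\<eta> a = A" "\<eta> b = B" by (simp_all add: \<eta>_def B)
  show "(\<lambda>t::real. ennreal M) \<in> borel_measurable lebesgue" by simp
  have d: "(\<eta> has_vector_derivative v) (at t)" for t
    unfolding \<eta>_def by (auto intro!: derivative_eq_intros simp: has_vector_derivative_def)
  show "AE t in lebesgue. t \<in> {a..b} \<longrightarrow>
        ennreal (Lag (\<eta> t) (vector_derivative \<eta> (at t within {a..b}))) \<le> ennreal M"
  proof (intro AE_I2 impI)
    fix t assume "t \<in> {a..b}"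
    then have "vector_derivative \<eta> (at t within {a..b}) = v"
      using vector_derivative_at_within_ivl[OF d] ab by auto
    then show "ennreal (Lag (\<eta> t) (vector_derivative \<eta> (at t within {a..b}))) \<le> ennreal M"
      using M[of "t - a"] by (simp add: \<eta>_def ennreal_leI)
  qed
  have "(\<integral>\<^sup>+t \<in> {a..b}. ennreal M \<partial>lebesgue) = ennreal M * emeasure lebesgue {a..b}"
    by (rule nn_integral_cmult_indicator) simp
  also have "\<dots> = ennreal (M * (b - a))" using ab M0 by (simp add: ennreal_mult)
  finally show "(\<integral>\<^sup>+t \<in> {a..b}. ennreal M \<partial>lebesgue) \<le> ennreal (M * (b - a))" by simp
qed

text \<open>
At the junction the derivative of the concatenated curve is arbitrary, but this concerns a null set
only.
\<close>
lemma connects_concat: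
  assumes 1: "connects a b A B K1" and 2: "connects b c B C K2" and K: "K1 \<ge> 0" "K2 \<ge> 0"
  shows "connects a c A C (K1 + K2)"
proof -
  obtain \<eta>1 L1 g1 where h1: "L1-lipschitz_on {a..b} \<eta>1" "\<eta>1 a = A" "\<eta>1 b = B"
     "g1 \<in> borel_measurable lebesgue" "AE t in lebesgue. t \<in> {a..b} \<longrightarrow>
        ennreal (Lag (\<eta>1 t) (vector_derivative \<eta>1 (at t within {a..b}))) \<le> g1 t"
     "(\<integral>\<^sup>+t \<in> {a..b}. g1 t \<partial>lebesgue) \<le> ennreal K1" and ab: "a < b"
    using 1 unfolding connects_def by blast
  obtain \<eta>2 L2 g2 where h2: "L2-lipschitz_on {b..c} \<eta>2" "\<eta>2 b = B" "\<eta>2 c = C"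
     "g2 \<in> borel_measurable lebesgue" "AE t in lebesgue. t \<in> {b..c} \<longrightarrow>
        ennreal (Lag (\<eta>2 t) (vector_derivative \<eta>2 (at t within {b..c}))) \<le> g2 t"
     "(\<integral>\<^sup>+t \<in> {b..c}. g2 t \<partial>lebesgue) \<le> ennreal K2" and bc: "b < c"
    using 2 unfolding connects_def by blast
  define \<eta> where "\<eta> = (\<lambda>t. if t \<le> b then \<eta>1 t else \<eta>2 t)"
  define g where "g = (\<lambda>t. g1 t * indicator {..b} t + g2 t * indicator {b<..} t)"
  have d1: "vector_derivative \<eta> (at t within {a..c}) = vector_derivative \<eta>1 (at t within {a..b})"
    if "a < t" "t < b" for t
  proof -
    have "vector_derivative \<eta> (at t) = vector_derivative \<eta>1 (at t)"
      by (rule vector_derivative_cong_eq[OF _ refl refl])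
         (use that eventually_nhds_in_open[of "{..<b}" t] in \<open>auto simp: \<eta>_def elim!: eventually_mono\<close>)
    then show ?thesis using that bc by (simp add: at_within_Icc_at)
  qed
  have d2: "vector_derivative \<eta> (at t within {a..c}) = vector_derivative \<eta>2 (at t within {b..c})"
    if "b < t" "t < c" for t
  proof -
    have "vector_derivative \<eta> (at t) = vector_derivative \<eta>2 (at t)"
      by (rule vector_derivative_cong_eq[OF _ refl refl])
         (use that eventually_nhds_in_open[of "{b<..}" t] in \<open>auto simp: \<eta>_def elim!: eventually_mono\<close>)
    then show ?thesis using that ab by (simp add: at_within_Icc_at)
  qed
  have ne: "AE t in lebesgue. t \<noteq> x" for x :: real
    by (rule AE_completion[OF AE_lborel_singleton])
  show ?thesis unfolding connects_def
  proof (intro conjI exI)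
    show "a < c" using ab bc by simp
    show "(max L1 L2)-lipschitz_on {a..c} \<eta>"
      unfolding \<eta>_def by (rule lipschitz_on_concat_max[OF h1(1) h2(1)]) (simp add: h1 h2)
    show "\<eta> a = A" "\<eta> c = C" using ab bc h1 h2 by (simp_all add: \<eta>_def)
    show "g \<in> borel_measurable lebesgue"
      unfolding g_def
      by (intro borel_measurable_add borel_measurable_times_ennreal h1(4) h2(4) borel_measurable_indicator) simp_all
    show "AE t in lebesgue. t \<in> {a..c} \<longrightarrow>
        ennreal (Lag (\<eta> t) (vector_derivative \<eta> (at t within {a..c}))) \<le> g t"
      using h1(5) h2(5) ne[of a] ne[of b] ne[of c]
    proof eventually_elim
      case (elim t)
      show ?case
      proof
        assume "t \<in> {a..c}"
        then consider "a < t" "t < b" | "b < t" "t < c" using elim by force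
        then show "ennreal (Lag (\<eta> t) (vector_derivative \<eta> (at t within {a..c}))) \<le> g t"
        proof cases
          case 1
          then show ?thesis using elim(1) d1[OF 1] by (simp add: \<eta>_def g_def)
        next
          case 2
          then show ?thesis using elim(2) d2[OF 2] by (simp add: \<eta>_def g_def)
        qed
      qed
    qed
    have "(\<integral>\<^sup>+t \<in> {a..c}. g t \<partial>lebesgue)
        \<le> (\<integral>\<^sup>+t. g1 t * indicator {a..b} t + g2 t * indicator {b..c} t \<partial>lebesgue)"
      using ab bc by (intro nn_integral_mono) (auto simp: g_def split: split_indicator)
    also have "\<dots> = (\<integral>\<^sup>+t \<in> {a..b}. g1 t \<partial>lebesgue) + (\<integral>\<^sup>+t \<in> {b..c}. g2 t \<partial>lebesgue)"
      by (intro nn_integral_add borel_measurable_times_ennreal h1(4) h2(4) borel_measurable_indicator) simp_all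
    also have "\<dots> \<le> ennreal K1 + ennreal K2" by (rule add_mono[OF h1(6) h2(6)])
    finally show "(\<integral>\<^sup>+t \<in> {a..c}. g t \<partial>lebesgue) \<le> ennreal (K1 + K2)"
      using K by (simp add: ennreal_plus)
  qed
qed

section \<open>The excess of a minimizer has infimum zero\<close>

lemma continuous_EL:
  assumes "EL_curve \<gamma>"
  shows "continuous_on UNIV \<gamma>" "continuous_on UNIV (velocity \<gamma>)"
proof -
  note D = EL_curveD[OF assms]
  show c: "continuous_on UNIV \<gamma>"
    using D(1) by (meson has_vector_derivative_continuous continuous_at_imp_continuous_on)
  have m: "continuous_on UNIV (\<lambda>t. mass (fst (\<gamma> t)))"
    unfolding mass_def by (intro continuous_intros c)
  have divide: "continuous_on UNIV h" if "continuous_on UNIV (\<lambda>t. mass (fst (\<gamma> t)) * h t)" for h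
  proof -
    have "continuous_on UNIV (\<lambda>t. mass (fst (\<gamma> t)) * h t / mass (fst (\<gamma> t)))"
      by (rule continuous_on_divide[OF that m]) (intro ballI mass_pos)
    moreover have "(\<lambda>t. mass (fst (\<gamma> t)) * h t / mass (fst (\<gamma> t))) = h"
      by (rule ext) simp
    ultimately show ?thesis by (simp only:)
  qed
  have 1: "continuous_on UNIV (\<lambda>t. fst (velocity \<gamma> t))"
    by (rule divide, intro continuous_at_imp_continuous_on ballI) (rule DERIV_isCont[OF D(4)])
  have 2: "continuous_on UNIV (\<lambda>t. snd (velocity \<gamma> t))"
    by (rule divide, subst D(5)) (rule continuous_on_const)
  from continuous_on_Pair[OF 1 2] show "continuous_on UNIV (velocity \<gamma>)" by simp
qed

text \<open>
The calibrating form is exact on the plane, so it contributes only a boundary term.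
\<close>
lemma curve_action_ge:
  assumes EL: "EL_curve \<gamma>" and T: "0 < T"
    and c: "\<And>t. c \<le> Lag (\<gamma> t) (velocity \<gamma> t) - sqrt 2 * snd (velocity \<gamma> t)"
  shows "ennreal (sqrt 2 * (snd (\<gamma> T) - snd (\<gamma> 0)) + c * T) \<le> curve_action 0 T \<gamma>"
proof -
  define f where "f = (\<lambda>t. Lag (\<gamma> t) (velocity \<gamma> t))"
  have "continuous_on UNIV f"
    unfolding f_def Lag_def mass_def potential_def using mass_pos(2)[unfolded mass_def]
    by (intro continuous_intros continuous_EL[OF EL]) auto
  then have "f integrable_on {0..T}"
    by (intro integrable_continuous_real) (rule continuous_on_subset, auto)
  then obtain J where J: "(f has_integral J) {0..T}" by (auto simp: integrable_on_def)
  have "((\<lambda>t. snd (velocity \<gamma> t)) has_integral (snd (\<gamma> T) - snd (\<gamma> 0))) {0..T}"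
    using EL_curveD(3)[OF EL] T
    by (intro fundamental_theorem_of_calculus)
       (auto simp: has_real_derivative_iff_has_vector_derivative intro: has_vector_derivative_at_within)
  from has_integral_add[OF has_integral_mult_right[OF this] has_integral_const_real[of c 0 T]]
  have "((\<lambda>t. sqrt 2 * snd (velocity \<gamma> t) + c) has_integral
     (sqrt 2 * (snd (\<gamma> T) - snd (\<gamma> 0)) + c * T)) {0..T}" using T by (simp add: mult.commute)
  from has_integral_le[OF this J]
  have "sqrt 2 * (snd (\<gamma> T) - snd (\<gamma> 0)) + c * T \<le> J" using c by (auto simp: f_def algebra_simps)
  then have "ennreal (sqrt 2 * (snd (\<gamma> T) - snd (\<gamma> 0)) + c * T) \<le> ennreal J" by (rule ennreal_leI)
  also have "ennreal J = (\<integral>\<^sup>+t. ennreal (indicator {0..T} t * f t) \<partial>lebesgue)"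
    unfolding nn_integral_completion
    by (rule nn_integral_has_integral_lebesgue[OF _ J, symmetric]) (simp add: f_def less_imp_le[OF Lag_pos])
  also have "\<dots> = curve_action 0 T \<gamma>"
    unfolding curve_action_def
  proof (rule nn_integral_cong)
    fix t
    show "ennreal (indicator {0..T} t * f t) =
      ennreal (Lag (\<gamma> t) (vector_derivative \<gamma> (at t within {0..T}))) * indicator {0..T} t"
      using vector_derivative_at_within_ivl[OF EL_curveD(1)[OF EL, of t], of 0 T] T
      by (auto simp: f_def split: split_indicator)
  qed
  finally show ?thesis .
qed

lemma rotation_limit:
  assumes "has_rotation_vector \<gamma> (r1, r2)"
  shows "((\<lambda>T. (fst (\<gamma> T) - fst (\<gamma> 0)) / T) \<longlongrightarrow> 2 * pi * r1) at_top"
    and "((\<lambda>T. (snd (\<gamma> T) - snd (\<gamma> 0)) / T) \<longlongrightarrow> 2 * pi * r2) at_top"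
proof -
  have "filterlim (\<lambda>T::real. (0::real, T)) (filtercomap (\<lambda>(a, b). b - a) at_top) at_top"
    unfolding filterlim_filtercomap_iff by (simp add: o_def filterlim_ident)
  from filterlim_compose[OF assms[unfolded has_rotation_vector_def] this]
  have lim: "((\<lambda>T. (1 / (2 * pi)) *\<^sub>R ((\<gamma> T - \<gamma> 0) /\<^sub>R T)) \<longlongrightarrow> (r1, r2)) at_top" by simp
  have cancel: "2 * pi * ((1 / (2 * pi)) * (inverse T * d)) = d / T" for T d :: real
  proof -
    have "2 * pi * ((1 / (2 * pi)) * y) = y" for y by simp
    then show ?thesis by (simp only: divide_inverse[of d] mult.commute[of d])
  qed
  from tendsto_mult[OF tendsto_const[of "2 * pi"] tendsto_fst[OF lim]]
  show "((\<lambda>T. (fst (\<gamma> T) - fst (\<gamma> 0)) / T) \<longlongrightarrow> 2 * pi * r1) at_top"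
    unfolding fst_scaleR fst_diff real_scaleR_def cancel by simp
  from tendsto_mult[OF tendsto_const[of "2 * pi"] tendsto_snd[OF lim]]
  show "((\<lambda>T. (snd (\<gamma> T) - snd (\<gamma> 0)) / T) \<longlongrightarrow> 2 * pi * r2) at_top"
    unfolding snd_scaleR snd_diff real_scaleR_def cancel by simp
qed

text \<open>
The three transitions of the competitor below have velocities of this size, whatever the length of
the time interval. The cost 63 is \<open>3 / 2 * (2\<^sup>2 + 6\<^sup>2) + 3\<close>.
\<close>
lemma connects_fast_line:
  assumes ab: "a < b"
    and 1: "\<bar>fst B - fst A\<bar> \<le> 2 * (b - a)" and 2: "\<bar>snd B - snd A\<bar> \<le> 6 * (b - a)"
  shows "connects a b A B (63 * (b - a))"
proof (rule connects_line[OF ab])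
  define v where "v = (B - A) /\<^sub>R (b - a)"
  show "B = A + (b - a) *\<^sub>R v" using ab by (simp add: v_def)
  have v: "fst v = (fst B - fst A) / (b - a)" "snd v = (snd B - snd A) / (b - a)"
    by (simp_all add: v_def divide_inverse mult.commute)
  have "\<bar>fst v\<bar> \<le> 2" "\<bar>snd v\<bar> \<le> 6"
    unfolding v abs_divide using 1 2 ab by (simp_all add: pos_divide_le_eq)
  then have "(fst v)\<^sup>2 \<le> 2\<^sup>2" "(snd v)\<^sup>2 \<le> 6\<^sup>2" by (metis abs_ge_zero power2_abs power_mono)+
  then have "(norm v)\<^sup>2 \<le> 40" by (simp add: power2_norm_plane)
  then show "Lag (A + s *\<^sub>R v) v \<le> 63" for s using Lag_le[of "A + s *\<^sub>R v" v] by simp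
qed

lemma connects_loop:
  assumes ab: "a < b" and c: "cos c = 0"
  shows "connects a b (c, y) (c, y + loop_speed c * (b - a)) (sqrt 2 * loop_speed c * (b - a))"
proof (rule connects_line[OF ab])
  show "(c, y + loop_speed c * (b - a)) = (c, y) + (b - a) *\<^sub>R (0, loop_speed c)"
    by (simp add: mult.commute)
  show "Lag ((c, y) + s *\<^sub>R (0, loop_speed c)) (0, loop_speed c) \<le> sqrt 2 * loop_speed c" for s
    using Lag_calibrated_eq_0_iff[of "(c, y) + s *\<^sub>R (0, loop_speed c)" "(0, loop_speed c)"] c by simp
qed

text \<open>
The competitor follows the first loop for a fraction \<open>1 - \<theta>\<close> of the time and the second one for a fraction
\<open>\<theta>\<close>, at no excess. The transitions to, between and from the loops take time \<open>e * T\<close> each, at bounded cost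
per unit of time.
\<close>
lemma connects_via_loops:
  assumes \<theta>: "0 < \<theta>" "\<theta> < 1" and s: "2 * pi * \<rho> = (1 - \<theta>) * (sqrt 2 / 3) + \<theta> * sqrt 2"
    and e: "0 < e" "e \<le> 1 / 6" and T: "0 < T"
    and A: "\<bar>pi / 2 - fst A\<bar> \<le> e * T" "\<bar>3 * pi / 2 - fst A\<bar> \<le> e * T" "pi \<le> e * T"
    and B: "\<bar>fst B - fst A\<bar> \<le> e * T" "\<bar>snd B - snd A - 2 * pi * \<rho> * T\<bar> \<le> e * T"
  shows "connects 0 T A B (sqrt 2 * (2 * pi * \<rho> * T) + 189 * e * T)"
proof -
  define R where "R = (1 - 3 * e) * T"
  have R: "R > 0" using e T by (simp add: R_def)
  have eT: "e * T > 0" using e T by simp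
  define t1 where "t1 = e * T"
  define t2 where "t2 = t1 + (1 - \<theta>) * R"
  define t3 where "t3 = t2 + e * T"
  define t4 where "t4 = t3 + \<theta> * R"
  have t: "0 < t1" "t1 < t2" "t2 < t3" "t3 < t4" "t4 < T"
  proof -
    show "0 < t1" "t2 < t3" using eT by (simp_all only: t1_def t3_def less_add_same_cancel1)
    show "t1 < t2" "t3 < t4" using R \<theta> by (simp_all add: t2_def t4_def)
    have "T - t4 = e * T" by (simp add: t1_def t2_def t3_def t4_def R_def algebra_simps)
    then show "t4 < T" using eT by linarith
  qed
  have len: "t1 - 0 = e * T" "t2 - t1 = (1 - \<theta>) * R" "t3 - t2 = e * T" "t4 - t3 = \<theta> * R" "T - t4 = e * T"
    by (simp_all add: t1_def t2_def t3_def t4_def R_def algebra_simps)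
  define y where "y = snd A"
  define y1 where "y1 = y + sqrt 2 / 3 * ((1 - \<theta>) * R)"
  define y2 where "y2 = y1 + sqrt 2 * (\<theta> * R)"
  have y2: "y2 = y + 2 * pi * \<rho> * R" unfolding y2_def y1_def s by (simp add: algebra_simps)
  have leg1: "connects 0 t1 A (pi / 2, y) (63 * (e * T))"
    using connects_fast_line[OF t(1), of "(pi / 2, y)" A] A eT unfolding len y_def by simp
  have leg2: "connects t1 t2 (pi / 2, y) (pi / 2, y1) (2 / 3 * ((1 - \<theta>) * R))"
    using connects_loop[OF t(2) cos_loops(1), of y] unfolding len y1_def loop_speeds by (simp add: mult.assoc)
  have leg3: "connects t2 t3 (pi / 2, y1) (3 * pi / 2, y1) (63 * (e * T))"
    using connects_fast_line[OF t(3), of "(3 * pi / 2, y1)" "(pi / 2, y1)"] A(3) eT unfolding len by simp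
  have leg4: "connects t3 t4 (3 * pi / 2, y1) (3 * pi / 2, y2) (2 * (\<theta> * R))"
    using connects_loop[OF t(4) cos_loops(2), of y1] unfolding len y2_def loop_speeds by (simp add: mult.assoc)
  have leg5: "connects t4 T (3 * pi / 2, y2) B (63 * (e * T))"
  proof -
    have "\<bar>fst B - 3 * pi / 2\<bar> \<le> 2 * (e * T)" using A(2) B(1) by linarith
    moreover have "\<bar>snd B - y2\<bar> \<le> 6 * (e * T)"
    proof -
      have "snd B - y2 = (snd B - snd A - 2 * pi * \<rho> * T) + 3 * (2 * pi * \<rho>) * (e * T)"
        unfolding y2 y_def R_def by (simp add: algebra_simps)
      moreover have "0 \<le> 2 * pi * \<rho>" "2 * pi * \<rho> \<le> 3 / 2"
      proof -
        show "0 \<le> 2 * pi * \<rho>" unfolding s using \<theta> by simp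
        have "sqrt 2 \<le> 3 / 2" by (rule real_le_lsqrt) (simp_all add: power2_eq_square)
        moreover have "2 * pi * \<rho> = sqrt 2 * (1 - 2 / 3 * (1 - \<theta>))" unfolding s by (simp add: field_simps)
        moreover have "sqrt 2 * (1 - 2 / 3 * (1 - \<theta>)) \<le> sqrt 2 * 1" using \<theta> by (intro mult_left_mono) auto
        ultimately show "2 * pi * \<rho> \<le> 3 / 2" by linarith
      qed
      then have "0 \<le> 3 * (2 * pi * \<rho>) * (e * T)" "3 * (2 * pi * \<rho>) * (e * T) \<le> 3 * (3 / 2) * (e * T)"
        using eT by (simp_all only: mult_nonneg_nonneg less_imp_le zero_le_numeral mult_right_mono mult_left_mono)
      ultimately show ?thesis using B(2) eT by linarith
    qed
    ultimately show ?thesis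
      using connects_fast_line[OF t(5), of B "(3 * pi / 2, y2)"] unfolding len by simp
  qed
  have nn: "0 \<le> 63 * (e * T)" "0 \<le> 2 / 3 * ((1 - \<theta>) * R)" "0 \<le> 2 * (\<theta> * R)"
    using \<theta> R e T by simp_all
  have all: "connects 0 T A B
     (63 * (e * T) + 2 / 3 * ((1 - \<theta>) * R) + 63 * (e * T) + 2 * (\<theta> * R) + 63 * (e * T))"
    using nn by (intro connects_concat[OF connects_concat[OF connects_concat[OF connects_concat
        [OF leg1 leg2] leg3] leg4] leg5]) simp_all
  have "2 / 3 * ((1 - \<theta>) * R) + 2 * (\<theta> * R) = sqrt 2 * (2 * pi * \<rho>) * R"
    unfolding s by (simp add: algebra_simps)
  also have "\<dots> \<le> sqrt 2 * (2 * pi * \<rho>) * T"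
  proof (rule mult_left_mono)
    show "R \<le> T" using e T by (simp add: R_def algebra_simps)
    show "0 \<le> sqrt 2 * (2 * pi * \<rho>)" unfolding s using \<theta> by simp
  qed
  finally have "63 * (e * T) + 2 / 3 * ((1 - \<theta>) * R) + 63 * (e * T) + 2 * (\<theta> * R) + 63 * (e * T)
    \<le> sqrt 2 * (2 * pi * \<rho> * T) + 189 * e * T" by (simp add: mult.assoc)
  then show ?thesis by (rule connects_mono[OF all])
qed

text \<open>
If the excess were at least \<open>c\<close> along the curve, its action over \<open>[0, T]\<close> would exceed that of the
loop-following competitor by about \<open>c * T\<close>, as both have the same vertical displacement up to an
error that is small compared with \<open>T\<close>.
\<close>
lemma minimizer_excess_inf:
  assumes EL: "EL_curve \<gamma>" and min: "EL_minimizer \<gamma>" and rot: "has_rotation_vector \<gamma> (0, \<rho>)"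
    and \<theta>: "0 < \<theta>" "\<theta> < 1" and s: "2 * pi * \<rho> = (1 - \<theta>) * (sqrt 2 / 3) + \<theta> * sqrt 2"
    and c: "c > 0"
  shows "\<exists>t. Lag (\<gamma> t) (velocity \<gamma> t) - sqrt 2 * snd (velocity \<gamma> t) < c"
proof (rule ccontr)
  assume "\<not> ?thesis"
  then have ge: "\<And>t. c \<le> Lag (\<gamma> t) (velocity \<gamma> t) - sqrt 2 * snd (velocity \<gamma> t)" by (simp add: not_less)
  \<comment> \<open>The errors below add up to \<open>(189 + sqrt 2) * e * T\<close>, less than \<open>400 * e * T\<close>.\<close>
  define e where "e = min (c / 400) (1 / 6)"
  have e: "0 < e" "e \<le> 1 / 6" "400 * e \<le> c" using c by (auto simp: e_def)
  have "\<forall>\<^sub>F T in at_top. dist ((fst (\<gamma> T) - fst (\<gamma> 0)) / T) (2 * pi * 0) < e"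
    "\<forall>\<^sub>F T in at_top. dist ((snd (\<gamma> T) - snd (\<gamma> 0)) / T) (2 * pi * \<rho>) < e"
    using rotation_limit[OF rot] e(1) by (auto dest: tendstoD)
  moreover have "\<forall>\<^sub>F T::real in at_top. x \<le> e * T" for x
    using eventually_ge_at_top[of "x / e"] by eventually_elim (use e in \<open>simp add: field_simps\<close>)
  moreover have "\<forall>\<^sub>F T::real in at_top. 0 < T" by (rule eventually_gt_at_top)
  ultimately have "\<forall>\<^sub>F T in at_top. 0 < T \<and> dist ((fst (\<gamma> T) - fst (\<gamma> 0)) / T) (2 * pi * 0) < e
     \<and> dist ((snd (\<gamma> T) - snd (\<gamma> 0)) / T) (2 * pi * \<rho>) < e
     \<and> \<bar>pi / 2 - fst (\<gamma> 0)\<bar> \<le> e * T \<and> \<bar>3 * pi / 2 - fst (\<gamma> 0)\<bar> \<le> e * T \<and> pi \<le> e * T"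
    by (intro eventually_conj) auto
  then obtain T where T: "0 < T" and d1: "dist ((fst (\<gamma> T) - fst (\<gamma> 0)) / T) (2 * pi * 0) < e"
     and d2: "dist ((snd (\<gamma> T) - snd (\<gamma> 0)) / T) (2 * pi * \<rho>) < e"
     and A: "\<bar>pi / 2 - fst (\<gamma> 0)\<bar> \<le> e * T" "\<bar>3 * pi / 2 - fst (\<gamma> 0)\<bar> \<le> e * T" "pi \<le> e * T"
    unfolding eventually_at_top_linorder by blast
  have B1: "\<bar>fst (\<gamma> T) - fst (\<gamma> 0)\<bar> \<le> e * T"
    using d1 T by (simp add: dist_real_def field_simps)
  have B2: "\<bar>snd (\<gamma> T) - snd (\<gamma> 0) - 2 * pi * \<rho> * T\<bar> \<le> e * T"
  proof -
    have "snd (\<gamma> T) - snd (\<gamma> 0) - 2 * pi * \<rho> * T = ((snd (\<gamma> T) - snd (\<gamma> 0)) / T - 2 * pi * \<rho>) * T"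
      using T by (simp add: field_simps)
    then have "\<bar>snd (\<gamma> T) - snd (\<gamma> 0) - 2 * pi * \<rho> * T\<bar> = \<bar>(snd (\<gamma> T) - snd (\<gamma> 0)) / T - 2 * pi * \<rho>\<bar> * T"
      using T by (simp add: abs_mult)
    also have "\<dots> \<le> e * T" using d2 T by (intro mult_right_mono) (auto simp: dist_real_def)
    finally show ?thesis .
  qed
  obtain \<eta> where \<eta>: "abs_continuous_curve 0 T \<eta>" "\<eta> 0 = \<gamma> 0" "\<eta> T = \<gamma> T"
    "curve_action 0 T \<eta> \<le> ennreal (sqrt 2 * (2 * pi * \<rho> * T) + 189 * e * T)"
    using connectsE[OF connects_via_loops[OF \<theta> s e(1,2) T A B1 B2]] .
  have rho: "0 \<le> 2 * pi * \<rho>" unfolding s using \<theta> by simp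
  have "ennreal (sqrt 2 * (snd (\<gamma> T) - snd (\<gamma> 0)) + c * T) \<le> curve_action 0 T \<gamma>"
    by (rule curve_action_ge[OF EL T ge])
  also have "\<dots> \<le> curve_action 0 T \<eta>" using min \<eta>(1-3) T unfolding EL_minimizer_def by blast
  also note \<eta>(4)
  finally have "sqrt 2 * (snd (\<gamma> T) - snd (\<gamma> 0)) + c * T \<le> sqrt 2 * (2 * pi * \<rho> * T) + 189 * e * T"
    using rho T e by (subst (asm) ennreal_le_iff) (auto intro!: add_nonneg_nonneg mult_nonneg_nonneg)
  moreover have "sqrt 2 * (2 * pi * \<rho> * T) - sqrt 2 * (e * T) \<le> sqrt 2 * (snd (\<gamma> T) - snd (\<gamma> 0))"
    unfolding right_diff_distrib[symmetric] using B2 by (intro mult_left_mono) auto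
  moreover have "sqrt 2 * (e * T) \<le> 2 * (e * T)"
  proof (rule mult_right_mono)
    show "sqrt 2 \<le> 2" by (rule real_le_lsqrt) simp_all
  qed (use e T in simp)
  moreover have "400 * (e * T) \<le> c * T" using e(3) T by (simp add: mult.assoc[symmetric])
  moreover have "e * T > 0" using e T by simp
  ultimately show False by linarith
qed

section \<open>Recurrent curves on the critical energy level\<close>

text \<open>
On the two loops the energy is 0 and the momentum is \<open>sqrt 2\<close>; the curve is shown to share these
values.
\<close>
definition energy :: "plane \<Rightarrow> plane \<Rightarrow> real" where
  "energy x v = mass (fst x) / 2 * (norm v)\<^sup>2 + potential (fst x)"

lemma energy_conserved:
  assumes EL: "EL_curve \<gamma>"
  shows "energy (\<gamma> t) (velocity \<gamma> t) = energy (\<gamma> 0) (velocity \<gamma> 0)"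
proof -
  define x where "x = (\<lambda>t. fst (\<gamma> t))"
  define v1 where "v1 = (\<lambda>t. fst (velocity \<gamma> t))"
  define v2 where "v2 = (\<lambda>t. snd (velocity \<gamma> t))"
  define p where "p = mass (x 0) * v2 0"
  define y where "y = (\<lambda>t. mass (x t) * v1 t)"
  have v2: "v2 t = p / mass (x t)" for t
    using EL_curveD(5)[OF EL, of t] by (simp add: p_def x_def v2_def field_simps)
  have v1: "v1 t = y t / mass (x t)" for t by (simp add: y_def)
  have e: "energy (\<gamma> t) (velocity \<gamma> t) = ((y t)\<^sup>2 + p\<^sup>2) / (2 * mass (x t)) + potential (x t)" for t
  proof -
    have "energy (\<gamma> t) (velocity \<gamma> t) = mass (x t) / 2 * ((v1 t)\<^sup>2 + (v2 t)\<^sup>2) + potential (x t)"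
      by (simp add: energy_def power2_norm_plane x_def v1_def v2_def)
    also have "mass (x t) / 2 * ((v1 t)\<^sup>2 + (v2 t)\<^sup>2) = ((y t)\<^sup>2 + p\<^sup>2) / (2 * mass (x t))"
      unfolding v1[of t] v2[of t] by (simp add: field_simps power2_eq_square)
    finally show ?thesis .
  qed
  have "((\<lambda>t. ((y t)\<^sup>2 + p\<^sup>2) / (2 * mass (x t)) + potential (x t)) has_real_derivative 0) (at t)" for t
  proof -
    have dx: "(x has_real_derivative v1 t) (at t)"
      using EL_curveD(2)[OF EL, of t] by (simp add: x_def v1_def)
    have dy: "(y has_real_derivative cos (x t) / 2 * ((v1 t)\<^sup>2 + (v2 t)\<^sup>2) + neg_potential_deriv (x t)) (at t)"
      using EL_curveD(4)[OF EL, of t] by (simp add: x_def v1_def v2_def y_def power2_norm_plane)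
    have "((\<lambda>t. ((y t)\<^sup>2 + p\<^sup>2) / (2 * mass (x t)) + potential (x t)) has_real_derivative
      ((2 * y t * (cos (x t) / 2 * ((v1 t)\<^sup>2 + (v2 t)\<^sup>2) + neg_potential_deriv (x t))) * (2 * mass (x t))
        - ((y t)\<^sup>2 + p\<^sup>2) * (2 * (cos (x t) * v1 t))) / (2 * mass (x t))\<^sup>2
       + - neg_potential_deriv (x t) * v1 t) (at t)"
      by (auto intro!: derivative_eq_intros dy DERIV_chain2[OF DERIV_mass dx] DERIV_chain2[OF DERIV_potential dx]
          simp: power2_eq_square)
    moreover have "((2 * y t * (cos (x t) / 2 * ((v1 t)\<^sup>2 + (v2 t)\<^sup>2) + neg_potential_deriv (x t))) * (2 * mass (x t))
        - ((y t)\<^sup>2 + p\<^sup>2) * (2 * (cos (x t) * v1 t))) / (2 * mass (x t))\<^sup>2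
       + - neg_potential_deriv (x t) * v1 t = 0"
      unfolding v1[of t] v2[of t] by (simp add: field_simps power2_eq_square)
    ultimately show ?thesis by simp
  qed
  from DERIV_isconst_all[OF allI[OF this]] show ?thesis unfolding e by blast
qed

text \<open>
The energy and the distance of the momentum from \<open>sqrt 2\<close> are both controlled by the excess. Being
conserved, they take their limiting values on the whole curve as soon as the excess comes close
to 0 somewhere.
\<close>
lemma zero_energy_of_excess_inf:
  assumes EL: "EL_curve \<gamma>"
    and inf: "\<And>c. c > 0 \<Longrightarrow> \<exists>t. Lag (\<gamma> t) (velocity \<gamma> t) - sqrt 2 * snd (velocity \<gamma> t) < c"
  shows "mass (fst (\<gamma> t)) * snd (velocity \<gamma> t) = sqrt 2"
    and "(mass (fst (\<gamma> t)) * fst (velocity \<gamma> t))\<^sup>2 = 4 * (cos (fst (\<gamma> t)))\<^sup>2"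
proof -
  define p where "p = mass (fst (\<gamma> 0)) * snd (velocity \<gamma> 0)"
  have p: "mass (fst (\<gamma> t)) * snd (velocity \<gamma> t) = p" for t
    unfolding p_def by (rule EL_curveD(5)[OF EL])
  have v2: "snd (velocity \<gamma> t) = p / mass (fst (\<gamma> t))" for t using p[of t] by (simp add: field_simps)
  have ex: "Lag (\<gamma> t) (velocity \<gamma> t) - sqrt 2 * snd (velocity \<gamma> t)
     = mass (fst (\<gamma> t)) / 2 * (fst (velocity \<gamma> t))\<^sup>2 + (p - sqrt 2)\<^sup>2 / (2 * mass (fst (\<gamma> t)))
       + 2 * (cos (fst (\<gamma> t)))\<^sup>2 / mass (fst (\<gamma> t))" for t
    unfolding Lag_calibrated unfolding v2 diff_divide_distrib[symmetric]
    by (simp add: power_divide field_simps power2_eq_square)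
  have "p = sqrt 2"
  proof (rule ccontr)
    assume "p \<noteq> sqrt 2"
    then have "(p - sqrt 2)\<^sup>2 / 6 > 0" by simp
    from inf[OF this] obtain t where t: "Lag (\<gamma> t) (velocity \<gamma> t) - sqrt 2 * snd (velocity \<gamma> t) < (p - sqrt 2)\<^sup>2 / 6"
      by blast
    have "(p - sqrt 2)\<^sup>2 / 6 \<le> (p - sqrt 2)\<^sup>2 / (2 * mass (fst (\<gamma> t)))"
      using mass_bounds[of "fst (\<gamma> t)"] by (intro divide_left_mono) auto
    moreover have "0 \<le> mass (fst (\<gamma> t)) / 2 * (fst (velocity \<gamma> t))\<^sup>2"
      "0 \<le> 2 * (cos (fst (\<gamma> t)))\<^sup>2 / mass (fst (\<gamma> t))" by simp_all
    ultimately show False using t unfolding ex by linarith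
  qed
  then show "mass (fst (\<gamma> t)) * snd (velocity \<gamma> t) = sqrt 2" using p by simp
  define E where "E = energy (\<gamma> 0) (velocity \<gamma> 0)"
  have en: "E = mass (fst (\<gamma> t)) / 2 * (fst (velocity \<gamma> t))\<^sup>2 - 2 * (cos (fst (\<gamma> t)))\<^sup>2 / mass (fst (\<gamma> t))" for t
  proof -
    define m where "m = mass (fst (\<gamma> t))"
    have m: "m > 0" by (simp add: m_def)
    have "E = energy (\<gamma> t) (velocity \<gamma> t)" unfolding E_def by (rule energy_conserved[OF EL, symmetric])
    also have "\<dots> = m / 2 * (fst (velocity \<gamma> t))\<^sup>2 + m / 2 * (sqrt 2 / m)\<^sup>2 + potential (fst (\<gamma> t))"
      by (simp add: energy_def power2_norm_plane v2 \<open>p = sqrt 2\<close> m_def distrib_left)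
    also have "m / 2 * (sqrt 2 / m)\<^sup>2 = 1 / m" using m by (simp add: power_divide power2_eq_square)
    also have "potential (fst (\<gamma> t)) = - (1 / m) - 2 * (cos (fst (\<gamma> t)))\<^sup>2 / m"
      unfolding m_def by (rule potential_eq)
    finally show ?thesis by (simp add: m_def)
  qed
  have "E = 0"
  proof (rule ccontr)
    assume "E \<noteq> 0"
    then have "\<bar>E\<bar> > 0" by simp
    from inf[OF this] obtain t where t: "Lag (\<gamma> t) (velocity \<gamma> t) - sqrt 2 * snd (velocity \<gamma> t) < \<bar>E\<bar>" by blast
    moreover have "0 \<le> mass (fst (\<gamma> t)) / 2 * (fst (velocity \<gamma> t))\<^sup>2"
      "0 \<le> 2 * (cos (fst (\<gamma> t)))\<^sup>2 / mass (fst (\<gamma> t))" "(p - sqrt 2)\<^sup>2 / (2 * mass (fst (\<gamma> t))) = 0"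
      using \<open>p = sqrt 2\<close> by simp_all
    ultimately show False using en[of t] unfolding ex by linarith
  qed
  then show "(mass (fst (\<gamma> t)) * fst (velocity \<gamma> t))\<^sup>2 = 4 * (cos (fst (\<gamma> t)))\<^sup>2"
    using en[of t] by (simp add: field_simps power2_eq_square)
qed

lemma recurrent_sin_limit:
  assumes "recurrent_curve \<gamma>"
  obtains s where "filterlim s at_top sequentially" "(\<lambda>n. sin (fst (\<gamma> (s n)))) \<longlonglongrightarrow> sin (fst (\<gamma> 0))"
proof -
  have EL: "EL_curve \<gamma>" using assms by (simp add: recurrent_curve_def)
  obtain s where s: "filterlim s at_top sequentially"
      "(\<lambda>n. EL_flow (s n) (tangent_lift \<gamma> 0)) \<longlonglongrightarrow> tangent_lift \<gamma> 0"
    using assms unfolding recurrent_curve_def recurrent_point_def by blast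
  have "(\<lambda>n. torus_sin (tangent_lift \<gamma> (s n))) \<longlonglongrightarrow> torus_sin (tangent_lift \<gamma> 0)"
    using continuous_on_tendsto_compose[OF continuous_torus_sin s(2)]
    by (simp add: EL_flow_tangent_lift[OF EL])
  then show thesis using that[OF s(1)] by (simp add: tangent_lift_tangent_proj torus_sin_tangent_proj del: tangent_proj_simp)
qed

text \<open>
On the critical level \<open>(cos x1)\<^sup>2\<close> satisfies a Gronwall inequality, hence vanishes everywhere or
nowhere. In the latter case the curve runs from one loop to the other: \<open>sin x1\<close> has a derivative
without zeros, so it is strictly monotone along the curve, which contradicts recurrence.
\<close>
lemma recurrent_calibrated_curve_vertical:
  assumes rec: "recurrent_curve \<gamma>"
    and v1: "\<And>t. (mass (fst (\<gamma> t)) * fst (velocity \<gamma> t))\<^sup>2 = 4 * (cos (fst (\<gamma> t)))\<^sup>2"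
  shows "cos (fst (\<gamma> 0)) = 0" "fst (\<gamma> t) = fst (\<gamma> 0)"
proof -
  have EL: "EL_curve \<gamma>" using rec by (simp add: recurrent_curve_def)
  define x where "x = (\<lambda>t. fst (\<gamma> t))"
  define u where "u = (\<lambda>t. fst (velocity \<gamma> t))"
  have dx: "(x has_real_derivative u t) (at t)" for t
    using EL_curveD(2)[OF EL, of t] by (simp add: x_def u_def)
  have cu: "continuous_on UNIV u" unfolding u_def by (intro continuous_on_fst continuous_EL[OF EL])
  have cx: "continuous_on UNIV x" unfolding x_def by (intro continuous_on_fst continuous_EL[OF EL])
  have u: "mass (x t) * \<bar>u t\<bar> = 2 * \<bar>cos (x t)\<bar>" for t
  proof -
    have "(mass (x t) * \<bar>u t\<bar>)\<^sup>2 = (2 * \<bar>cos (x t)\<bar>)\<^sup>2"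
      using v1[of t] by (simp add: power_mult_distrib x_def u_def)
    then show ?thesis by (rule power2_eq_imp_eq) simp_all
  qed
  have ule: "\<bar>u t\<bar> \<le> 2 * \<bar>cos (x t)\<bar>" for t
    using u[of t] mult_right_mono[OF mass_bounds(1)[of "x t"], of "\<bar>u t\<bar>"] by simp
  have dg: "((\<lambda>t. (cos (x t))\<^sup>2) has_real_derivative 2 * cos (x t) * (- sin (x t) * u t)) (at t)" for t
    by (auto intro!: derivative_eq_intros dx)
  have le: "\<bar>2 * cos (x t) * (- sin (x t) * u t)\<bar> \<le> 4 * (cos (x t))\<^sup>2" for t
  proof -
    have "\<bar>2 * cos (x t) * (- sin (x t) * u t)\<bar> = 2 * \<bar>cos (x t)\<bar> * (\<bar>sin (x t)\<bar> * \<bar>u t\<bar>)"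
      by (simp add: abs_mult)
    also have "\<dots> \<le> 2 * \<bar>cos (x t)\<bar> * (1 * (2 * \<bar>cos (x t)\<bar>))"
      using ule by (intro mult_left_mono mult_mono) auto
    also have "\<dots> = 4 * (cos (x t))\<^sup>2" by (simp add: power2_eq_square)
    finally show ?thesis .
  qed
  note G = gronwall_scalar[OF dg le]
  have "cos (x 0) = 0"
  proof (rule ccontr)
    assume "cos (x 0) \<noteq> 0"
    then have "0 < (cos (x 0))\<^sup>2 * exp (- (4 * \<bar>t\<bar>))" for t by simp
    then have nz: "cos (x t) \<noteq> 0" for t using G(2)[of t] by (metis not_less zero_power2)
    define r where "r = (\<lambda>t. cos (x t) * u t)"
    have r0: "r t \<noteq> 0" for t using u[of t] nz[of t] by (auto simp: r_def)
    have dS: "((\<lambda>t. sin (x t)) has_real_derivative r t) (at t)" for t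
      unfolding r_def by (auto intro!: derivative_eq_intros dx)
    have cr: "isCont r t" for t
      using cu cx unfolding r_def by (intro continuous_intros) (simp_all add: continuous_on_eq_continuous_at)
    have sign: "(\<forall>t. r t > 0) \<or> (\<forall>t. r t < 0)"
    proof (rule ccontr)
      assume "\<not> ?thesis"
      then obtain a b where "r a < 0" "0 < r b" using r0 by (meson linorder_neqE_linordered_idom)
      then have "\<exists>t. r t = 0"
      proof (cases "a \<le> b")
        case True
        then show ?thesis using IVT[of r a 0 b] \<open>r a < 0\<close> \<open>0 < r b\<close> cr by (meson less_imp_le)
      next
        case False
        then show ?thesis using IVT2[of r a 0 b] \<open>r a < 0\<close> \<open>0 < r b\<close> cr by (meson less_imp_le linear)
      qed
      then show False using r0 by blast
    qed
    obtain s where s: "filterlim s at_top sequentially" "(\<lambda>n. sin (x (s n))) \<longlonglongrightarrow> sin (x 0)"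
      using recurrent_sin_limit[OF rec] by (auto simp: x_def)
    have ev: "\<forall>\<^sub>F n in sequentially. 1 \<le> s n"
      using s(1) by (simp add: filterlim_at_top)
    from sign show False
    proof
      assume pos: "\<forall>t. r t > 0"
      have inc: "sin (x a) < sin (x b)" if "a < b" for a b
        using that by (rule DERIV_pos_imp_increasing) (use pos dS in blast)
      have "\<forall>\<^sub>F n in sequentially. sin (x 1) \<le> sin (x (s n))"
        using ev by eventually_elim (metis inc less_eq_real_def)
      from tendsto_lowerbound[OF s(2) this] have "sin (x 1) \<le> sin (x 0)" by simp
      then show False using inc[of 0 1] by simp
    next
      assume neg: "\<forall>t. r t < 0"
      have dec: "sin (x b) < sin (x a)" if "a < b" for a b
        using that by (rule DERIV_neg_imp_decreasing) (use neg dS in blast)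
      have "\<forall>\<^sub>F n in sequentially. sin (x (s n)) \<le> sin (x 1)"
        using ev by eventually_elim (metis dec less_eq_real_def)
      from tendsto_upperbound[OF s(2) this] have "sin (x 0) \<le> sin (x 1)" by simp
      then show False using dec[of 0 1] by simp
    qed
  qed
  then show "cos (fst (\<gamma> 0)) = 0" by (simp add: x_def)
  have "(cos (x t))\<^sup>2 \<le> 0" for t using G(1)[of t] \<open>cos (x 0) = 0\<close> by simp
  then have "u t = 0" for t using ule[of t] by simp
  then have "\<forall>t. (x has_real_derivative 0) (at t)" using dx by metis
  from DERIV_isconst_all[OF this] show "fst (\<gamma> t) = fst (\<gamma> 0)" unfolding x_def by blast
qed

text \<open>
The curve has to be one of the vertical loops, whose rotation vectors are the endpoints.
\<close>
lemma no_recurrent_minimizer: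
  assumes \<rho>: "\<rho>1 < \<rho>" "\<rho> < \<rho>2"
    and min: "EL_minimizer \<gamma>" and rec: "recurrent_curve \<gamma>" and rot: "has_rotation_vector \<gamma> (0, \<rho>)"
  shows False
proof -
  have EL: "EL_curve \<gamma>" using rec by (simp add: recurrent_curve_def)
  have ends: "2 * pi * \<rho>1 = sqrt 2 / 3" "2 * pi * \<rho>2 = sqrt 2"
    by (simp_all add: field_simps)
  have \<rho>': "sqrt 2 / 3 < 2 * pi * \<rho>" "2 * pi * \<rho> < sqrt 2"
    using mult_strict_left_mono[OF \<rho>(1), of "2 * pi"] mult_strict_left_mono[OF \<rho>(2), of "2 * pi"]
    unfolding ends by simp_all
  define \<theta> where "\<theta> = (2 * pi * \<rho> - sqrt 2 / 3) / (sqrt 2 * (2 / 3))"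
  have \<theta>: "0 < \<theta>" "\<theta> < 1" using \<rho>' by (simp_all add: \<theta>_def)
  have "\<theta> * (sqrt 2 * (2 / 3)) = 2 * pi * \<rho> - sqrt 2 / 3" by (simp add: \<theta>_def)
  then have s: "2 * pi * \<rho> = (1 - \<theta>) * (sqrt 2 / 3) + \<theta> * sqrt 2" by (simp add: field_simps)
  note Z = zero_energy_of_excess_inf[OF EL minimizer_excess_inf[OF EL min rot \<theta> s]]
  note V = recurrent_calibrated_curve_vertical[OF rec Z(2)]
  define c where "c = fst (\<gamma> 0)"
  have v2: "snd (velocity \<gamma> t) = loop_speed c" for t
    using Z(1)[of t] V(2)[of t] by (simp add: loop_speed_def c_def field_simps)
  have "\<forall>t. ((\<lambda>t. snd (\<gamma> t) - loop_speed c * t) has_real_derivative 0) (at t)"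
    using EL_curveD(3)[OF EL] v2 by (auto intro!: derivative_eq_intros)
  note const = DERIV_isconst_all[OF this]
  have lin: "snd (\<gamma> t) - snd (\<gamma> 0) = loop_speed c * t" for t
    using const[of t 0] by simp
  have "\<forall>\<^sub>F T::real in at_top. (snd (\<gamma> T) - snd (\<gamma> 0)) / T = loop_speed c"
    using eventually_gt_at_top[of 0] by eventually_elim (simp add: lin)
  then have "((\<lambda>T. (snd (\<gamma> T) - snd (\<gamma> 0)) / T) \<longlongrightarrow> loop_speed c) at_top" by (rule tendsto_eventually)
  from tendsto_unique[OF _ this rotation_limit(2)[OF rot]] have "loop_speed c = 2 * pi * \<rho>" by simp
  moreover have "sin c = 1 \<or> sin c = -1"
    using V(1) sin_cos_squared_add[of c] by (auto simp: c_def power2_eq_1_iff)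
  then have "loop_speed c = sqrt 2 / 3 \<or> loop_speed c = sqrt 2" by (auto simp: loop_speed_def mass_def)
  ultimately show False using \<rho>' by auto
qed

theorem mainTheorem6:
  fixes I :: "real set"
  defines "I \<equiv> {1 / (3 * sqrt 2 * pi) .. 1 / (sqrt 2 * pi)}"
  shows "(\<exists>\<mu>1 \<mu>2 Q1 Q2.
            minimal_measure \<mu>1 \<and> ergodic_measure \<mu>1 \<and>
            minimal_measure \<mu>2 \<and> ergodic_measure \<mu>2 \<and>
            periodic_orbit Q1 \<and> msupport \<mu>1 = Q1 \<and> fst ` Q1 = vertical_loop (pi / 2) \<and>
            periodic_orbit Q2 \<and> msupport \<mu>2 = Q2 \<and> fst ` Q2 = vertical_loop (3 * pi / 2) \<and>
            rotation \<mu>1 = (0, 1 / (3 * sqrt 2 * pi)) \<and>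
            rotation \<mu>2 = (0, 1 / (sqrt 2 * pi)) \<and>
            (\<forall>\<rho> \<in> I. (\<exists>!\<mu>. minimal_measure \<mu> \<and> rotation \<mu> = (0, \<rho>)) \<and>
               (\<forall>\<mu>. minimal_measure \<mu> \<and> rotation \<mu> = (0, \<rho>) \<longrightarrow> convex_combination \<mu> \<mu>1 \<mu>2))) \<and>
         (\<forall>\<rho> \<in> interior I.
            \<not> (\<exists>\<gamma>. EL_minimizer \<gamma> \<and> recurrent_curve \<gamma> \<and> has_rotation_vector \<gamma> (0, \<rho>)))"
proof (rule conjI)
  show "\<exists>\<mu>1 \<mu>2 Q1 Q2.
            minimal_measure \<mu>1 \<and> ergodic_measure \<mu>1 \<and>
            minimal_measure \<mu>2 \<and> ergodic_measure \<mu>2 \<and>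
            periodic_orbit Q1 \<and> msupport \<mu>1 = Q1 \<and> fst ` Q1 = vertical_loop (pi / 2) \<and>
            periodic_orbit Q2 \<and> msupport \<mu>2 = Q2 \<and> fst ` Q2 = vertical_loop (3 * pi / 2) \<and>
            rotation \<mu>1 = (0, 1 / (3 * sqrt 2 * pi)) \<and>
            rotation \<mu>2 = (0, 1 / (sqrt 2 * pi)) \<and>
            (\<forall>\<rho> \<in> I. (\<exists>!\<mu>. minimal_measure \<mu> \<and> rotation \<mu> = (0, \<rho>)) \<and>
               (\<forall>\<mu>. minimal_measure \<mu> \<and> rotation \<mu> = (0, \<rho>) \<longrightarrow> convex_combination \<mu> \<mu>1 \<mu>2))"
  proof (rule exI[of _ "loop_measure (pi / 2)"], rule exI[of _ "loop_measure (3 * pi / 2)"],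
      rule exI[of _ loop1], rule exI[of _ loop2], intro conjI ballI allI impI)
    fix \<rho> assume \<rho>: "\<rho> \<in> I"
    show "\<exists>!\<mu>. minimal_measure \<mu> \<and> rotation \<mu> = (0, \<rho>)"
      by (rule minimal_measure_convex_combination(1)[OF \<rho>[unfolded I_def]])
    fix \<mu> assume "minimal_measure \<mu> \<and> rotation \<mu> = (0, \<rho>)"
    then show "convex_combination \<mu> (loop_measure (pi / 2)) (loop_measure (3 * pi / 2))"
      using minimal_measure_convex_combination(2)[OF \<rho>[unfolded I_def]] by blast
  qed (fact loop_measure_minimal | rule ergodic_loop_measure periodic_orbit_loop
      msupport_loop_measure fst_loop_orbit cos_loops)+
  show "\<forall>\<rho> \<in> interior I.
            \<not> (\<exists>\<gamma>. EL_minimizer \<gamma> \<and> recurrent_curve \<gamma> \<and> has_rotation_vector \<gamma> (0, \<rho>))"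
    unfolding I_def interior_atLeastAtMost_real
    using no_recurrent_minimizer by (meson greaterThanLessThan_iff)
qed

end
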